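(* Let $\mathcal K,\tilde{\mathcal K}\subset\mathcal S$ be two embedded generic transversal curves, with bendings $\mathfrak k,\tilde{\mathfrak k}$ and twists $\mathfrak t,\tilde{\mathfrak t}$. Then $\mathcal K$ and $\tilde{\mathcal K}$ are congruent to each other (i.e. $\tilde{\mathcal K}=A\mathcal K$ for some $A\in G$) if and only if there exists an orientation-preserving diffeomorphism $h:\mathcal K\to\tilde{\mathcal K}$ such that $\tilde{\mathfrak k}\circ h=\mathfrak k$ and $\tilde{\mathfrak t}\circ h=\mathfrak t$. In addition, given two smooth functions $\kappa,\tau:J\to\mathbb R$ on an interval $J$, there exists a generic transversal curve $\gamma:J\to\mathcal S$, parametrized by the natural parameter, with bending $\kappa$ and twist $\tau$.
   Context: $\mathbb C^{2,1}$ is $\mathbb C^3$ with the Hermitian form $\langle \mathbf z,\mathbf w\rangle={}^t\overline{\mathbf z}\,\mathbf h\,\mathbf w$, $\mathbf h=\begin{pmatrix}0&0&i\\0&1&0\\-i&0&0\end{pmatrix}$. $\mathcal N$ is the set of nonzero null vectors and $\mathcal S=\{[\mathbf z]\in\mathbb{CP}^2:\langle\mathbf z,\mathbf z\rangle=0\}$ (the 3-sphere with its standard CR structure), with contact form $\zeta$ equal to the restriction to $T\mathcal S$ of $-i\langle\mathbf z,d\mathbf z\rangle/({}^t\overline{\mathbf z}\mathbf z)$. $G=\{A\in SL(3,\mathbb C):{}^t\bar A\mathbf hA=\mathbf h\}$ acts on $\mathcal S$ by $A[\mathbf z]=[A\mathbf z]$. Let $J\subseteq\mathbb R$ be an interval.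 A lift of a smooth curve $\gamma:J\to\mathcal S$ is a smooth map $\Gamma:J\to\mathcal N$ with $\gamma=[\Gamma]$. The curve $\gamma$ is transversal if $\zeta(\gamma')\ne0$ everywhere; transversal curves are always assumed positively parametrized, $\zeta(\gamma')>0$, i.e. $-i\langle\Gamma,\Gamma'\rangle>0$ (this also orients embedded transversal curves). A transversal curve $\gamma$ is generic if $\det(\Gamma,\Gamma',\Gamma'')$ is nowhere zero (this does not depend on the lift). A Wilczynski lift of a generic transversal curve is a lift with $\det(\Gamma,\Gamma',\Gamma'')=-1$; it is unique up to multiplication by a cube root of unity. The strain density is the real function $a_\gamma=i\langle\Gamma,\Gamma'\rangle^{-1}$, with $\Gamma$ a Wilczynski lift. The parametrization is natural (by the natural parameter) if $a_\gamma=1$; every generic transversal curve can be so parametrized. For a natural parametrization, the bending and twist are the real functions $\kappa=\frac12\langle\Gamma',\Gamma'\rangle$ and $\tau=\mathrm{Im}\langle\Gamma'',\Gamma'\rangle+3\kappa^2$, with $\Gamma$ any Wilczynski lift. For an embedded generic transversal curve $\mathcal K$ with natural parametrization $\gamma:J\to\mathcal K$, with bending $\kappa$ and twist $\tau$, the functions $\mathfrak k=\kappa\circ\gamma^{-1}$ and $\mathfrak t=\tau\circ\gamma^{-1}$ on $\mathcal K$ do not depend on the choice of $\gamma$; they are the bending and twist of $\mathcal K$.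
   Formalization: The diffeomorphism h is additionally required to preserve the natural parameter (strain element); without this the claim fails, e.g. for two arcs of different strain length on a curve with constant bending and twist. *)

theory Defs
  imports "HOL-Analysis.Analysis"
begin

section \<open>The Hermitian space and its group\<close>

definition hmat :: "complex^3^3" where
  "hmat = vector [vector [0, 0, \<i>], vector [0, 1, 0], vector [- \<i>, 0, 0]]"

definition herm :: "complex^3 \<Rightarrow> complex^3 \<Rightarrow> complex" where
  "herm z w = (\<Sum>i\<in>UNIV. \<Sum>j\<in>UNIV. cnj (z $ i) * hmat $ i $ j * w $ j)"

definition null_vectors :: "(complex^3) set" where
  "null_vectors = {z. z \<noteq> 0 \<and> herm z z = 0}"

definition G :: "(complex^3^3) set" where
  "G = {A. det A = 1 \<and> map_matrix cnj (transpose A) ** hmat ** A = hmat}"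

definition det3 :: "complex^3 \<Rightarrow> complex^3 \<Rightarrow> complex^3 \<Rightarrow> complex" where
  "det3 u v w = det (transpose (vector [u, v, w] :: complex^3^3))"


section \<open>The complex projective plane and the sphere\<close>

text \<open>A point of the projective plane is a complex line through the origin, as a set of vectors.\<close>

type_synonym point = "(complex^3) set"

definition pt :: "complex^3 \<Rightarrow> point" where
  "pt z = range (\<lambda>c. c *s z)"

definition CP2 :: "point set" where
  "CP2 = {pt z | z. z \<noteq> 0}"

definition S :: "point set" where
  "S = {pt z | z. z \<in> null_vectors}"

definition act :: "complex^3^3 \<Rightarrow> point \<Rightarrow> point" where
  "act A p = (\<lambda>z. A *v z) ` p"

text \<open>The quotient topology of the projection of the nonzero vectors onto \<^const>\<open>CP2\<close>.\<close>

definition CP2_topology :: "point topology" where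
  "CP2_topology = topology (\<lambda>U. U \<subseteq> CP2 \<and> open {z. z \<noteq> 0 \<and> pt z \<in> U})"

lemma openin_CP2_topology:
  "openin CP2_topology U \<longleftrightarrow> U \<subseteq> CP2 \<and> open {z. z \<noteq> 0 \<and> pt z \<in> U}"
proof -
  have "istopology (\<lambda>U. U \<subseteq> CP2 \<and> open {z. z \<noteq> 0 \<and> pt z \<in> U})"
    unfolding istopology_def
  proof (intro conjI allI impI)
    fix U V assume U: "U \<subseteq> CP2 \<and> open {z. z \<noteq> 0 \<and> pt z \<in> U}"
      and V: "V \<subseteq> CP2 \<and> open {z. z \<noteq> 0 \<and> pt z \<in> V}"
    show "U \<inter> V \<subseteq> CP2" using U by blast
    have "{z. z \<noteq> 0 \<and> pt z \<in> U \<inter> V}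
        = {z. z \<noteq> 0 \<and> pt z \<in> U} \<inter> {z. z \<noteq> 0 \<and> pt z \<in> V}" by blast
    then show "open {z. z \<noteq> 0 \<and> pt z \<in> U \<inter> V}" using U V by (simp add: open_Int)
  next
    fix \<K> assume K: "\<forall>U\<in>\<K>. U \<subseteq> CP2 \<and> open {z. z \<noteq> 0 \<and> pt z \<in> U}"
    then show "\<Union>\<K> \<subseteq> CP2" by blast
    have "{z. z \<noteq> 0 \<and> pt z \<in> \<Union>\<K>} = (\<Union>U\<in>\<K>. {z. z \<noteq> 0 \<and> pt z \<in> U})" by blast
    then show "open {z. z \<noteq> 0 \<and> pt z \<in> \<Union>\<K>}" using K by (simp add: open_UN)
  qed
  then show ?thesis unfolding CP2_topology_def by (simp add: topology_inverse')
qed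

text \<open>
  The affine chart around the points with nonvanishing coordinate \<open>i\<close>: \<open>chart i p\<close> is the
  representative of \<open>p\<close> whose coordinate \<open>i\<close> equals 1; its other two coordinates are the usual
  affine coordinates.
\<close>

definition chart_dom :: "3 \<Rightarrow> point set" where
  "chart_dom i = {p \<in> CP2. \<exists>z\<in>p. z $ i \<noteq> 0}"

definition chart :: "3 \<Rightarrow> point \<Rightarrow> complex^3" where
  "chart i p = (THE z. z \<in> p \<and> z $ i = 1)"


section \<open>Smooth curves and lifts\<close>

text \<open>Intervals may be open, closed, half-open or unbounded, but contain more than one point.\<close>

definition intvl :: "real set \<Rightarrow> bool" where
  "intvl J \<longleftrightarrow> is_interval J \<and> (\<exists>a\<in>J. \<exists>b\<in>J. a < b)"

text \<open>At an endpoint belonging to \<open>J\<close> the derivative is one-sided.\<close>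

definition vderiv :: "real set \<Rightarrow> (real \<Rightarrow> 'a::real_normed_vector) \<Rightarrow> real \<Rightarrow> 'a" where
  "vderiv J f t = vector_derivative f (at t within J)"

definition smooth_fun :: "real set \<Rightarrow> (real \<Rightarrow> 'a::real_normed_vector) \<Rightarrow> bool" where
  "smooth_fun J f \<longleftrightarrow> (\<forall>n::nat. ((vderiv J ^^ n) f) differentiable_on J)"

definition smooth_curve :: "real set \<Rightarrow> (real \<Rightarrow> point) \<Rightarrow> bool" where
  "smooth_curve J \<gamma> \<longleftrightarrow> \<gamma> ` J \<subseteq> S \<and>
     (\<forall>t\<in>J. \<exists>i. \<exists>e>0. \<gamma> ` (J \<inter> ball t e) \<subseteq> chart_dom i \<and>
        smooth_fun (J \<inter> ball t e) (\<lambda>s. chart i (\<gamma> s)))"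

definition lift :: "real set \<Rightarrow> (real \<Rightarrow> point) \<Rightarrow> (real \<Rightarrow> complex^3) \<Rightarrow> bool" where
  "lift J \<gamma> \<Gamma> \<longleftrightarrow> smooth_fun J \<Gamma> \<and> (\<forall>t\<in>J. \<Gamma> t \<in> null_vectors \<and> \<gamma> t = pt (\<Gamma> t))"


section \<open>Transversal curves\<close>

text \<open>
  The value of the contact form on the tangent vector of the sphere at \<open>pt z\<close> that is the
  projection of the vector \<open>v\<close> at \<open>z\<close>. The number under \<open>Re\<close> is real for \<open>v\<close> tangent to the
  null cone, and depends only on the projected vector.
\<close>

definition contact_form :: "complex^3 \<Rightarrow> complex^3 \<Rightarrow> real" where
  "contact_form z v = Re (- \<i> * herm z v / (\<Sum>i\<in>UNIV. cnj (z $ i) * z $ i))"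

text \<open>Transversality includes the positivity of the parametrization.\<close>

definition transversal :: "real set \<Rightarrow> (real \<Rightarrow> point) \<Rightarrow> bool" where
  "transversal J \<gamma> \<longleftrightarrow> smooth_curve J \<gamma> \<and>
     (\<exists>\<Gamma>. lift J \<gamma> \<Gamma> \<and> (\<forall>t\<in>J. contact_form (\<Gamma> t) (vderiv J \<Gamma> t) > 0))"

definition wronskian :: "real set \<Rightarrow> (real \<Rightarrow> complex^3) \<Rightarrow> real \<Rightarrow> complex" where
  "wronskian J \<Gamma> t = det3 (\<Gamma> t) (vderiv J \<Gamma> t) (vderiv J (vderiv J \<Gamma>) t)"

definition generic_transversal :: "real set \<Rightarrow> (real \<Rightarrow> point) \<Rightarrow> bool" where
  "generic_transversal J \<gamma> \<longleftrightarrow> transversal J \<gamma> \<and>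
     (\<exists>\<Gamma>. lift J \<gamma> \<Gamma> \<and> (\<forall>t\<in>J. wronskian J \<Gamma> t \<noteq> 0))"

definition wilczynski_lift :: "real set \<Rightarrow> (real \<Rightarrow> point) \<Rightarrow> (real \<Rightarrow> complex^3) \<Rightarrow> bool" where
  "wilczynski_lift J \<gamma> \<Gamma> \<longleftrightarrow> lift J \<gamma> \<Gamma> \<and> (\<forall>t\<in>J. wronskian J \<Gamma> t = -1)"

text \<open>
  Wilczynski lifts differ by a constant cube root of unity, so the choice is immaterial in the
  definitions of strain density, bending and twist below. The arguments of \<open>Re\<close> there are real.
\<close>

definition wlift :: "real set \<Rightarrow> (real \<Rightarrow> point) \<Rightarrow> real \<Rightarrow> complex^3" where
  "wlift J \<gamma> = (SOME \<Gamma>. wilczynski_lift J \<gamma> \<Gamma>)"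

definition strain :: "real set \<Rightarrow> (real \<Rightarrow> point) \<Rightarrow> real \<Rightarrow> real" where
  "strain J \<gamma> t = Re (\<i> * inverse (herm (wlift J \<gamma> t) (vderiv J (wlift J \<gamma>) t)))"

definition natural :: "real set \<Rightarrow> (real \<Rightarrow> point) \<Rightarrow> bool" where
  "natural J \<gamma> \<longleftrightarrow> generic_transversal J \<gamma> \<and> (\<forall>t\<in>J. strain J \<gamma> t = 1)"

text \<open>Meaningful for natural parametrizations only.\<close>

definition bending :: "real set \<Rightarrow> (real \<Rightarrow> point) \<Rightarrow> real \<Rightarrow> real" where
  "bending J \<gamma> t =
     1/2 * Re (herm (vderiv J (wlift J \<gamma>) t) (vderiv J (wlift J \<gamma>) t))"

definition twist :: "real set \<Rightarrow> (real \<Rightarrow> point) \<Rightarrow> real \<Rightarrow> real" where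
  "twist J \<gamma> t =
     Im (herm (vderiv J (vderiv J (wlift J \<gamma>)) t) (vderiv J (wlift J \<gamma>) t))
       + 3 * (bending J \<gamma> t)\<^sup>2"


section \<open>Embedded curves\<close>

text \<open>
  An embedded curve is a connected embedded one-dimensional submanifold of the sphere, possibly
  with endpoints. This covers the images of embeddings of an interval, which are the curves with
  a single parametrization \<open>\<gamma>\<close> in the sense of \<open>local_param\<close> with \<open>\<gamma> ` J = K\<close>, as well as closed
  curves.
\<close>

definition local_param :: "point set \<Rightarrow> real set \<Rightarrow> (real \<Rightarrow> point) \<Rightarrow> bool" where
  "local_param K J \<gamma> \<longleftrightarrow> intvl J \<and> generic_transversal J \<gamma> \<and>
     openin (subtopology CP2_topology K) (\<gamma> ` J) \<and>
     homeomorphic_map (top_of_set J) (subtopology CP2_topology (\<gamma> ` J)) \<gamma>"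

definition embedded_generic_transversal :: "point set \<Rightarrow> bool" where
  "embedded_generic_transversal K \<longleftrightarrow> K \<subseteq> S \<and> K \<noteq> {} \<and> connectedin CP2_topology K \<and>
     (\<forall>p\<in>K. \<exists>J \<gamma>. local_param K J \<gamma> \<and> p \<in> \<gamma> ` J)"

definition natural_local_param :: "point set \<Rightarrow> real set \<Rightarrow> (real \<Rightarrow> point) \<Rightarrow> bool" where
  "natural_local_param K J \<gamma> \<longleftrightarrow> local_param K J \<gamma> \<and> natural J \<gamma>"

text \<open>The value at \<open>p\<close> is the same for all natural parametrizations around \<open>p\<close>.\<close>

definition curve_bending :: "point set \<Rightarrow> point \<Rightarrow> real" where
  "curve_bending K p =
     (THE k. \<exists>J \<gamma> s. natural_local_param K J \<gamma> \<and> s \<in> J \<and> \<gamma> s = p \<and> k = bending J \<gamma> s)"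

definition curve_twist :: "point set \<Rightarrow> point \<Rightarrow> real" where
  "curve_twist K p =
     (THE k. \<exists>J \<gamma> s. natural_local_param K J \<gamma> \<and> s \<in> J \<and> \<gamma> s = p \<and> k = twist J \<gamma> s)"

definition congruent_curves :: "point set \<Rightarrow> point set \<Rightarrow> bool" where
  "congruent_curves K K' \<longleftrightarrow> (\<exists>A\<in>G. K' = act A ` K)"


section \<open>Maps between embedded curves\<close>

definition smooth_map :: "point set \<Rightarrow> (point \<Rightarrow> point) \<Rightarrow> bool" where
  "smooth_map K h \<longleftrightarrow> (\<forall>J \<gamma>. local_param K J \<gamma> \<longrightarrow> smooth_curve J (h \<circ> \<gamma>))"

definition diffeo :: "point set \<Rightarrow> point set \<Rightarrow> (point \<Rightarrow> point) \<Rightarrow> bool" where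
  "diffeo K K' h \<longleftrightarrow> bij_betw h K K' \<and> smooth_map K h \<and> smooth_map K' (the_inv_into K h)"

definition orientation_preserving :: "point set \<Rightarrow> (point \<Rightarrow> point) \<Rightarrow> bool" where
  "orientation_preserving K h \<longleftrightarrow> (\<forall>J \<gamma>. local_param K J \<gamma> \<longrightarrow> transversal J (h \<circ> \<gamma>))"

text \<open>
  The map preserves the strain element \<open>a\<^sub>\<gamma> dt\<close>. The natural parameter is itself an invariant:
  two arcs of different strain lengths on an orbit of a one-parameter subgroup of \<^const>\<open>G\<close> have
  equal constant bendings and twists, but are not congruent. A correspondence of points that
  forces congruence therefore has to preserve the natural parameter.
\<close>

definition preserves_natural_parameter :: "point set \<Rightarrow> (point \<Rightarrow> point) \<Rightarrow> bool" where
  "preserves_natural_parameter K h \<longleftrightarrow>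
     (\<forall>J \<gamma>. natural_local_param K J \<gamma> \<longrightarrow> natural J (h \<circ> \<gamma>))"

end

theory Submission
  imports Defs
begin

text \<open>
  A natural curve with Wilczynski lift \<open>\<Gamma>\<close>, bending \<open>k\<close> and twist \<open>\<tau>\<close> carries the frame
  \<open>B = (\<Gamma>, F\<^sub>2, F\<^sub>3)\<close> with \<open>F\<^sub>3 = \<Gamma>' - ik\<Gamma>\<close> and
  \<open>F\<^sub>2 = \<Gamma>'' - (ik' - k\<^sup>2 + \<tau>)\<Gamma> - 2ikF\<^sub>3\<close>. It takes values in \<open>G\<close> and solves \<open>B' = BK\<close>, where \<open>K\<close>
  depends on \<open>k\<close> and \<open>\<tau>\<close> only. If \<open>C\<close> is the frame of a second curve with the same invariants, then
  \<open>C B\<^sup>-\<^sup>1\<close> is constant, so the curves are congruent; conversely the solution of \<open>B' = BK\<close> starting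
  at the identity stays in \<open>G\<close>, and its first column is the lift of a curve with the given invariants.

  For embedded curves, a diffeomorphism preserving the natural parameter and the invariants therefore
  agrees near each point with an element of \<open>G\<close>. Two elements that agree on an arc differ by a scalar,
  since \<open>\<Gamma>\<close>, \<open>\<Gamma>'\<close>, \<open>\<Gamma>''\<close> are independent, so connectedness makes the element global.
\<close>

section \<open>Differentiation on intervals\<close>

text \<open>The frame is forced by asking for the Gram matrix \<open>hmat\<close>: the multiple of
  \<Gamma> subtracted in F3 makes F3 null, and the two coefficients in F2 make F2 orthogonal to F3
  and to \<Gamma>. The summand 3k^2 in the twist is what turns the \<Gamma>-coordinate of F3' into
  \<tau> alone. Two quantities escape direct computation: <F2, F2>, which involves <\<Gamma>'',
  \<Gamma>''>, and F2', which involves \<Gamma>'''. The first follows from the determinant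
  condition, the second from the fact that a frame in G has B^-1 B' in the Lie algebra.

  For embedded curves the obstacle is regularity. Local parametrizations are homeomorphisms onto
  relatively open arcs, so the change between two natural parameters is at first only continuous. A
  coordinate built from the Hermitian form shows that it is differentiable, and the two
  normalizations then give it derivative 1; only this makes bending and twist functions on the
  curve.

  Intervals may contain endpoints or be unbounded, so derivatives are taken within the interval and
  estimates on compact pieces of it.\<close>

definition deriv_on :: "real set \<Rightarrow> (real \<Rightarrow> 'a::real_normed_vector) \<Rightarrow> (real \<Rightarrow> 'a) \<Rightarrow> bool" where
  "deriv_on J f g \<longleftrightarrow> (\<forall>t\<in>J. (f has_vector_derivative g t) (at t within J))"

text \<open>Each stage asks for some derivative instead of iterating \<open>vderiv\<close>. The
  closure rules then become inductions that hold on any set, where derivatives need not be unique;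
  \<open>smooth_fun_iff\<close> identifies the notion with smoothness on intervals.\<close>

primrec diffn :: "nat \<Rightarrow> real set \<Rightarrow> (real \<Rightarrow> 'a::real_normed_vector) \<Rightarrow> bool" where
  "diffn 0 J f = True"
| "diffn (Suc n) J f = (\<exists>g. deriv_on J f g \<and> diffn n J g)"

lemma diffn_SucI: "deriv_on J f g \<Longrightarrow> diffn n J g \<Longrightarrow> diffn (Suc n) J f"
  by auto

lemma deriv_onD: "deriv_on J f g \<Longrightarrow> t \<in> J \<Longrightarrow> (f has_vector_derivative g t) (at t within J)"
  by (simp add: deriv_on_def)

lemma deriv_on_cong:
  assumes "deriv_on J f g" "\<And>t. t \<in> J \<Longrightarrow> f t = f' t" "\<And>t. t \<in> J \<Longrightarrow> g t = g' t"
  shows "deriv_on J f' g'"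
  unfolding deriv_on_def
proof
  fix t assume t: "t \<in> J"
  have "(f has_vector_derivative g' t) (at t within J)" using assms t by (auto simp: deriv_on_def)
  then show "(f' has_vector_derivative g' t) (at t within J)"
    by (rule has_vector_derivative_transform[rotated 2]) (use t assms(2) in auto)
qed

lemma deriv_on_subset: "deriv_on J f g \<Longrightarrow> J' \<subseteq> J \<Longrightarrow> deriv_on J' f g"
  unfolding deriv_on_def using has_vector_derivative_within_subset by blast

lemma deriv_on_continuous: "deriv_on J f g \<Longrightarrow> continuous_on J f"
  unfolding deriv_on_def continuous_on_eq_continuous_within
  using has_vector_derivative_continuous by blast

lemma deriv_on_add: "deriv_on J f f' \<Longrightarrow> deriv_on J g g' \<Longrightarrow> deriv_on J (\<lambda>t. f t + g t) (\<lambda>t. f' t + g' t)"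
  by (auto simp: deriv_on_def intro: has_vector_derivative_add)

lemma deriv_on_const: "deriv_on J (\<lambda>t. c) (\<lambda>t. 0)"
  by (auto simp: deriv_on_def)

lemma deriv_on_id: "deriv_on J (\<lambda>t. t) (\<lambda>t. 1)"
  by (auto simp: deriv_on_def intro: has_vector_derivative_id)

lemma deriv_on_linear: "bounded_linear F \<Longrightarrow> deriv_on J f f' \<Longrightarrow> deriv_on J (\<lambda>t. F (f t)) (\<lambda>t. F (f' t))"
  by (auto simp: deriv_on_def intro: bounded_linear.has_vector_derivative)

lemma deriv_on_bilinear:
  "bounded_bilinear F \<Longrightarrow> deriv_on J f f' \<Longrightarrow> deriv_on J g g' \<Longrightarrow>
    deriv_on J (\<lambda>t. F (f t) (g t)) (\<lambda>t. F (f t) (g' t) + F (f' t) (g t))"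
  by (auto simp: deriv_on_def intro: bounded_bilinear.has_vector_derivative)

lemma deriv_on_compose:
  assumes "deriv_on J' \<phi> \<phi>'" "deriv_on J f f'" "\<phi> ` J' \<subseteq> J"
  shows "deriv_on J' (\<lambda>s. f (\<phi> s)) (\<lambda>s. \<phi>' s *\<^sub>R f' (\<phi> s))"
  unfolding deriv_on_def
proof
  fix s assume s: "s \<in> J'"
  have "((f \<circ> \<phi>) has_vector_derivative \<phi>' s *\<^sub>R f' (\<phi> s)) (at s within J')"
    by (rule vector_diff_chain_within)
      (use s assms in \<open>auto intro: deriv_onD has_vector_derivative_within_subset\<close>)
  then show "((\<lambda>s. f (\<phi> s)) has_vector_derivative \<phi>' s *\<^sub>R f' (\<phi> s)) (at s within J')"
    by (simp add: o_def)
qed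

lemma deriv_on_inverse:
  fixes f :: "real \<Rightarrow> 'a::real_normed_field"
  assumes "deriv_on J f f'" "\<And>t. t \<in> J \<Longrightarrow> f t \<noteq> 0"
  shows "deriv_on J (\<lambda>t. inverse (f t)) (\<lambda>t. - (f' t * (inverse (f t) * inverse (f t))))"
  unfolding deriv_on_def
proof
  fix t assume t: "t \<in> J"
  have "(f has_derivative (\<lambda>h. h *\<^sub>R f' t)) (at t within J)"
    using deriv_onD[OF assms(1) t] by (simp add: has_vector_derivative_def)
  from Deriv.has_derivative_inverse[OF assms(2)[OF t] this]
  show "((\<lambda>t. inverse (f t)) has_vector_derivative - (f' t * (inverse (f t) * inverse (f t)))) (at t within J)"
    by (simp add: has_vector_derivative_def mult_ac)
qed

lemma diffn_Suc_imp: "diffn (Suc n) J f \<Longrightarrow> diffn n J f"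
  by (induction n arbitrary: f) auto

lemma diffn_continuous: "diffn (Suc n) J f \<Longrightarrow> continuous_on J f"
  by (auto intro: deriv_on_continuous)

lemma diffn_cong: "diffn n J f \<Longrightarrow> (\<And>t. t \<in> J \<Longrightarrow> f t = g t) \<Longrightarrow> diffn n J g"
  by (cases n) (auto intro: deriv_on_cong)

lemma diffn_subset: "diffn n J f \<Longrightarrow> J' \<subseteq> J \<Longrightarrow> diffn n J' f"
  by (induction n arbitrary: f) (auto intro: deriv_on_subset)

lemma diffn_const: "diffn n J (\<lambda>t. c)"
  by (induction n arbitrary: c) (auto intro: deriv_on_const)

lemma diffn_add: "diffn n J f \<Longrightarrow> diffn n J g \<Longrightarrow> diffn n J (\<lambda>t. f t + g t)"
proof (induction n arbitrary: f g)
  case (Suc n)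
  then obtain f' g' where "deriv_on J f f'" "diffn n J f'" "deriv_on J g g'" "diffn n J g'" by auto
  then show ?case using Suc.IH by (intro diffn_SucI[where g="\<lambda>t. f' t + g' t"] deriv_on_add)
qed simp

lemma diffn_linear: "bounded_linear F \<Longrightarrow> diffn n J f \<Longrightarrow> diffn n J (\<lambda>t. F (f t))"
proof (induction n arbitrary: f)
  case (Suc n)
  then obtain f' where "deriv_on J f f'" "diffn n J f'" by auto
  then show ?case
    using diffn_SucI[OF deriv_on_linear[OF Suc.prems(1)] Suc.IH[OF Suc.prems(1)]] by blast
qed simp

text \<open>One Leibniz rule serves scalar multiples, matrix products, the Hermitian form and the
  standard inner product alike.\<close>

lemma diffn_bilinear: "bounded_bilinear F \<Longrightarrow> diffn n J f \<Longrightarrow> diffn n J g \<Longrightarrow> diffn n J (\<lambda>t. F (f t) (g t))"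
proof (induction n arbitrary: f g)
  case (Suc n)
  then obtain f' g' where "deriv_on J f f'" "diffn n J f'" "deriv_on J g g'" "diffn n J g'" by auto
  moreover have "diffn n J f" "diffn n J g" using Suc.prems diffn_Suc_imp by blast+
  ultimately show ?case
    using diffn_SucI[OF deriv_on_bilinear[OF Suc.prems(1)] diffn_add[OF Suc.IH Suc.IH]] Suc.prems(1)
    by blast
qed simp

lemmas diffn_mult = diffn_bilinear[OF bounded_bilinear_mult]
lemmas diffn_minus = diffn_linear[OF bounded_linear_minus[OF bounded_linear_ident]]

text \<open>The derivative of the reciprocal is a polynomial in f' and the reciprocal itself, so
  order n for the reciprocal yields order n + 1.\<close>

lemma diffn_inverse:
  fixes f :: "real \<Rightarrow> 'a::real_normed_field"
  shows "diffn n J f \<Longrightarrow> (\<And>t. t \<in> J \<Longrightarrow> f t \<noteq> 0) \<Longrightarrow> diffn n J (\<lambda>t. inverse (f t))"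
proof (induction n)
  case (Suc n)
  then obtain f' where f': "deriv_on J f f'" "diffn n J f'" by auto
  have "diffn n J (\<lambda>t. inverse (f t))" using Suc diffn_Suc_imp by blast
  then have "diffn n J (\<lambda>t. - (f' t * (inverse (f t) * inverse (f t))))"
    using f' by (intro diffn_minus diffn_mult)
  then show ?case using deriv_on_inverse[OF f'(1) Suc.prems(2)] by auto
qed simp

lemma diffn_compose:
  "diffn n J' \<phi> \<Longrightarrow> diffn n J f \<Longrightarrow> \<phi> ` J' \<subseteq> J \<Longrightarrow> diffn n J' (\<lambda>s. f (\<phi> s))"
proof (induction n arbitrary: f)
  case (Suc n)
  then obtain f' \<phi>' where "deriv_on J f f'" "diffn n J f'" "deriv_on J' \<phi> \<phi>'" "diffn n J' \<phi>'" by auto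
  moreover have "diffn n J' \<phi>" using Suc.prems diffn_Suc_imp by blast
  ultimately show ?case using Suc.IH Suc.prems(3)
      diffn_SucI[OF deriv_on_compose diffn_bilinear[OF bounded_bilinear_scaleR]] by blast
qed simp

section \<open>Nondegenerate intervals and uniqueness of one-sided derivatives\<close>

lemma intvl_islimpt:
  assumes "intvl J" "t \<in> J"
  shows "at t within J \<noteq> bot"
proof -
  obtain a b where ab: "a \<in> J" "b \<in> J" "a < b" and J: "is_interval J" using assms by (auto simp: intvl_def)
  define c where "c = (if t = a then b else a)"
  have c: "c \<in> J" "c \<noteq> t" using ab by (auto simp: c_def)
  have "convex J" using J is_interval_convex_1 by blast
  have "t islimpt J" unfolding islimpt_approachable_real
  proof (intro allI impI)
    fix e :: real assume e: "e > 0"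
    \<comment> \<open>The displacement from t towards c is at most e / 2; the cap 1 keeps the new
      point on the segment, hence in J.\<close>
    define u where "u = min 1 (e / (2 * \<bar>c - t\<bar>))"
    have u: "0 < u" "u \<le> 1" using e c by (auto simp: u_def)
    have eq: "((1 - u) * t + u * c) - t = u * (c - t)" by (simp add: algebra_simps)
    have "u * \<bar>c - t\<bar> \<le> e / (2 * \<bar>c - t\<bar>) * \<bar>c - t\<bar>" by (intro mult_right_mono) (auto simp: u_def)
    also have "\<dots> < e" using e c by (simp add: field_simps)
    finally have "\<bar>((1 - u) * t + u * c) - t\<bar> < e"
      unfolding eq using u by (simp add: abs_mult)
    moreover have "(1 - u) * t + u * c \<in> J"
      using convexD[OF \<open>convex J\<close> assms(2) c(1), of "1 - u" u] u by simp
    moreover have "(1 - u) * t + u * c \<noteq> t"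
    proof
      assume "(1 - u) * t + u * c = t"
      then have "u * (c - t) = 0" by (simp add: algebra_simps)
      then show False using u c by simp
    qed
    ultimately show "\<exists>x'\<in>J. x' \<noteq> t \<and> \<bar>x' - t\<bar> < e" by blast
  qed
  then show ?thesis by (simp add: trivial_limit_within)
qed

lemma vderiv_eq: "intvl J \<Longrightarrow> deriv_on J f g \<Longrightarrow> t \<in> J \<Longrightarrow> vderiv J f t = g t"
  unfolding vderiv_def
  by (rule vector_derivative_within[OF intvl_islimpt]) (auto intro: deriv_onD)

lemma deriv_on_unique:
  "intvl J \<Longrightarrow> deriv_on J f g \<Longrightarrow> deriv_on J f h \<Longrightarrow> t \<in> J \<Longrightarrow> g t = h t"
  using vderiv_eq by metis

lemma differentiable_on_iff_deriv_on: "intvl J \<Longrightarrow> f differentiable_on J \<longleftrightarrow> deriv_on J f (vderiv J f)"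
  unfolding differentiable_on_def deriv_on_def vderiv_def
  using vector_derivative_works differentiableI_vector by blast

text \<open>Derivatives on a nondegenerate interval are unique, so every witness in
  \<open>diffn\<close> agrees with \<open>vderiv\<close> on J.\<close>

lemma smooth_fun_iff:
  assumes J: "intvl J"
  shows "smooth_fun J f \<longleftrightarrow> (\<forall>n. diffn n J f)"
proof -
  have 1: "diffn n J f" if "\<forall>n. ((vderiv J ^^ n) f) differentiable_on J" for n f
    using that
  proof (induction n arbitrary: f)
    case (Suc n)
    have "deriv_on J f (vderiv J f)"
      using Suc.prems[rule_format, of 0] differentiable_on_iff_deriv_on[OF J, of f] by simp
    moreover have "diffn n J (vderiv J f)"
      by (rule Suc.IH) (metis Suc.prems funpow_Suc_right comp_apply)
    ultimately show ?case by auto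
  qed simp
  have 2: "((vderiv J ^^ n) f) differentiable_on J" if "diffn (Suc n) J f" for n f
    using that
  proof (induction n arbitrary: f)
    case 0
    then obtain g where g: "deriv_on J f g" by auto
    have "deriv_on J f (vderiv J f)" by (rule deriv_on_cong[OF g]) (use vderiv_eq[OF J g] in auto)
    then show ?case using differentiable_on_iff_deriv_on[OF J, of f] by simp
  next
    case (Suc n)
    then obtain g where g: "deriv_on J f g" "diffn (Suc n) J g" by auto
    have "diffn (Suc n) J (vderiv J f)" by (rule diffn_cong[OF g(2)]) (use vderiv_eq[OF J g(1)] in simp)
    from Suc.IH[OF this] show ?case by (simp add: funpow_Suc_right del: funpow.simps)
  qed
  show ?thesis unfolding smooth_fun_def using 1 2 by blast
qed

lemma smooth_fun_obtain:
  assumes "intvl J" "smooth_fun J f"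
  shows "deriv_on J f (vderiv J f)" "smooth_fun J (vderiv J f)"
proof -
  show d: "deriv_on J f (vderiv J f)"
    using assms(2)[unfolded smooth_fun_def, rule_format, of 0] differentiable_on_iff_deriv_on[OF assms(1), of f]
    by simp
  show "smooth_fun J (vderiv J f)" using assms(2) unfolding smooth_fun_def
    by (metis funpow_Suc_right comp_apply)
qed

lemma smooth_fun_cong: "intvl J \<Longrightarrow> smooth_fun J f \<Longrightarrow> (\<And>t. t \<in> J \<Longrightarrow> f t = g t) \<Longrightarrow> smooth_fun J g"
  unfolding smooth_fun_iff using diffn_cong by metis

lemma smooth_fun_continuous: "intvl J \<Longrightarrow> smooth_fun J f \<Longrightarrow> continuous_on J f"
  using smooth_fun_obtain(1) deriv_on_continuous by blast

lemma smooth_fun_subset: "intvl J \<Longrightarrow> intvl J' \<Longrightarrow> J' \<subseteq> J \<Longrightarrow> smooth_fun J f \<Longrightarrow> smooth_fun J' f"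
  by (auto simp: smooth_fun_iff intro: diffn_subset)

text \<open>The pieces into which \<open>smooth_curve\<close> cuts J must again be nondegenerate, so
  that derivatives on them are determined.\<close>

lemma intvl_Int_ball:
  assumes "intvl J" "t \<in> J" "e > 0"
  shows "intvl (J \<inter> ball t e)"
proof -
  have i: "is_interval (J \<inter> ball t e)"
    using assms by (auto simp: intvl_def is_interval_ball_real intro: is_interval_Int)
  have "t islimpt J" using intvl_islimpt[OF assms(1,2)] by (simp add: trivial_limit_within)
  then obtain x where "x \<in> J" "x \<noteq> t" "\<bar>x - t\<bar> < e" using assms(3) unfolding islimpt_approachable_real by blast
  then have "x \<in> J \<inter> ball t e" "t \<in> J \<inter> ball t e" "x < t \<or> t < x" using assms by (auto simp: dist_real_def)
  then show ?thesis using i unfolding intvl_def by blast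
qed

lemma deriv_on_zero_const:
  assumes "intvl J" "deriv_on J f (\<lambda>t. 0)" "s \<in> J" "t \<in> J"
  shows "f s = f t"
proof -
  have "convex J" using assms(1) by (simp add: intvl_def is_interval_convex_1)
  then obtain c where "\<And>x. x \<in> J \<Longrightarrow> f x = c"
    using has_vector_derivative_zero_constant[of J f] assms(2) unfolding deriv_on_def by metis
  then show ?thesis using assms by simp
qed

text \<open>J may be open or unbounded, while integrals and uniform bounds live on compact pieces.
  The piece has to contain the base point t0 and all of J near t, so that differentiability at t
  within the piece is differentiability within J. If t is an endpoint of J, it is an endpoint of the
  piece as well.\<close>

lemma intvl_compact_nbhd:
  assumes "intvl J" "t \<in> J" "t0 \<in> J"
  obtains a b e where "a < b" "{a..b} \<subseteq> J" "t \<in> {a..b}" "t0 \<in> {a..b}" "0 < e" "J \<inter> ball t e \<subseteq> {a..b}"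
proof -
  have J: "is_interval J" using assms by (simp add: intvl_def)
  have "\<exists>b\<in>J. t0 \<le> b \<and> t \<le> b \<and> ((\<exists>x\<in>J. t < x) \<longrightarrow> t < b)"
  proof (cases "\<exists>x\<in>J. t < x")
    case True
    then obtain x where "x \<in> J" "t < x" by blast
    then show ?thesis using assms(3) by (intro bexI[of _ "max t0 x"]) (auto simp: max_def)
  next
    case False
    then show ?thesis using assms by (intro bexI[of _ t]) force+
  qed
  then obtain b where b: "b \<in> J" "t0 \<le> b" "t \<le> b" "(\<exists>x\<in>J. t < x) \<Longrightarrow> t < b" by blast
  have "\<exists>a\<in>J. a \<le> t0 \<and> a \<le> t \<and> ((\<exists>x\<in>J. x < t) \<longrightarrow> a < t)"
  proof (cases "\<exists>x\<in>J. x < t")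
    case True
    then obtain x where "x \<in> J" "x < t" by blast
    then show ?thesis using assms(3) by (intro bexI[of _ "min t0 x"]) (auto simp: min_def)
  next
    case False
    then show ?thesis using assms by (intro bexI[of _ t]) force+
  qed
  then obtain a where a: "a \<in> J" "a \<le> t0" "a \<le> t" "(\<exists>x\<in>J. x < t) \<Longrightarrow> a < t" by blast
  obtain p q where "p \<in> J" "q \<in> J" "p < q" using assms by (auto simp: intvl_def)
  then have "(\<exists>x\<in>J. x < t) \<or> (\<exists>x\<in>J. t < x)" by (meson less_le_trans not_le)
  then have ab: "a < b" using a b by force
  have sub: "{a..b} \<subseteq> J" using mem_is_interval_1_I[OF J a(1) b(1)] by auto
  \<comment> \<open>The default 1 applies on a side where t is an endpoint of \<open>{a..b}\<close>;
    there J has no points beyond t, so any radius will do.\<close>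
  define e where "e = min (if a < t then t - a else 1) (if t < b then b - t else 1)"
  have "e > 0" by (auto simp: e_def)
  moreover have "x \<in> {a..b}" if "x \<in> J" "x \<in> ball t e" for x
  proof -
    have "\<bar>t - x\<bar> < e" using that by (simp add: dist_real_def)
    then have "x < t \<Longrightarrow> a < t \<Longrightarrow> a \<le> x" "t < x \<Longrightarrow> t < b \<Longrightarrow> x \<le> b" by (auto simp: e_def)
    moreover have "x < t \<Longrightarrow> a < t" "t < x \<Longrightarrow> t < b" using a(4) b(4) that by blast+
    ultimately show ?thesis using a b by (cases "x < t"; cases "t < x") auto
  qed
  ultimately show ?thesis using that[OF ab sub, of e] a b by (auto simp: subset_iff)
qed

section \<open>Antiderivatives and linear differential equations on an interval\<close>

lemma has_vector_derivative_local:
  assumes "(f has_vector_derivative d) (at t within A)" "0 < e" "J \<inter> ball t e \<subseteq> A" "t \<in> J"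
  shows "(f has_vector_derivative d) (at t within J)"
proof -
  have "(f has_vector_derivative d) (at t within (J \<inter> ball t e))"
    using assms has_vector_derivative_within_subset by blast
  moreover have "at t within (J \<inter> ball t e) = at t within J"
    by (rule at_within_nhd[of _ "ball t e"]) (use assms in auto)
  ultimately show ?thesis by simp
qed

lemma antiderivative:
  fixes f :: "real \<Rightarrow> 'a::banach"
  assumes "intvl J" "continuous_on J f" "t0 \<in> J"
  obtains F where "deriv_on J F f" "F t0 = 0"
proof -
  \<comment> \<open>The case distinction supplies the orientation, since the integral over an
    interval with reversed endpoints is 0.\<close>
  define F where "F t = (if t0 \<le> t then integral {t0..t} f else - integral {t..t0} f)" for t
  have "(F has_vector_derivative f t) (at t within J)" if t: "t \<in> J" for t
  proof -
    obtain a b e where ab: "a < b" "{a..b} \<subseteq> J" "t \<in> {a..b}" "t0 \<in> {a..b}" "0 < e" "J \<inter> ball t e \<subseteq> {a..b}"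
      using intvl_compact_nbhd[OF assms(1) t assms(3)] by blast
    have c: "continuous_on {a..b} f" using assms(2) ab(2) continuous_on_subset by blast
    have int: "f integrable_on {x..y}" if "a \<le> x" "y \<le> b" for x y
      by (rule integrable_continuous_real, rule continuous_on_subset[OF c]) (use that in auto)
    have F: "F x = integral {a..x} f - integral {a..t0} f" if "x \<in> {a..b}" for x
    proof (cases "t0 \<le> x")
      case True
      then have "integral {a..t0} f + integral {t0..x} f = integral {a..x} f"
        using that ab by (intro Henstock_Kurzweil_Integration.integral_combine int) auto
      then show ?thesis using True by (simp add: F_def algebra_simps)
    next
      case False
      then have "integral {a..x} f + integral {x..t0} f = integral {a..t0} f"
        using that ab by (intro Henstock_Kurzweil_Integration.integral_combine int) auto
      then show ?thesis using False by (simp add: F_def algebra_simps)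
    qed
    have "((\<lambda>x. integral {a..x} f - integral {a..t0} f) has_vector_derivative f t) (at t within {a..b})"
      using integral_has_vector_derivative[OF c ab(3)] by (simp add: has_vector_derivative_diff_const)
    then have "(F has_vector_derivative f t) (at t within {a..b})"
      by (rule has_vector_derivative_transform[rotated 2]) (use ab F in auto)
    then show ?thesis using has_vector_derivative_local ab t by blast
  qed
  then show ?thesis using that[of F] by (auto simp: deriv_on_def F_def)
qed

text \<open>The X n are the terms of the Picard series, each an antiderivative of the preceding term
  times K. Integrating the bound for X n gains a factor C k |t - t0| and divides by n + 1, which
  produces the terms of an exponential series.\<close>

lemma linear_ode_bound:
  fixes X :: "nat \<Rightarrow> real \<Rightarrow> 'a::real_normed_vector" and K :: "real \<Rightarrow> 'b::real_normed_vector"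
  assumes P: "\<And>x y. norm (pr x y) \<le> norm x * norm y * C" "0 \<le> C"
    and ab: "{a..b} \<subseteq> J" "t0 \<in> {a..b}" "\<And>t. t \<in> {a..b} \<Longrightarrow> norm (K t) \<le> k" "0 \<le> k"
    and X: "\<And>n. deriv_on J (X (Suc n)) (\<lambda>t. pr (X n t) (K t))" "\<And>n. X (Suc n) t0 = 0"
      "\<And>t. X 0 t = c"
    and t: "t \<in> {a..b}"
  shows "norm (X n t) \<le> norm c * (C * k * \<bar>t - t0\<bar>) ^ n / fact n"
  using t
proof (induction n arbitrary: t)
  case 0
  then show ?case by (simp add: X(3))
next
  case (Suc n)
  define d where "d = t - t0"
  \<comment> \<open>The segment from t0 to t is traversed over [0,1], so that times before and after
    t0 need no separate treatment and |t - t0| enters only as the constant |d|.\<close>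
  define p where "p u = t0 + u * d" for u
  have p: "p u \<in> {a..b}" if "u \<in> {0..1}" for u
  proof -
    have "convex {a..b}" by simp
    from convexD[OF this, of t0 t "1 - u" u] show ?thesis
      using that ab Suc.prems by (simp add: p_def d_def algebra_simps)
  qed
  have dp: "deriv_on {0..1} p (\<lambda>u. d)"
    unfolding deriv_on_def p_def by (auto intro!: derivative_eq_intros)
  define M where "M = norm c * (C * k * \<bar>d\<bar>) ^ Suc n"
  have M: "0 \<le> M" unfolding M_def using P ab by (intro mult_nonneg_nonneg zero_le_power) auto
  have der: "deriv_on {0..1} (\<lambda>u. X (Suc n) (p u)) (\<lambda>u. d *\<^sub>R pr (X n (p u)) (K (p u)))"
    using deriv_on_compose[OF dp X(1)] p ab by blast
  have bnd: "norm (d *\<^sub>R pr (X n (p u)) (K (p u))) \<le> M * (real (Suc n) * u ^ n) / fact (Suc n)"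
    if "0 < u" "u < 1" for u
  proof -
    have pu: "p u \<in> {a..b}" using p that by simp
    have "norm (X n (p u)) \<le> norm c * (C * k * \<bar>p u - t0\<bar>) ^ n / fact n" by (rule Suc.IH[OF pu])
    also have "\<bar>p u - t0\<bar> = u * \<bar>d\<bar>" using that by (simp add: p_def abs_mult)
    finally have 1: "norm (X n (p u)) \<le> norm c * (C * k * (u * \<bar>d\<bar>)) ^ n / fact n" .
    have "norm (pr (X n (p u)) (K (p u))) \<le> norm (X n (p u)) * norm (K (p u)) * C" by (rule P)
    also have "\<dots> \<le> (norm c * (C * k * (u * \<bar>d\<bar>)) ^ n / fact n) * k * C"
      using 1 ab(3)[OF pu] ab P that by (intro mult_mono) (auto intro: order_trans[OF norm_ge_zero])
    finally have "\<bar>d\<bar> * norm (pr (X n (p u)) (K (p u))) \<le> \<bar>d\<bar> * ((norm c * (C * k * (u * \<bar>d\<bar>)) ^ n / fact n) * k * C)"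
      by (intro mult_left_mono) auto
    also have "\<dots> = M * (real (Suc n) * u ^ n) / fact (Suc n)"
      by (simp add: M_def field_simps power_mult_distrib del: of_nat_Suc)
    finally show ?thesis by simp
  qed
  have "norm (X (Suc n) (p 1) - X (Suc n) (p 0)) \<le> M * 1 ^ Suc n / fact (Suc n) - M * 0 ^ Suc n / fact (Suc n)"
  proof (rule differentiable_bound_general)
    show "continuous_on {0..1} (\<lambda>u. X (Suc n) (p u))" using der deriv_on_continuous by blast
    show "continuous_on {0..1} (\<lambda>u. M * u ^ Suc n / fact (Suc n))" by (intro continuous_intros) auto
    show "((\<lambda>u. X (Suc n) (p u)) has_vector_derivative d *\<^sub>R pr (X n (p u)) (K (p u))) (at u)"
      if "0 < u" "u < 1" for u
      using deriv_onD[OF der, of u] that at_within_Icc_at[of 0 u 1] by simp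
    show "((\<lambda>u. M * u ^ Suc n / fact (Suc n)) has_vector_derivative M * (real (Suc n) * u ^ n) / fact (Suc n)) (at u)" for u
      unfolding has_real_derivative_iff_has_vector_derivative[symmetric]
      by (auto intro!: derivative_eq_intros simp del: power_Suc fact_Suc)
  qed (use bnd in auto)
  then show ?case by (simp add: p_def d_def X(2) M_def del: fact_Suc power_Suc)
qed

text \<open>By linearity the Picard series converges uniformly on every compact piece of J, so the
  solution exists on all of J. An arbitrary bounded bilinear product covers both the scalar equation
  that normalizes lifts and the matrix equation of frames.\<close>

lemma linear_ode:
  fixes K :: "real \<Rightarrow> 'b::real_normed_vector" and c :: "'a::banach"
  assumes J: "intvl J" "t0 \<in> J" and P: "bounded_bilinear pr" and K: "continuous_on J K"
  obtains X where "deriv_on J X (\<lambda>t. pr (X t) (K t))" "X t0 = c"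
proof -
  have step: "\<exists>F. (deriv_on J F (\<lambda>t. pr (f t) (K t)) \<and> F t0 = 0)"
    if "continuous_on J f" for f :: "real \<Rightarrow> 'a"
  proof -
    have "continuous_on J (\<lambda>t. pr (f t) (K t))"
      using bounded_bilinear.continuous_on[OF P that K] .
    from antiderivative[OF J(1) this J(2)] show ?thesis by metis
  qed
  \<comment> \<open>The iterates are chosen once on all of J; the compact pieces below serve only
    for estimates, so no gluing of local solutions arises.\<close>
  define nxt where "nxt f = (SOME F. deriv_on J F (\<lambda>t. pr (f t) (K t)) \<and> F t0 = 0)" for f :: "real \<Rightarrow> 'a"
  define X where "X n = (nxt ^^ n) (\<lambda>t. c)" for n
  have nxt: "deriv_on J (nxt f) (\<lambda>t. pr (f t) (K t)) \<and> nxt f t0 = 0" if "continuous_on J f" for f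
    unfolding nxt_def by (rule someI_ex[OF step[OF that]])
  have cX: "continuous_on J (X n)" for n
    by (induction n) (use nxt deriv_on_continuous in \<open>auto simp: X_def\<close>)
  have X: "deriv_on J (X (Suc n)) (\<lambda>t. pr (X n t) (K t))" "X (Suc n) t0 = 0" for n
    using nxt[OF cX[of n]] by (auto simp: X_def)
  have X0: "X 0 t = c" for t by (simp add: X_def)
  obtain C where C: "0 \<le> C" "\<And>x y. norm (pr x y) \<le> norm x * norm y * C"
    using bounded_bilinear.nonneg_bounded[OF P] by blast
  define S where "S t = (\<Sum>n. X n t)" for t
  have main: "(S has_vector_derivative pr (S t) (K t)) (at t within J) \<and> S t0 = c" if t: "t \<in> J" for t
  proof -
    obtain a b e where ab: "a < b" "{a..b} \<subseteq> J" "t \<in> {a..b}" "t0 \<in> {a..b}" "0 < e" "J \<inter> ball t e \<subseteq> {a..b}"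
      using intvl_compact_nbhd[OF J(1) t J(2)] by blast
    have "compact (K ` {a..b})"
      by (rule compact_continuous_image) (use K ab continuous_on_subset in auto)
    then have "bounded (K ` {a..b})" by (rule compact_imp_bounded)
    then obtain k where "\<forall>x\<in>K ` {a..b}. norm x \<le> k" unfolding bounded_iff by (rule exE)
    then have k: "norm (K s) \<le> k" if "s \<in> {a..b}" for s using that by simp
    have k0: "0 \<le> k" using k[OF ab(3)] norm_ge_zero order_trans by blast
    define r where "r = C * k * (b - a)"
    define m where "m n = norm c * (r ^ n / fact n)" for n
    have r0: "0 \<le> r" using C k0 ab by (simp add: r_def)
    have summ: "summable m" unfolding m_def using summable_exp[of r]
      by (intro summable_mult) (simp add: field_simps)
    have Xm: "norm (X n s) \<le> m n" if s: "s \<in> {a..b}" for n s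
    proof -
      have "norm (X n s) \<le> norm c * (C * k * \<bar>s - t0\<bar>) ^ n / fact n"
        by (rule linear_ode_bound[OF C(2,1) ab(2,4) k k0 X X0 s])
      also have "\<dots> \<le> norm c * r ^ n / fact n"
        using C k0 s ab(4) unfolding r_def
        by (intro divide_right_mono mult_left_mono power_mono) auto
      finally show ?thesis by (simp add: m_def)
    qed
    have ul: "uniform_limit {a..b} (\<lambda>n s. \<Sum>i<n. X i s) S sequentially"
      unfolding S_def by (rule Weierstrass_m_test[OF Xm summ])
    have sums: "(\<lambda>n. X n s) sums S s" if "s \<in> {a..b}" for s
      unfolding S_def by (rule summable_sums, rule summable_comparison_test'[OF summ, of 0]) (use Xm that in simp)
    \<comment> \<open>The series of derivatives is the original series times K, shifted by one
      index: the constant term X 0 contributes 0.\<close>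
    define X' where "X' n s = (case n of 0 \<Rightarrow> 0 | Suc i \<Rightarrow> pr (X i s) (K s))" for n s
    have X': "(X n has_vector_derivative X' n s) (at s within {a..b})" if "s \<in> {a..b}" for n s
    proof (cases n)
      case 0
      have "X 0 = (\<lambda>t. c)" by (simp add: X_def)
      then show ?thesis using 0 by (simp add: X'_def)
    next
      case (Suc i)
      then show ?thesis using deriv_onD[OF deriv_on_subset[OF X(1)[of i] ab(2)] that]
        by (simp add: X'_def)
    qed
    have sumX': "(\<Sum>i<Suc n. X' i s) = pr (\<Sum>i<n. X i s) (K s)" for n s
      by (subst sum.lessThan_Suc_shift) (simp add: X'_def bounded_bilinear.sum_left[OF P])
    have "\<exists>g. \<forall>s\<in>{a..b}. (\<lambda>n. X n s) sums g s \<and> (g has_derivative (\<lambda>h. h *\<^sub>R pr (S s) (K s))) (at s within {a..b})"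
    proof (rule has_derivative_series)
      show "convex {a..b}" by simp
      show "(X n has_derivative (\<lambda>h. h *\<^sub>R X' n s)) (at s within {a..b})" if "s \<in> {a..b}" for n s
        using X'[OF that] by (simp add: has_vector_derivative_def)
      show "t0 \<in> {a..b}" "(\<lambda>n. X n t0) sums S t0" using ab sums by auto
      fix \<epsilon> :: real assume \<epsilon>: "\<epsilon> > 0"
      \<comment> \<open>The summand 1 keeps the denominator positive when \<open>k * C\<close> is
        0.\<close>
      define \<delta> where "\<delta> = \<epsilon> / (k * C + 1)"
      have kC: "0 \<le> k * C" using k0 C by simp
      have \<delta>: "\<delta> > 0" using kC \<epsilon> by (simp add: \<delta>_def)
      have "\<delta> * (k * C) \<le> \<delta> * (k * C + 1)" using \<delta> by simp
      also have "\<dots> = \<epsilon>" using kC by (simp add: \<delta>_def)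
      finally have \<delta>\<epsilon>: "\<delta> * (k * C) \<le> \<epsilon>" .
      from ul \<delta> have "\<forall>\<^sub>F n in sequentially. \<forall>s\<in>{a..b}. dist (\<Sum>i<n. X i s) (S s) < \<delta>"
        by (simp add: uniform_limit_iff)
      then have "\<forall>\<^sub>F n in sequentially. \<forall>s\<in>{a..b}. \<forall>h. norm ((\<Sum>i<Suc n. h *\<^sub>R X' i s) - h *\<^sub>R pr (S s) (K s)) \<le> \<epsilon> * norm h"
      proof (rule eventually_mono, intro ballI allI)
        fix n s h assume A: "\<forall>s\<in>{a..b}. dist (\<Sum>i<n. X i s) (S s) < \<delta>" and s: "s \<in> {a..b}"
        have "(\<Sum>i<Suc n. h *\<^sub>R X' i s) - h *\<^sub>R pr (S s) (K s) = h *\<^sub>R pr ((\<Sum>i<n. X i s) - S s) (K s)"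
          unfolding scaleR_sum_right[symmetric] sumX' bounded_bilinear.diff_left[OF P] scaleR_diff_right ..
        also have "norm \<dots> \<le> \<bar>h\<bar> * (norm ((\<Sum>i<n. X i s) - S s) * norm (K s) * C)"
          using C(2) by (simp add: mult_left_mono)
        also have "\<dots> \<le> \<bar>h\<bar> * (\<delta> * k * C)"
          using A s k[OF s] k0 \<delta> C by (intro mult_left_mono mult_mono) (auto simp: dist_norm less_imp_le)
        also have "\<dots> \<le> \<bar>h\<bar> * \<epsilon>" using \<delta>\<epsilon> by (intro mult_left_mono) (auto simp: mult_ac)
        finally show "norm ((\<Sum>i<Suc n. h *\<^sub>R X' i s) - h *\<^sub>R pr (S s) (K s)) \<le> \<epsilon> * norm h"
          by (simp add: mult_ac)
      qed
      then show "\<forall>\<^sub>F n in sequentially. \<forall>s\<in>{a..b}. \<forall>h. norm ((\<Sum>i<n. h *\<^sub>R X' i s) - h *\<^sub>R pr (S s) (K s)) \<le> \<epsilon> * norm h"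
        by (rule eventually_sequentially_Suc[THEN iffD1])
    qed
    then obtain g where g: "\<And>s. s\<in>{a..b} \<Longrightarrow> (\<lambda>n. X n s) sums g s"
      "\<And>s. s\<in>{a..b} \<Longrightarrow> (g has_vector_derivative pr (S s) (K s)) (at s within {a..b})"
      unfolding has_vector_derivative_def by blast
    have gS: "g s = S s" if "s \<in> {a..b}" for s using sums_unique2[OF g(1) sums] that by blast
    have "(S has_vector_derivative pr (S t) (K t)) (at t within {a..b})"
      by (rule has_vector_derivative_transform[OF ab(3) _ g(2)[OF ab(3)]]) (simp add: gS)
    then have 1: "(S has_vector_derivative pr (S t) (K t)) (at t within J)"
      using has_vector_derivative_local ab t by blast
    have "X n t0 = 0" if "n \<notin> {0}" for n using that X(2)[of "n - 1"] by simp
    then have "S t0 = c" using suminf_finite[of "{0}" "\<lambda>n. X n t0"] by (simp add: S_def X0)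
    with 1 show ?thesis by blast
  qed
  show ?thesis by (rule that[of S]) (use main J(2) in \<open>auto simp: deriv_on_def\<close>)
qed

text \<open>Bootstrapping: the right-hand side is as often differentiable as X and K, so X is
  differentiable once more.\<close>

lemma linear_ode_smooth:
  assumes "intvl J" "bounded_bilinear pr" "smooth_fun J K" "deriv_on J X (\<lambda>t. pr (X t) (K t))"
  shows "smooth_fun J X"
proof -
  have "diffn n J X" for n
  proof (induction n)
    case (Suc n)
    then have "diffn n J (\<lambda>t. pr (X t) (K t))"
      using assms by (intro diffn_bilinear[OF assms(2)]) (auto simp: smooth_fun_iff)
    then show ?case using assms(4) by auto
  qed simp
  then show ?thesis by (simp add: smooth_fun_iff[OF assms(1)])
qed

section \<open>Hermitian linear algebra in dimension three\<close>

definition adj :: "complex^'n^'m \<Rightarrow> complex^'m^'n" where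
  "adj M = map_matrix cnj (transpose M)"

definition of_columns :: "complex^3 \<Rightarrow> complex^3 \<Rightarrow> complex^3 \<Rightarrow> complex^3^3" where
  "of_columns u v w = transpose (vector [u, v, w])"

lemma adj_nth [simp]: "adj M $ i $ j = cnj (M $ j $ i)"
  by (simp add: adj_def map_matrix_def transpose_def)

lemma of_columns_nth [simp]: "of_columns u v w $ i $ 1 = u $ i" "of_columns u v w $ i $ 2 = v $ i" "of_columns u v w $ i $ 3 = w $ i"
  by (simp_all add: of_columns_def transpose_def)

lemma hmat_nth [simp]:
  "hmat $ 1 $ 1 = 0" "hmat $ 1 $ 2 = 0" "hmat $ 1 $ 3 = \<i>"
  "hmat $ 2 $ 1 = 0" "hmat $ 2 $ 2 = 1" "hmat $ 2 $ 3 = 0"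
  "hmat $ 3 $ 1 = -\<i>" "hmat $ 3 $ 2 = 0" "hmat $ 3 $ 3 = 0"
  by (simp_all add: hmat_def)

lemma herm_eq: "herm z w = \<i> * cnj (z $ 1) * w $ 3 + cnj (z $ 2) * w $ 2 - \<i> * cnj (z $ 3) * w $ 1"
  by (simp add: herm_def sum_3 algebra_simps)

lemma herm_swap: "herm w z = cnj (herm z w)"
  by (simp add: herm_eq algebra_simps)

lemma herm_self_real: "herm z z = of_real (Re (herm z z))"
  using herm_swap[of z z] by (metis Reals_cnj_iff of_real_Re)

lemma herm_add_left: "herm (a + b) c = herm a c + herm b c"
  and herm_add_right: "herm c (a + b) = herm c a + herm c b"
  and herm_smult_left: "herm (k *s a) c = cnj k * herm a c"
  and herm_smult_right: "herm c (k *s a) = k * herm c a"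
  and herm_diff_left: "herm (a - b) c = herm a c - herm b c"
  and herm_diff_right: "herm c (a - b) = herm c a - herm c b"
  by (simp_all add: herm_eq algebra_simps)

lemma herm_zero [simp]: "herm 0 c = 0" "herm c 0 = 0"
  by (simp_all add: herm_eq)

lemmas herm_simps = herm_add_left herm_add_right herm_smult_left herm_smult_right
  herm_diff_left herm_diff_right

lemma herm_unit_smult: "cmod c = 1 \<Longrightarrow> herm (c *s a) (c *s b) = herm a b"
  using complex_norm_square[of c] by (simp add: herm_simps flip: mult.assoc)

lemma det3_of_columns: "det3 u v w = det (of_columns u v w)"
  by (simp add: det3_def of_columns_def)

lemma adj_mult: "adj (A ** B) = adj B ** adj A"
  by (simp add: vec_eq_iff matrix_matrix_mult_def mult.commute)

lemma adj_adj [simp]: "adj (adj A) = A"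
  by (simp add: vec_eq_iff)

lemma adj_hmat [simp]: "adj hmat = hmat"
  by (simp add: vec_eq_iff forall_3)

lemma hmat_hmat: "hmat ** hmat = mat 1"
  by (simp add: vec_eq_iff forall_3 matrix_matrix_mult_def sum_3 mat_def)

lemma det_hmat: "det hmat = -1"
  by (simp add: det_3)

lemma det_adj: "det (adj (A :: complex^3^3)) = cnj (det A)"
  by (simp add: det_3 algebra_simps)

lemma G_iff: "A \<in> G \<longleftrightarrow> det A = 1 \<and> adj A ** hmat ** A = hmat"
  by (simp add: G_def adj_def)

lemma gram_nth:
  fixes A B :: "complex^3^3"
  shows "(adj A ** hmat ** B) $ i $ j = herm (column i A) (column j B)"
  by (simp add: herm_eq matrix_matrix_mult_def sum_3 column_def algebra_simps)

lemma herm_mult_vec: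
  fixes A B :: "complex^3^3"
  shows "herm (A *v z) (B *v w) = (\<Sum>i\<in>UNIV. \<Sum>j\<in>UNIV. cnj (z $ i) * (adj A ** hmat ** B) $ i $ j * w $ j)"
  by (simp add: gram_nth herm_eq matrix_vector_mult_def sum_3 column_def algebra_simps)

lemma herm_G: "A \<in> G \<Longrightarrow> herm (A *v z) (A *v w) = herm z w"
  unfolding herm_mult_vec by (simp add: G_iff herm_def)

lemma of_columns_mult: "of_columns (A *v u) (A *v v) (A *v w) = A ** of_columns u v w"
  by (simp add: vec_eq_iff forall_3 matrix_matrix_mult_def matrix_vector_mult_def)

lemma det3_mult_vec: "det3 (A *v u) (A *v v) (A *v w) = det A * det3 u v w"
  by (simp add: det3_of_columns of_columns_mult det_mul)

text \<open>Since \<open>hmat\<close> squares to the identity, the hypothesis exhibits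
  \<open>hmat ** adj A ** hmat\<close> as a left inverse of A, and a left inverse of a square matrix
  is a right inverse.\<close>

lemma adj_h_inverse:
  assumes "adj A ** hmat ** A = hmat"
  shows "(hmat ** adj A ** hmat) ** A = mat 1" "A ** (hmat ** adj A ** hmat) = mat 1"
    "A ** hmat ** adj A = hmat"
proof -
  have "(hmat ** adj A ** hmat) ** A = hmat ** (adj A ** hmat ** A)"
    by (simp add: matrix_mul_assoc)
  then show 1: "(hmat ** adj A ** hmat) ** A = mat 1" by (simp add: assms hmat_hmat)
  then show 2: "A ** (hmat ** adj A ** hmat) = mat 1" by (simp add: matrix_left_right_inverse)
  have "A ** hmat ** adj A = A ** (hmat ** adj A ** hmat) ** hmat"
    by (simp add: matrix_mul_assoc[symmetric] hmat_hmat)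
  then show "A ** hmat ** adj A = hmat" by (simp add: 2)
qed

lemma adj_h_flip:
  assumes "A ** hmat ** adj A = hmat"
  shows "adj A ** hmat ** A = hmat"
  using adj_h_inverse(3)[of "adj A"] assms by simp

lemma G_mult: "A \<in> G \<Longrightarrow> B \<in> G \<Longrightarrow> A ** B \<in> G"
proof -
  assume A: "A \<in> G" and B: "B \<in> G"
  have "adj (A ** B) ** hmat ** (A ** B) = adj B ** (adj A ** hmat ** A) ** B"
    by (simp add: adj_mult matrix_mul_assoc)
  then show ?thesis using A B by (simp add: G_iff det_mul)
qed

text \<open>The inverse is \<open>hmat ** adj A ** hmat\<close>; its own membership in G rests on
  the relation with A and its adjoint exchanged.\<close>

lemma G_inverse:
  assumes "A \<in> G"
  obtains B where "B \<in> G" "B ** A = mat 1" "A ** B = mat 1"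
proof -
  let ?B = "hmat ** adj A ** hmat"
  have A: "det A = 1" "adj A ** hmat ** A = hmat" using assms by (auto simp: G_iff)
  have "adj ?B = hmat ** A ** hmat" by (simp add: adj_mult matrix_mul_assoc)
  then have "adj ?B ** hmat ** ?B = hmat ** A ** (hmat ** hmat ** hmat) ** adj A ** hmat"
    by (simp add: matrix_mul_assoc)
  also have "\<dots> = hmat ** (A ** hmat ** adj A) ** hmat" by (simp add: hmat_hmat matrix_mul_assoc)
  also have "\<dots> = hmat" by (simp add: adj_h_inverse(3)[OF A(2)] hmat_hmat)
  finally have "?B \<in> G" by (simp add: G_iff det_mul det_adj det_hmat A)
  then show ?thesis using that adj_h_inverse[OF A(2)] by blast
qed

lemma G_mult_nonzero: "A \<in> G \<Longrightarrow> A *v z = 0 \<longleftrightarrow> z = 0"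
  by (metis G_inverse matrix_vector_mul_assoc matrix_vector_mul_lid matrix_vector_mult_0_right)

lemma null_vectors_G: "A \<in> G \<Longrightarrow> A *v z \<in> null_vectors \<longleftrightarrow> z \<in> null_vectors"
  by (simp add: null_vectors_def herm_G G_mult_nonzero)

section \<open>Linearity, bilinearity and derivatives of the matrix operations\<close>

lemma smult_scaleR [simp]: "c *s (r *\<^sub>R z) = r *\<^sub>R (c *s z)" for z :: "complex^3"
  by (simp add: vec_eq_iff)

lemma bounded_bilinear_smult: "bounded_bilinear (\<lambda>(c::complex) (z::complex^3). c *s z)"
  unfolding bilinear_conv_bounded_bilinear[symmetric] bilinear_def linear_iff
  by (simp add: vec_eq_iff algebra_simps)

lemma bounded_bilinear_herm: "bounded_bilinear herm"
  unfolding bilinear_conv_bounded_bilinear[symmetric] bilinear_def linear_iff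
  by (simp add: herm_eq algebra_simps scaleR_conv_of_real[where 'a=complex])

lemma bounded_bilinear_matrix_mult: "bounded_bilinear ((**) :: complex^3^3 \<Rightarrow> complex^3^3 \<Rightarrow> complex^3^3)"
  unfolding bilinear_conv_bounded_bilinear[symmetric] bilinear_def linear_iff
  by (simp add: vec_eq_iff matrix_matrix_mult_def sum_3 algebra_simps scaleR_conv_of_real[where 'a=complex])

lemma bounded_bilinear_matrix_vec: "bounded_bilinear ((*v) :: complex^3^3 \<Rightarrow> complex^3 \<Rightarrow> complex^3)"
  unfolding bilinear_conv_bounded_bilinear[symmetric] bilinear_def linear_iff
  by (simp add: vec_eq_iff matrix_vector_mult_def sum_3 algebra_simps scaleR_conv_of_real[where 'a=complex])

lemma bounded_linear_adj: "bounded_linear (adj :: complex^3^3 \<Rightarrow> complex^3^3)"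
  unfolding linear_conv_bounded_linear[symmetric] linear_iff
  by (simp add: vec_eq_iff)

lemma bounded_linear_column: "bounded_linear (column i :: complex^3^3 \<Rightarrow> complex^3)"
  unfolding linear_conv_bounded_linear[symmetric] linear_iff
  by (simp add: vec_eq_iff column_def)

lemma bounded_linear_entry: "bounded_linear (\<lambda>M::complex^3^3. M $ i $ j)"
  unfolding linear_conv_bounded_linear[symmetric] linear_iff by simp

lemma bounded_linear_of_columns:
  "bounded_linear (\<lambda>u. of_columns u 0 0)" "bounded_linear (\<lambda>u. of_columns 0 u 0)" "bounded_linear (\<lambda>u. of_columns 0 0 u)"
  unfolding linear_conv_bounded_linear[symmetric] linear_iff
  by (simp_all add: vec_eq_iff forall_3)

lemma of_columns_split: "of_columns u v w = of_columns u 0 0 + of_columns 0 v 0 + of_columns 0 0 w"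
  by (simp add: vec_eq_iff forall_3)

lemma deriv_on_of_columns:
  assumes "deriv_on J u u'" "deriv_on J v v'" "deriv_on J w w'"
  shows "deriv_on J (\<lambda>t. of_columns (u t) (v t) (w t)) (\<lambda>t. of_columns (u' t) (v' t) (w' t))"
  using deriv_on_add[OF deriv_on_add[OF deriv_on_linear[OF bounded_linear_of_columns(1) assms(1)]
    deriv_on_linear[OF bounded_linear_of_columns(2) assms(2)]] deriv_on_linear[OF bounded_linear_of_columns(3) assms(3)]]
  by (simp flip: of_columns_split)

lemmas diffn_smult = diffn_bilinear[OF bounded_bilinear_smult]
lemmas diffn_herm = diffn_bilinear[OF bounded_bilinear_herm]
lemmas deriv_on_smult = deriv_on_bilinear[OF bounded_bilinear_smult]
lemmas deriv_on_herm = deriv_on_bilinear[OF bounded_bilinear_herm]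
lemmas deriv_on_matrix_mult = deriv_on_bilinear[OF bounded_bilinear_matrix_mult]
lemmas deriv_on_adj = deriv_on_linear[OF bounded_linear_adj]

lemma deriv_on_mult:
  fixes f g :: "real \<Rightarrow> 'a::real_normed_algebra"
  shows "deriv_on J f f' \<Longrightarrow> deriv_on J g g' \<Longrightarrow> deriv_on J (\<lambda>t. f t * g t) (\<lambda>t. f t * g' t + f' t * g t)"
  by (rule deriv_on_bilinear[OF bounded_bilinear_mult])

text \<open>Liouville's formula, obtained by expanding the 3 by 3 determinant.\<close>

lemma deriv_on_det:
  fixes B K :: "real \<Rightarrow> complex^3^3"
  assumes "deriv_on J B (\<lambda>t. B t ** K t)"
  shows "deriv_on J (\<lambda>t. det (B t)) (\<lambda>t. trace (K t) * det (B t))"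
  unfolding deriv_on_def
proof
  fix t assume t: "t \<in> J"
  have e: "((\<lambda>t. B t $ i $ j) has_vector_derivative (B t ** K t) $ i $ j) (at t within J)" for i j
    using deriv_onD[OF deriv_on_linear[OF bounded_linear_entry assms] t] .
  note [derivative_intros] = e
  show "((\<lambda>t. det (B t)) has_vector_derivative trace (K t) * det (B t)) (at t within J)"
    unfolding det_3
    by (rule derivative_eq_intros refl)+ (simp add: matrix_matrix_mult_def sum_3 trace_def algebra_simps)
qed

lemma matrix_add_rdist: "(A + B) ** C = A ** C + B ** C" for A B C :: "complex^3^3"
  by (simp add: vec_eq_iff matrix_matrix_mult_def algebra_simps sum.distrib)

text \<open>Along two solutions of \<open>B' = BK\<close> with \<open>K\<close> in the Lie algebra, the product \<open>C h B\<^sup>*\<close> is constant;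
  no uniqueness theorem for the differential equation is needed.\<close>

lemma frame_const:
  fixes B C K :: "real \<Rightarrow> complex^3^3"
  assumes J: "intvl J" and B: "deriv_on J B (\<lambda>t. B t ** K t)" and C: "deriv_on J C (\<lambda>t. C t ** K t)"
    and K: "\<And>t. t \<in> J \<Longrightarrow> K t ** hmat + hmat ** adj (K t) = 0" and st: "s \<in> J" "t \<in> J"
  shows "C s ** hmat ** adj (B s) = C t ** hmat ** adj (B t)"
proof -
  have "deriv_on J (\<lambda>t. C t ** (hmat ** adj (B t))) (\<lambda>t. 0)"
  proof (rule deriv_on_cong[OF deriv_on_matrix_mult[OF C
          deriv_on_matrix_mult[OF deriv_on_const deriv_on_adj[OF B]]]])
    fix t assume "t \<in> J"
    have "C t ** (hmat ** adj (B t ** K t) + 0 ** adj (B t)) + C t ** K t ** (hmat ** adj (B t))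
       = C t ** (K t ** hmat + hmat ** adj (K t)) ** adj (B t)"
      by (simp add: adj_mult matrix_mul_assoc matrix_add_ldistrib matrix_add_rdist)
    also have "\<dots> = 0" using K[OF \<open>t \<in> J\<close>] by simp
    finally show "C t ** (hmat ** adj (B t ** K t) + 0 ** adj (B t)) + C t ** K t ** (hmat ** adj (B t)) = 0" .
  qed simp
  from deriv_on_zero_const[OF J this st] show ?thesis by (simp add: matrix_mul_assoc)
qed

section \<open>Points and the action\<close>

lemma smult_smult: "a *s (b *s z) = (a * b) *s z" for z :: "complex^3"
  by (simp add: vec_eq_iff)

lemma pt_self: "z \<in> pt z"
  unfolding pt_def by (metis rangeI vector_smult_lid)

lemma pt_smult: "c \<noteq> 0 \<Longrightarrow> pt (c *s z) = pt z"
proof -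
  assume c: "c \<noteq> 0"
  have "k *s z = (k / c) *s (c *s z)" for k using c by (simp add: smult_smult)
  then have "pt z \<subseteq> pt (c *s z)" unfolding pt_def by (metis (no_types, lifting) image_subsetI rangeI)
  moreover have "pt (c *s z) \<subseteq> pt z" unfolding pt_def by (auto simp: smult_smult)
  ultimately show ?thesis by blast
qed

lemma pt_eq_iff: "z \<noteq> 0 \<Longrightarrow> pt z = pt w \<longleftrightarrow> (\<exists>c. c \<noteq> 0 \<and> z = c *s w)"
proof
  assume "z \<noteq> 0" "pt z = pt w"
  then have "z \<in> pt w" using pt_self by blast
  then show "\<exists>c. c \<noteq> 0 \<and> z = c *s w" using \<open>z \<noteq> 0\<close> by (auto simp: pt_def)
qed (auto simp: pt_smult)

lemma chart_dom_eq: "chart_dom i = {p. \<exists>z. p = pt z \<and> z $ i \<noteq> 0}"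
proof -
  have "\<exists>w\<in>pt z. w $ i \<noteq> 0 \<Longrightarrow> z $ i \<noteq> 0" for z by (auto simp: pt_def)
  then show ?thesis unfolding chart_dom_def CP2_def using pt_self by fastforce
qed

lemma chart_pt: "z $ i \<noteq> 0 \<Longrightarrow> chart i (pt z) = inverse (z $ i) *s z"
  unfolding chart_def by (rule the_equality) (auto simp: pt_def eq_divide_eq inverse_eq_divide)

lemma act_pt: "act A (pt z) = pt (A *v z)"
  unfolding act_def pt_def by (auto simp: matrix_vector_mult_scaleR vector_scalar_commute image_iff)

lemma act_mult: "act (A ** B) p = act A (act B p)"
  by (simp add: act_def image_image matrix_vector_mul_assoc)

lemma act_one [simp]: "act (mat 1) p = p"
  by (simp add: act_def)

lemma act_CP2: "A \<in> G \<Longrightarrow> p \<in> CP2 \<Longrightarrow> act A p \<in> CP2"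
  unfolding CP2_def using G_mult_nonzero by (auto simp: act_pt)

section \<open>Lifts\<close>

text \<open>A definite product is needed besides \<open>herm\<close>: the latter vanishes on a null
  vector paired with itself, so it cannot recover the factor c from z and c z.\<close>

definition std_inner :: "complex^3 \<Rightarrow> complex^3 \<Rightarrow> complex" where
  "std_inner z w = (\<Sum>i\<in>UNIV. cnj (z $ i) * w $ i)"

lemma bounded_bilinear_std_inner: "bounded_bilinear std_inner"
  unfolding bilinear_conv_bounded_bilinear[symmetric] bilinear_def linear_iff
  by (simp add: std_inner_def sum_3 algebra_simps scaleR_conv_of_real[where 'a=complex])

lemma std_inner_self: "std_inner z z = of_real ((norm z)\<^sup>2)"
proof -
  have "(norm z)\<^sup>2 = (\<Sum>i\<in>UNIV. (cmod (z $ i))\<^sup>2)"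
    by (simp add: norm_vec_def L2_set_def sum_nonneg)
  then show ?thesis by (simp only: std_inner_def of_real_sum complex_norm_square mult.commute)
qed

lemma std_inner_smult: "std_inner z (c *s w) = c * std_inner z w"
  by (simp add: std_inner_def sum_3 algebra_simps)

lemma contact_form_eq: "contact_form z v = Im (herm z v) / (norm z)\<^sup>2"
proof -
  have "contact_form z v = Re (- \<i> * herm z v / of_real ((norm z)\<^sup>2))"
    using std_inner_self[of z] by (simp add: contact_form_def std_inner_def)
  then show ?thesis by (simp add: Re_divide_of_real)
qed

lemma contact_form_pos_iff: "z \<noteq> 0 \<Longrightarrow> contact_form z v > 0 \<longleftrightarrow> Im (herm z v) > 0"
  by (simp add: contact_form_eq zero_less_divide_iff)

section \<open>Change of lift and of parameter\<close>

lemma diffn_diff: "diffn n J f \<Longrightarrow> diffn n J g \<Longrightarrow> diffn n J (\<lambda>t. f t - g t)"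
  using diffn_add[OF _ diffn_minus, of n J f g] by simp

lemma diffn_det3:
  assumes "diffn n J u" "diffn n J v" "diffn n J w"
  shows "diffn n J (\<lambda>t. det3 (u t) (v t) (w t))"
proof -
  have "diffn n J (\<lambda>t. u t $ i)" "diffn n J (\<lambda>t. v t $ i)" "diffn n J (\<lambda>t. w t $ i)" for i
    using assms by (auto intro: diffn_linear[OF bounded_linear_vec_nth])
  then show ?thesis unfolding det3_of_columns det_3 of_columns_nth
    by (intro diffn_add diffn_diff diffn_mult)
qed

text \<open>The 2-jet of a lift changes in this triangular manner under rescaling and
  reparametrization; only the diagonal coefficients survive in the determinant.\<close>

lemma det3_lower:
  "det3 (a *s u) (b *s u + c *s v) (d *s u + e *s v + f *s w) = a * c * f * det3 u v w"
  by (simp add: det3_of_columns det_3 algebra_simps)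

text \<open>The case \<phi> = id compares two lifts of one curve, the general case two
  parametrizations. The determinant acquires the factor (l \<phi>')^3. In the contact term the part
  with l' is a multiple of <\<Gamma>2, \<Gamma>2> = 0, which leaves the factor |l|^2 \<phi>'. These
  scaling laws govern the normalizations of lift and parameter.\<close>

lemma lift_change:
  assumes "intvl U"
    and g1: "deriv_on U \<Gamma>1 D1" "deriv_on U D1 E1"
    and g2: "deriv_on J \<Gamma>2 D2" "deriv_on J D2 E2"
    and ph: "\<phi> ` U \<subseteq> J" "deriv_on U \<phi> \<phi>1" "deriv_on U \<phi>1 \<phi>2"
    and l: "deriv_on U l l1" "deriv_on U l1 l2"
    and eq: "\<And>t. t \<in> U \<Longrightarrow> \<Gamma>1 t = l t *s \<Gamma>2 (\<phi> t)"
    and t: "t \<in> U"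
  shows "D1 t = l1 t *s \<Gamma>2 (\<phi> t) + (l t * of_real (\<phi>1 t)) *s D2 (\<phi> t)"
    "E1 t = l2 t *s \<Gamma>2 (\<phi> t) + (2 * l1 t * of_real (\<phi>1 t) + l t * of_real (\<phi>2 t)) *s D2 (\<phi> t)
       + (l t * of_real (\<phi>1 t) ^ 2) *s E2 (\<phi> t)"
    "det3 (\<Gamma>1 t) (D1 t) (E1 t) = l t ^ 3 * of_real (\<phi>1 t) ^ 3 * det3 (\<Gamma>2 (\<phi> t)) (D2 (\<phi> t)) (E2 (\<phi> t))"
    "herm (\<Gamma>2 (\<phi> t)) (\<Gamma>2 (\<phi> t)) = 0 \<Longrightarrow>
      herm (\<Gamma>1 t) (D1 t) = of_real ((cmod (l t))\<^sup>2 * \<phi>1 t) * herm (\<Gamma>2 (\<phi> t)) (D2 (\<phi> t))"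
proof -
  have sc: "r *\<^sub>R z = of_real r *s z" for r and z :: "complex^3"
    by (simp add: vec_eq_iff scaleR_conv_of_real[where 'a=complex])
  have G: "deriv_on U (\<lambda>t. \<Gamma>2 (\<phi> t)) (\<lambda>t. of_real (\<phi>1 t) *s D2 (\<phi> t))"
    using deriv_on_compose[OF ph(2) g2(1) ph(1)] by (simp add: sc)
  have D: "deriv_on U (\<lambda>t. D2 (\<phi> t)) (\<lambda>t. of_real (\<phi>1 t) *s E2 (\<phi> t))"
    using deriv_on_compose[OF ph(2) g2(2) ph(1)] by (simp add: sc)
  have p: "deriv_on U (\<lambda>t. complex_of_real (\<phi>1 t)) (\<lambda>t. of_real (\<phi>2 t))"
    by (rule deriv_on_linear[OF bounded_linear_of_real ph(3)])
  have d1: "D1 t = l1 t *s \<Gamma>2 (\<phi> t) + (l t * of_real (\<phi>1 t)) *s D2 (\<phi> t)" if "t \<in> U" for t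
  proof -
    have "deriv_on U \<Gamma>1 (\<lambda>t. l t *s (of_real (\<phi>1 t) *s D2 (\<phi> t)) + l1 t *s \<Gamma>2 (\<phi> t))"
      by (rule deriv_on_cong[OF deriv_on_smult[OF l(1) G]]) (use eq in auto)
    from deriv_on_unique[OF assms(1) g1(1) this that] show ?thesis by (simp add: smult_smult)
  qed
  then show d1t: "D1 t = l1 t *s \<Gamma>2 (\<phi> t) + (l t * of_real (\<phi>1 t)) *s D2 (\<phi> t)" using t by blast
  have "deriv_on U D1 (\<lambda>t. (l1 t *s (of_real (\<phi>1 t) *s D2 (\<phi> t)) + l2 t *s \<Gamma>2 (\<phi> t)) +
     ((l t * of_real (\<phi>1 t)) *s (of_real (\<phi>1 t) *s E2 (\<phi> t)) +
      (l t * of_real (\<phi>2 t) + l1 t * of_real (\<phi>1 t)) *s D2 (\<phi> t)))"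
    by (rule deriv_on_cong[OF deriv_on_add[OF deriv_on_smult[OF l(2) G]
            deriv_on_smult[OF deriv_on_mult[OF l(1) p] D]]]) (use d1 in auto)
  from deriv_on_unique[OF assms(1) g1(2) this t]
  show e1: "E1 t = l2 t *s \<Gamma>2 (\<phi> t) + (2 * l1 t * of_real (\<phi>1 t) + l t * of_real (\<phi>2 t)) *s D2 (\<phi> t)
       + (l t * of_real (\<phi>1 t) ^ 2) *s E2 (\<phi> t)"
    by (simp add: vec_eq_iff algebra_simps power2_eq_square)
  show "det3 (\<Gamma>1 t) (D1 t) (E1 t) = l t ^ 3 * of_real (\<phi>1 t) ^ 3 * det3 (\<Gamma>2 (\<phi> t)) (D2 (\<phi> t)) (E2 (\<phi> t))"
    unfolding d1t e1 eq[OF t] det3_lower by (simp add: power2_eq_square power3_eq_cube)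
  show "herm (\<Gamma>1 t) (D1 t) = of_real ((cmod (l t))\<^sup>2 * \<phi>1 t) * herm (\<Gamma>2 (\<phi> t)) (D2 (\<phi> t))"
    if "herm (\<Gamma>2 (\<phi> t)) (\<Gamma>2 (\<phi> t)) = 0"
    unfolding d1t eq[OF t] by (simp add: herm_simps that complex_norm_square del: of_real_power)
qed

text \<open>The factor equals <\<Gamma>2, \<Gamma>1> / <\<Gamma>2, \<Gamma>2> in the standard inner
  product, so it inherits regularity although it was only chosen pointwise. A finite order n is kept
  because \<Gamma>2 may stand for a lift composed with a change of parameter whose regularity is
  still being established.\<close>

lemma scalar_diffn:
  fixes \<Gamma>1 \<Gamma>2 :: "real \<Rightarrow> complex^3"
  assumes "diffn n U \<Gamma>1" "diffn n U \<Gamma>2" "\<And>t. t \<in> U \<Longrightarrow> \<Gamma>1 t = l t *s \<Gamma>2 t" "\<And>t. t \<in> U \<Longrightarrow> \<Gamma>2 t \<noteq> 0"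
  shows "diffn n U l"
proof -
  have "diffn n U (\<lambda>t. std_inner (\<Gamma>2 t) (\<Gamma>1 t) * inverse (std_inner (\<Gamma>2 t) (\<Gamma>2 t)))"
    using assms by (intro diffn_mult diffn_inverse diffn_bilinear[OF bounded_bilinear_std_inner]) (auto simp: std_inner_self)
  then show ?thesis
    by (rule diffn_cong) (use assms in \<open>auto simp: std_inner_smult std_inner_self\<close>)
qed

lemma liftD:
  assumes "lift J \<gamma> \<Gamma>" "t \<in> J"
  shows "\<Gamma> t \<noteq> 0" "herm (\<Gamma> t) (\<Gamma> t) = 0" "\<gamma> t = pt (\<Gamma> t)"
  using assms by (auto simp: lift_def null_vectors_def)

lemma lift_derivs:
  assumes "intvl J" "lift J \<gamma> \<Gamma>"
  shows "deriv_on J \<Gamma> (vderiv J \<Gamma>)" "deriv_on J (vderiv J \<Gamma>) (vderiv J (vderiv J \<Gamma>))"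
    "deriv_on J (vderiv J (vderiv J \<Gamma>)) (vderiv J (vderiv J (vderiv J \<Gamma>)))"
proof -
  have s: "smooth_fun J \<Gamma>" using assms by (simp add: lift_def)
  note s1 = smooth_fun_obtain[OF assms(1) s]
  note s2 = smooth_fun_obtain[OF assms(1) s1(2)]
  show "deriv_on J \<Gamma> (vderiv J \<Gamma>)" "deriv_on J (vderiv J \<Gamma>) (vderiv J (vderiv J \<Gamma>))"
    "deriv_on J (vderiv J (vderiv J \<Gamma>)) (vderiv J (vderiv J (vderiv J \<Gamma>)))"
    using s1(1) s2(1) smooth_fun_obtain(1)[OF assms(1) s2(2)] .
qed

text \<open>Differentiating <\<Gamma>, \<Gamma>> = 0 shows that <\<Gamma>, \<Gamma>'> and its
  conjugate add up to 0.\<close>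

lemma lift_imaginary:
  assumes "intvl J" "lift J \<gamma> \<Gamma>" "t \<in> J"
  shows "Re (herm (\<Gamma> t) (vderiv J \<Gamma> t)) = 0"
proof -
  note d = lift_derivs(1)[OF assms(1,2)]
  have "deriv_on J (\<lambda>t. 0) (\<lambda>t. herm (\<Gamma> t) (vderiv J \<Gamma> t) + herm (vderiv J \<Gamma> t) (\<Gamma> t))"
    by (rule deriv_on_cong[OF deriv_on_herm[OF d d]]) (use liftD[OF assms(2)] in auto)
  from deriv_on_unique[OF assms(1) this deriv_on_const assms(3)]
  have "herm (\<Gamma> t) (vderiv J \<Gamma> t) + cnj (herm (\<Gamma> t) (vderiv J \<Gamma> t)) = 0"
    by (simp flip: herm_swap)
  then show ?thesis by (simp add: complex_add_cnj)
qed

lemma two_lifts: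
  assumes "intvl J" "lift J \<gamma> \<Gamma>1" "lift J \<gamma> \<Gamma>2"
  obtains l l1 l2 where "deriv_on J l l1" "deriv_on J l1 l2"
    "\<And>t. t \<in> J \<Longrightarrow> l t \<noteq> 0" "\<And>t. t \<in> J \<Longrightarrow> \<Gamma>1 t = l t *s \<Gamma>2 t"
proof -
  have "\<exists>c. c \<noteq> 0 \<and> \<Gamma>1 t = c *s \<Gamma>2 t" if "t \<in> J" for t
    using liftD[OF assms(2) that] liftD[OF assms(3) that] pt_eq_iff by metis
  then obtain l where l: "\<And>t. t \<in> J \<Longrightarrow> l t \<noteq> 0 \<and> \<Gamma>1 t = l t *s \<Gamma>2 t" by metis
  have "smooth_fun J \<Gamma>1" "smooth_fun J \<Gamma>2" using assms(2,3) by (simp_all add: lift_def)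
  then have "diffn (Suc (Suc 0)) J \<Gamma>1" "diffn (Suc (Suc 0)) J \<Gamma>2"
    unfolding smooth_fun_iff[OF assms(1)] by blast+
  then have "diffn (Suc (Suc 0)) J l"
    by (rule scalar_diffn) (use l liftD(1)[OF assms(3)] in blast)+
  then show ?thesis using that l by auto
qed

lemma two_lifts_invariants:
  assumes "intvl J" "lift J \<gamma> \<Gamma>1" "lift J \<gamma> \<Gamma>2" "t \<in> J"
  shows "\<exists>c. c \<noteq> 0 \<and> wronskian J \<Gamma>1 t = c ^ 3 * wronskian J \<Gamma>2 t \<and>
    herm (\<Gamma>1 t) (vderiv J \<Gamma>1 t) = of_real ((cmod c)\<^sup>2) * herm (\<Gamma>2 t) (vderiv J \<Gamma>2 t)"
proof -
  obtain l l1 l2 where l: "deriv_on J l l1" "deriv_on J l1 l2"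
    "\<And>t. t \<in> J \<Longrightarrow> l t \<noteq> 0" "\<And>t. t \<in> J \<Longrightarrow> \<Gamma>1 t = l t *s \<Gamma>2 t"
    using two_lifts[OF assms(1-3)] by metis
  have im: "(\<lambda>t. t) ` J \<subseteq> J" by simp
  note ch = lift_change[OF assms(1) lift_derivs(1,2)[OF assms(1,2)] lift_derivs(1,2)[OF assms(1,3)]
      im deriv_on_id deriv_on_const l(1,2) l(4) assms(4)]
  show ?thesis using ch(3,4) l(3)[OF assms(4)] liftD[OF assms(3,4)]
    by (intro exI[of _ "l t"]) (simp add: wronskian_def)
qed

text \<open>Near t some coordinate of \<Gamma> does not vanish, and in the chart of that coordinate
  the curve is \<Gamma> divided by it.\<close>

lemma lift_smooth_curve:
  assumes J: "intvl J" and "lift J \<gamma> \<Gamma>"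
  shows "smooth_curve J \<gamma>"
proof -
  note L = liftD[OF assms(2)]
  have sm: "smooth_fun J \<Gamma>" using assms by (simp add: lift_def)
  show ?thesis unfolding smooth_curve_def
  proof (intro conjI ballI)
    show "\<gamma> ` J \<subseteq> S" using assms by (auto simp: lift_def S_def)
    fix t assume t: "t \<in> J"
    from L(1)[OF t] obtain i where i: "\<Gamma> t $ i \<noteq> 0" by (auto simp: vec_eq_iff)
    have "continuous_on J (\<lambda>s. \<Gamma> s $ i)"
      using smooth_fun_continuous[OF J sm] by (intro continuous_intros)
    from continuous_on_avoid[OF this t i] obtain e where e: "e > 0" "\<And>y. y \<in> J \<Longrightarrow> dist t y < e \<Longrightarrow> \<Gamma> y $ i \<noteq> 0"
      by blast
    let ?U = "J \<inter> ball t e"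
    note U = intvl_Int_ball[OF J t e(1)]
    have "diffn n ?U (\<lambda>s. inverse (\<Gamma> s $ i) *s \<Gamma> s)" for n
    proof -
      have "diffn n ?U \<Gamma>" using sm by (auto simp: smooth_fun_iff[OF J] intro: diffn_subset)
      then show ?thesis
        by (intro diffn_smult diffn_inverse diffn_linear[OF bounded_linear_vec_nth]) (use e in auto)
    qed
    then have "smooth_fun ?U (\<lambda>s. inverse (\<Gamma> s $ i) *s \<Gamma> s)" by (simp add: smooth_fun_iff[OF U])
    then have "smooth_fun ?U (\<lambda>s. chart i (\<gamma> s))"
      by (rule smooth_fun_cong[OF U]) (use e chart_pt L(3) in auto)
    moreover have "\<gamma> ` ?U \<subseteq> chart_dom i" unfolding chart_dom_eq using e L(3) by fastforce
    ultimately show "\<exists>i. \<exists>e>0. \<gamma> ` (J \<inter> ball t e) \<subseteq> chart_dom i \<and> smooth_fun (J \<inter> ball t e) (\<lambda>s. chart i (\<gamma> s))"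
      using e(1) by blast
  qed
qed

text \<open>A change of lift multiplies <\<Gamma>, \<Gamma>'> by |c|^2 > 0, so any given lift can
  test a condition that is defined by the existence of a suitable one.\<close>

lemma lift_transversal_iff:
  assumes "intvl J" "lift J \<gamma> \<Gamma>"
  shows "transversal J \<gamma> \<longleftrightarrow> (\<forall>t\<in>J. Im (herm (\<Gamma> t) (vderiv J \<Gamma> t)) > 0)"
proof
  assume "transversal J \<gamma>"
  then obtain \<Gamma>' where G': "lift J \<gamma> \<Gamma>'" "\<forall>t\<in>J. contact_form (\<Gamma>' t) (vderiv J \<Gamma>' t) > 0"
    by (auto simp: transversal_def)
  show "\<forall>t\<in>J. Im (herm (\<Gamma> t) (vderiv J \<Gamma> t)) > 0"
  proof
    fix t assume t: "t \<in> J"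
    obtain c where "c \<noteq> 0"
      "herm (\<Gamma> t) (vderiv J \<Gamma> t) = of_real ((cmod c)\<^sup>2) * herm (\<Gamma>' t) (vderiv J \<Gamma>' t)"
      using two_lifts_invariants[OF assms G'(1) t] by blast
    moreover have "Im (herm (\<Gamma>' t) (vderiv J \<Gamma>' t)) > 0"
      using G' t liftD[OF G'(1)] contact_form_pos_iff by metis
    ultimately show "Im (herm (\<Gamma> t) (vderiv J \<Gamma> t)) > 0" by (simp del: of_real_power)
  qed
next
  assume "\<forall>t\<in>J. Im (herm (\<Gamma> t) (vderiv J \<Gamma> t)) > 0"
  then show "transversal J \<gamma>"
    using assms lift_smooth_curve liftD(1) contact_form_pos_iff unfolding transversal_def by metis
qed

lemma lift_generic_iff:
  assumes "intvl J" "lift J \<gamma> \<Gamma>"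
  shows "generic_transversal J \<gamma> \<longleftrightarrow>
    (\<forall>t\<in>J. Im (herm (\<Gamma> t) (vderiv J \<Gamma> t)) > 0 \<and> wronskian J \<Gamma> t \<noteq> 0)"
proof -
  have "wronskian J \<Gamma> t \<noteq> 0" if "lift J \<gamma> \<Gamma>'" "wronskian J \<Gamma>' t \<noteq> 0" "t \<in> J" for \<Gamma>' t
    using two_lifts_invariants[OF assms that(1,3)] that(2) by auto
  then show ?thesis unfolding generic_transversal_def lift_transversal_iff[OF assms]
    using assms by blast
qed

text \<open>Rescaling a lift by l multiplies its Wronskian W by l^3, so a smooth cube root of -1/W
  along J is wanted. Instead of choosing branches, l is taken as the solution of a linear equation
  that keeps l^3 W constant.\<close>

lemma wilczynski_exists:
  assumes J: "intvl J" and "generic_transversal J \<gamma>"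
  obtains \<Gamma> where "wilczynski_lift J \<gamma> \<Gamma>"
proof -
  obtain \<Gamma>0 where G0: "lift J \<gamma> \<Gamma>0" "\<And>t. t \<in> J \<Longrightarrow> wronskian J \<Gamma>0 t \<noteq> 0"
    using assms by (auto simp: generic_transversal_def)
  obtain t0 where t0: "t0 \<in> J" using J by (auto simp: intvl_def)
  define W where "W = wronskian J \<Gamma>0"
  have sm: "smooth_fun J \<Gamma>0" "smooth_fun J (vderiv J \<Gamma>0)" "smooth_fun J (vderiv J (vderiv J \<Gamma>0))"
  proof -
    show s: "smooth_fun J \<Gamma>0" using G0 by (simp add: lift_def)
    show s1: "smooth_fun J (vderiv J \<Gamma>0)" by (rule smooth_fun_obtain(2)[OF J s])
    show "smooth_fun J (vderiv J (vderiv J \<Gamma>0))" by (rule smooth_fun_obtain(2)[OF J s1])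
  qed
  have W: "smooth_fun J W" using sm unfolding W_def wronskian_def smooth_fun_iff[OF J]
    by (blast intro: diffn_det3)
  have W0: "W t \<noteq> 0" if "t \<in> J" for t using G0(2) that by (simp add: W_def)
  note W' = smooth_fun_obtain[OF J W]
  \<comment> \<open>This is l' / l as dictated by 3 l' / l + W' / W = 0.\<close>
  define c where "c t = - (vderiv J W t * inverse (3 * W t))" for t
  have c: "smooth_fun J c" using W W'(2) unfolding c_def smooth_fun_iff[OF J]
    by (intro allI diffn_minus diffn_mult diffn_inverse diffn_const) (use W0 in auto)
  \<comment> \<open>The logarithm picks a cube root at the single point t0, so its branch cut does
    not matter.\<close>
  obtain l where l: "deriv_on J l (\<lambda>t. l t * c t)" "l t0 = exp (Ln (- inverse (W t0)) / 3)"
    using linear_ode[OF J t0 bounded_bilinear_mult smooth_fun_continuous[OF J c]] by metis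
  have ls: "smooth_fun J l" by (rule linear_ode_smooth[OF J bounded_bilinear_mult c l(1)])
  have l0: "l t0 ^ 3 * W t0 = -1"
    using W0[OF t0] unfolding l(2) by (simp flip: exp_of_nat_mult)
  have "deriv_on J (\<lambda>t. l t * (l t * (l t * W t))) (\<lambda>t. 0)"
  proof (rule deriv_on_cong[OF deriv_on_mult[OF l(1) deriv_on_mult[OF l(1) deriv_on_mult[OF l(1) W'(1)]]]])
    fix t assume t: "t \<in> J"
    then show "l t * (l t * (l t * vderiv J W t + l t * c t * W t) + l t * c t * (l t * W t)) + l t * c t * (l t * (l t * W t)) = 0"
      using W0[OF t] by (simp add: c_def field_simps)
  qed simp
  then have lW: "l t ^ 3 * W t = -1" if "t \<in> J" for t
    using deriv_on_zero_const[OF J, of "\<lambda>t. l t * (l t * (l t * W t))", OF _ that t0] l0 by (simp add: power3_eq_cube mult.assoc)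
  have lne: "l t \<noteq> 0" if "t \<in> J" for t using lW[OF that] by auto
  define \<Gamma> where "\<Gamma> t = l t *s \<Gamma>0 t" for t
  have "smooth_fun J \<Gamma>" using ls sm unfolding \<Gamma>_def smooth_fun_iff[OF J] by (blast intro: diffn_smult)
  then have L: "lift J \<gamma> \<Gamma>" using G0(1) lne
    unfolding lift_def \<Gamma>_def null_vectors_def by (auto simp: herm_simps pt_smult vec_eq_iff)
  have im: "(\<lambda>t. t) ` J \<subseteq> J" by simp
  have "wronskian J \<Gamma> t = -1" if t: "t \<in> J" for t
  proof -
    have sl: "deriv_on J l (vderiv J l)" "deriv_on J (vderiv J l) (vderiv J (vderiv J l))"
      using smooth_fun_obtain[OF J] ls by blast+
    show ?thesis
      using lift_change(3)[OF J lift_derivs(1,2)[OF J L] lift_derivs(1,2)[OF J G0(1)]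
      im deriv_on_id deriv_on_const sl _ t] \<Gamma>_def lW[OF t] by (simp add: wronskian_def W_def)
  qed
  then show ?thesis using that[of \<Gamma>] L by (simp add: wilczynski_lift_def)
qed

text \<open>Differentiating l^3 = 1 gives 3 l^2 l' = 0 with l nonzero. This lets the factor between
  two Wilczynski lifts pass through derivatives.\<close>

lemma deriv_on_root_of_unity:
  fixes l :: "real \<Rightarrow> complex"
  assumes J: "intvl J" and l: "deriv_on J l l'" "\<And>t. t \<in> J \<Longrightarrow> l t ^ 3 = 1" and t: "t \<in> J"
  shows "l' t = 0"
proof -
  have "deriv_on J (\<lambda>t. 1) (\<lambda>t. l t * (l t * l' t + l' t * l t) + l' t * (l t * l t))"
    by (rule deriv_on_cong[OF deriv_on_mult[OF l(1) deriv_on_mult[OF l(1) l(1)]]])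
      (use l(2) in \<open>auto simp: power3_eq_cube mult.assoc\<close>)
  from deriv_on_unique[OF J this deriv_on_const t]
  have "3 * (l t * l t) * l' t = 0" by (simp add: algebra_simps)
  moreover have "l t \<noteq> 0" using l(2)[OF t] by auto
  ultimately show ?thesis by simp
qed

text \<open>The factor between the lifts satisfies l^3 = 1 and has vanishing derivatives. What is
  recorded is that it has modulus 1 and is common to the whole 2-jet at t, which is all that the
  Hermitian invariants see.\<close>

lemma wilczynski_unique:
  assumes J: "intvl J" and w1: "wilczynski_lift J \<gamma> \<Gamma>1" and w2: "wilczynski_lift J \<gamma> \<Gamma>2" and t: "t \<in> J"
  obtains c where "cmod c = 1" "\<Gamma>1 t = c *s \<Gamma>2 t" "vderiv J \<Gamma>1 t = c *s vderiv J \<Gamma>2 t"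
     "vderiv J (vderiv J \<Gamma>1) t = c *s vderiv J (vderiv J \<Gamma>2) t"
proof -
  have L: "lift J \<gamma> \<Gamma>1" "lift J \<gamma> \<Gamma>2" using w1 w2 by (auto simp: wilczynski_lift_def)
  obtain l l1 l2 where l: "deriv_on J l l1" "deriv_on J l1 l2"
    "\<And>t. t \<in> J \<Longrightarrow> l t \<noteq> 0" "\<And>t. t \<in> J \<Longrightarrow> \<Gamma>1 t = l t *s \<Gamma>2 t"
    using two_lifts[OF J L] by metis
  have im: "(\<lambda>t. t) ` J \<subseteq> J" by simp
  note ch = lift_change[OF J lift_derivs(1,2)[OF J L(1)] lift_derivs(1,2)[OF J L(2)]
      im deriv_on_id deriv_on_const l(1,2) l(4)]
  have l3: "l t ^ 3 = 1" if "t \<in> J" for t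
    using ch(3)[OF _ that] w1 w2 that unfolding wilczynski_lift_def wronskian_def by simp
  have l1: "l1 t = 0" if "t \<in> J" for t by (rule deriv_on_root_of_unity[OF J l(1) l3 that])
  have "deriv_on J l1 (\<lambda>t. 0)" by (rule deriv_on_cong[OF deriv_on_const]) (use l1 in auto)
  from deriv_on_unique[OF J l(2) this t] have l2: "l2 t = 0" .
  have "cmod (l t) ^ 3 = 1 ^ 3" using l3[OF t] by (simp flip: norm_power)
  then have "cmod (l t) = 1" by (rule power_eq_imp_eq_base) auto
  then show ?thesis using that[of "l t"] ch(1,2)[OF _ t] l(4) t l1[OF t] l2 by simp
qed

lemma wlift: "intvl J \<Longrightarrow> generic_transversal J \<gamma> \<Longrightarrow> wilczynski_lift J \<gamma> (wlift J \<gamma>)"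
  unfolding wlift_def by (metis wilczynski_exists someI_ex)

text \<open>Frees the invariants from the choice made by \<open>SOME\<close> in
  \<open>wlift\<close>.\<close>

lemma wlift_eqs:
  assumes J: "intvl J" and w: "wilczynski_lift J \<gamma> \<Gamma>" and t: "t \<in> J"
  shows "strain J \<gamma> t = Re (\<i> * inverse (herm (\<Gamma> t) (vderiv J \<Gamma> t)))"
    "bending J \<gamma> t = 1/2 * Re (herm (vderiv J \<Gamma> t) (vderiv J \<Gamma> t))"
    "twist J \<gamma> t = Im (herm (vderiv J (vderiv J \<Gamma>) t) (vderiv J \<Gamma> t)) + 3 * (bending J \<gamma> t)\<^sup>2"
proof -
  have "wilczynski_lift J \<gamma> (wlift J \<gamma>)" unfolding wlift_def using w by (metis someI_ex)
  from wilczynski_unique[OF J this w t] obtain c where c: "cmod c = 1" "wlift J \<gamma> t = c *s \<Gamma> t"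
    "vderiv J (wlift J \<gamma>) t = c *s vderiv J \<Gamma> t"
    "vderiv J (vderiv J (wlift J \<gamma>)) t = c *s vderiv J (vderiv J \<Gamma>) t" by metis
  note h = herm_unit_smult[OF c(1)]
  show "strain J \<gamma> t = Re (\<i> * inverse (herm (\<Gamma> t) (vderiv J \<Gamma> t)))"
    "bending J \<gamma> t = 1/2 * Re (herm (vderiv J \<Gamma> t) (vderiv J \<Gamma> t))"
    "twist J \<gamma> t = Im (herm (vderiv J (vderiv J \<Gamma>) t) (vderiv J \<Gamma> t)) + 3 * (bending J \<gamma> t)\<^sup>2"
    unfolding strain_def twist_def c h by (auto simp: bending_def c h)
qed

text \<open>Unit strain controls only a real part; since <\<Gamma>, \<Gamma>'> = i y with y real, it
  says 1/y = 1.\<close>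

lemma naturalD:
  assumes J: "intvl J" and n: "natural J \<gamma>" and w: "wilczynski_lift J \<gamma> \<Gamma>" and t: "t \<in> J"
  shows "herm (\<Gamma> t) (vderiv J \<Gamma> t) = \<i>"
proof -
  have "lift J \<gamma> \<Gamma>" using w by (simp add: wilczynski_lift_def)
  from lift_imaginary[OF J this t] obtain y where y: "herm (\<Gamma> t) (vderiv J \<Gamma> t) = \<i> * of_real y"
    by (metis complex_eq add_0 of_real_0)
  have "strain J \<gamma> t = 1" using n t by (simp add: natural_def)
  then have "Re (\<i> * inverse (\<i> * of_real y)) = 1" using wlift_eqs(1)[OF J w t] y by simp
  then have "Re (of_real (inverse y) :: complex) = 1" by (simp add: field_simps)
  then have "y = 1" by (metis Re_complex_of_real inverse_eq_1_iff)
  then show ?thesis using y by simp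
qed

lemma naturalI:
  assumes J: "intvl J" and w: "wilczynski_lift J \<gamma> \<Gamma>" and h: "\<And>t. t \<in> J \<Longrightarrow> herm (\<Gamma> t) (vderiv J \<Gamma> t) = \<i>"
  shows "natural J \<gamma>"
proof -
  have "lift J \<gamma> \<Gamma>" "\<And>t. t \<in> J \<Longrightarrow> wronskian J \<Gamma> t = -1" using w by (auto simp: wilczynski_lift_def)
  then have "generic_transversal J \<gamma>" using lift_generic_iff[OF J] h by simp
  then show ?thesis unfolding natural_def using wlift_eqs(1)[OF J w] h by simp
qed

section \<open>The action on curves\<close>

lemma vderiv_mult_vec:
  fixes A :: "complex^3^3"
  assumes "intvl J" "smooth_fun J \<Gamma>" "t \<in> J"
  shows "vderiv J (\<lambda>t. A *v \<Gamma> t) t = A *v vderiv J \<Gamma> t"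
  by (rule vderiv_eq[OF assms(1) _ assms(3)])
    (rule deriv_on_linear[OF bounded_bilinear.bounded_linear_right[OF bounded_bilinear_matrix_vec]
      smooth_fun_obtain(1)[OF assms(1,2)]])

lemma vderiv_vderiv_mult_vec:
  fixes A :: "complex^3^3"
  assumes "intvl J" "smooth_fun J \<Gamma>" "t \<in> J"
  shows "vderiv J (vderiv J (\<lambda>t. A *v \<Gamma> t)) t = A *v vderiv J (vderiv J \<Gamma>) t"
proof -
  have "deriv_on J (vderiv J (\<lambda>t. A *v \<Gamma> t)) (\<lambda>t. A *v vderiv J (vderiv J \<Gamma>) t)"
    by (rule deriv_on_cong[OF deriv_on_linear[OF bounded_bilinear.bounded_linear_right[OF bounded_bilinear_matrix_vec]
      smooth_fun_obtain(1)[OF assms(1) smooth_fun_obtain(2)[OF assms(1,2)]]]])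
      (simp_all add: vderiv_mult_vec[OF assms(1,2)])
  from vderiv_eq[OF assms(1) this assms(3)] show ?thesis .
qed

lemma lift_act:
  assumes "intvl J" "A \<in> G" "lift J \<gamma> \<Gamma>"
  shows "lift J (act A \<circ> \<gamma>) (\<lambda>t. A *v \<Gamma> t)"
  using assms unfolding lift_def
  by (auto simp: act_pt null_vectors_G smooth_fun_iff
      intro: diffn_linear[OF bounded_bilinear.bounded_linear_right[OF bounded_bilinear_matrix_vec]])

lemma lift_act_invariants:
  assumes "intvl J" "A \<in> G" "lift J \<gamma> \<Gamma>" "t \<in> J"
  shows "wronskian J (\<lambda>t. A *v \<Gamma> t) t = wronskian J \<Gamma> t"
    "herm (A *v \<Gamma> t) (vderiv J (\<lambda>t. A *v \<Gamma> t) t) = herm (\<Gamma> t) (vderiv J \<Gamma> t)"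
proof -
  have "smooth_fun J \<Gamma>" using assms by (simp add: lift_def)
  note v = vderiv_mult_vec[OF assms(1) this assms(4)] vderiv_vderiv_mult_vec[OF assms(1) this assms(4)]
  show "wronskian J (\<lambda>t. A *v \<Gamma> t) t = wronskian J \<Gamma> t"
    "herm (A *v \<Gamma> t) (vderiv J (\<lambda>t. A *v \<Gamma> t) t) = herm (\<Gamma> t) (vderiv J \<Gamma> t)"
    unfolding wronskian_def v det3_mult_vec using assms(2) by (auto simp: herm_G G_iff)
qed

lemma transversal_act:
  assumes "intvl J" "A \<in> G" "transversal J \<gamma>"
  shows "transversal J (act A \<circ> \<gamma>)"
proof -
  obtain \<Gamma> where L: "lift J \<gamma> \<Gamma>" using assms(3) by (auto simp: transversal_def)
  show ?thesis
    using assms(3) lift_act_invariants(2)[OF assms(1,2) L]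
    unfolding lift_transversal_iff[OF assms(1) L] lift_transversal_iff[OF assms(1) lift_act[OF assms(1,2) L]]
    by simp
qed

lemma generic_act:
  assumes "intvl J" "A \<in> G" "generic_transversal J \<gamma>"
  shows "generic_transversal J (act A \<circ> \<gamma>)"
proof -
  obtain \<Gamma> where L: "lift J \<gamma> \<Gamma>" using assms(3) by (auto simp: generic_transversal_def)
  show ?thesis
    using assms(3) lift_act_invariants[OF assms(1,2) L]
    unfolding lift_generic_iff[OF assms(1) L] lift_generic_iff[OF assms(1) lift_act[OF assms(1,2) L]]
    by simp
qed

lemma wilczynski_act:
  assumes "intvl J" "A \<in> G" "wilczynski_lift J \<gamma> \<Gamma>"
  shows "wilczynski_lift J (act A \<circ> \<gamma>) (\<lambda>t. A *v \<Gamma> t)"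
  using assms lift_act[OF assms(1,2)] lift_act_invariants(1)[OF assms(1,2)]
  unfolding wilczynski_lift_def by auto

lemma natural_act:
  assumes J: "intvl J" and A: "A \<in> G" and n: "natural J \<gamma>"
  shows "natural J (act A \<circ> \<gamma>)" "t \<in> J \<Longrightarrow> bending J (act A \<circ> \<gamma>) t = bending J \<gamma> t"
    "t \<in> J \<Longrightarrow> twist J (act A \<circ> \<gamma>) t = twist J \<gamma> t"
proof -
  obtain \<Gamma> where w: "wilczynski_lift J \<gamma> \<Gamma>" using wilczynski_exists[OF J] n by (auto simp: natural_def)
  then have L: "lift J \<gamma> \<Gamma>" and sm: "smooth_fun J \<Gamma>" by (auto simp: wilczynski_lift_def lift_def)
  note wA = wilczynski_act[OF J A w]
  show "natural J (act A \<circ> \<gamma>)"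
    by (rule naturalI[OF J wA]) (use lift_act_invariants(2)[OF J A L] naturalD[OF J n w] in simp)
  note v = vderiv_mult_vec[OF J sm] vderiv_vderiv_mult_vec[OF J sm]
  show b: "bending J (act A \<circ> \<gamma>) t = bending J \<gamma> t" if "t \<in> J"
    using wlift_eqs(2)[OF J w that] wlift_eqs(2)[OF J wA that] by (simp add: v that herm_G[OF A])
  show "twist J (act A \<circ> \<gamma>) t = twist J \<gamma> t" if "t \<in> J"
    using wlift_eqs(3)[OF J w that] wlift_eqs(3)[OF J wA that] b[OF that] by (simp add: v that herm_G[OF A])
qed

section \<open>Frames along natural curves\<close>

text \<open>The columns are the coordinates of \<Gamma>', F2', F3' with respect to the frame
  (\<Gamma>, F2, F3).\<close>

definition Kmat :: "real \<Rightarrow> real \<Rightarrow> complex^3^3" where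
  "Kmat k \<tau> = of_columns (vector [\<i> * of_real k, 0, 1]) (vector [- \<i>, - 2 * \<i> * of_real k, 0])
     (vector [of_real \<tau>, 1, \<i> * of_real k])"

lemma Kmat_nth [simp]:
  "Kmat k \<tau> $ 1 $ 1 = \<i> * of_real k" "Kmat k \<tau> $ 2 $ 1 = 0" "Kmat k \<tau> $ 3 $ 1 = 1"
  "Kmat k \<tau> $ 1 $ 2 = - \<i>" "Kmat k \<tau> $ 2 $ 2 = - 2 * \<i> * of_real k" "Kmat k \<tau> $ 3 $ 2 = 0"
  "Kmat k \<tau> $ 1 $ 3 = of_real \<tau>" "Kmat k \<tau> $ 2 $ 3 = 1" "Kmat k \<tau> $ 3 $ 3 = \<i> * of_real k"
  by (simp_all add: Kmat_def)

lemma i_mult_i: "\<i> * z * \<i> = - z"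
  by (simp add: complex_eq_iff)

text \<open>Multiplication by \<open>hmat\<close> on both sides turns this into the usual condition
  for the Lie algebra of the unitary group of \<open>hmat\<close>; the present form is the one that
  arises in \<open>frame_const\<close>.\<close>

lemma Kmat_lie: "Kmat k \<tau> ** hmat + hmat ** adj (Kmat k \<tau>) = 0"
  by (simp add: vec_eq_iff forall_3 matrix_matrix_mult_def sum_3 i_mult_i)

lemma trace_Kmat: "trace (Kmat k \<tau>) = 0"
  by (simp add: trace_def sum_3)

lemma column_of_columns [simp]: "column 1 (of_columns u v w) = u" "column 2 (of_columns u v w) = v" "column 3 (of_columns u v w) = w"
  by (simp_all add: vec_eq_iff column_def)

lemma of_columns_columns: "of_columns (column 1 B) (column 2 B) (column 3 B) = B"
  by (simp add: vec_eq_iff forall_3 column_def)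

lemma column_mult:
  fixes B K :: "complex^3^3"
  shows "column j (B ** K) = K $ 1 $ j *s column 1 B + K $ 2 $ j *s column 2 B + K $ 3 $ j *s column 3 B"
  by (simp add: vec_eq_iff column_def matrix_matrix_mult_def sum_3 mult.commute)

lemma gram_G:
  assumes "adj B ** hmat ** B = hmat"
  shows "herm (column i B) (column j B) = hmat $ i $ j"
  using assms gram_nth by metis

lemma deriv_on_Re: "deriv_on J f f' \<Longrightarrow> deriv_on J (\<lambda>t. Re (f t)) (\<lambda>t. Re (f' t))"
  and diffn_Re: "diffn n J f \<Longrightarrow> diffn n J (\<lambda>t. Re (f t))"
  and diffn_Im: "diffn n J f \<Longrightarrow> diffn n J (\<lambda>t. Im (f t))"
  and diffn_of_real: "diffn n J g \<Longrightarrow> diffn n J (\<lambda>t. complex_of_real (g t))"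
  and deriv_on_of_real: "deriv_on J g g' \<Longrightarrow> deriv_on J (\<lambda>t. complex_of_real (g t)) (\<lambda>t. of_real (g' t))"
  using deriv_on_linear[OF bounded_linear_Re] diffn_linear[OF bounded_linear_Re]
    diffn_linear[OF bounded_linear_Im] diffn_linear[OF bounded_linear_of_real]
    deriv_on_linear[OF bounded_linear_of_real] by blast+

lemma natural_frame:
  assumes J: "intvl J" and nat: "natural J \<gamma>" and w: "wilczynski_lift J \<gamma> \<Gamma>"
  obtains B where "deriv_on J B (\<lambda>t. B t ** Kmat (bending J \<gamma> t) (twist J \<gamma> t))"
    "\<And>t. t \<in> J \<Longrightarrow> B t \<in> G" "\<And>t. t \<in> J \<Longrightarrow> column 1 (B t) = \<Gamma> t"
proof -
  have L: "lift J \<gamma> \<Gamma>" and W: "\<And>t. t \<in> J \<Longrightarrow> wronskian J \<Gamma> t = -1"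
    using w by (auto simp: wilczynski_lift_def)
  define D where "D = vderiv J \<Gamma>"
  define E where "E = vderiv J D"
  note gd = lift_derivs[OF J L, folded D_def, folded E_def]
  have sG: "smooth_fun J \<Gamma>" using L by (simp add: lift_def)
  have sD: "smooth_fun J D" unfolding D_def by (rule smooth_fun_obtain(2)[OF J sG])
  have sE: "smooth_fun J E" unfolding E_def by (rule smooth_fun_obtain(2)[OF J sD])
  have dG: "diffn n J \<Gamma>" "diffn n J D" "diffn n J E" for n
    using sG sD sE by (simp_all add: smooth_fun_iff[OF J])
  define k where "k t = Re (herm (D t) (D t)) / 2" for t
  define k' where "k' t = Re (herm (D t) (E t))" for t
  define \<tau> where "\<tau> t = Im (herm (E t) (D t)) + 3 * (k t)\<^sup>2" for t
  have bend: "bending J \<gamma> t = k t" if "t \<in> J" for t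
    using wlift_eqs(2)[OF J w that] by (simp add: k_def D_def)
  have twi: "twist J \<gamma> t = \<tau> t" if "t \<in> J" for t
    using wlift_eqs(3)[OF J w that] bend[OF that] by (simp add: \<tau>_def D_def E_def)
  have dk: "diffn n J k" "diffn n J k'" for n
    unfolding k_def k'_def
    by (intro diffn_linear[OF bounded_linear_divide] diffn_Re diffn_herm dG)+
  have dt: "diffn n J \<tau>" for n
    unfolding \<tau>_def power2_eq_square using dG dk by (auto intro!: diffn_add diffn_mult diffn_const diffn_Im diffn_herm)
  have kk: "deriv_on J k k'"
  proof -
    have "deriv_on J (\<lambda>t. Re (herm (D t) (D t))) (\<lambda>t. Re (herm (D t) (E t) + herm (E t) (D t)))"
      by (rule deriv_on_Re[OF deriv_on_herm[OF gd(2) gd(2)]])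
    from deriv_on_linear[OF bounded_linear_divide[of 2] this]
    show ?thesis by (rule deriv_on_cong)
        (simp_all add: k_def k'_def herm_swap[of "E _" "D _"] add_divide_distrib[symmetric])
  qed
  \<comment> \<open>The Gram matrix of the 2-jet apart from <\<Gamma>'', \<Gamma>''>.
    Differentiating <\<Gamma>, \<Gamma>'> = i yields <\<Gamma>, \<Gamma>''>; the real part of
    <\<Gamma>', \<Gamma>''> is k', and its imaginary part is read off from the twist.\<close>
  have h11: "herm (\<Gamma> t) (\<Gamma> t) = 0" and h12: "herm (\<Gamma> t) (D t) = \<i>" and h21: "herm (D t) (\<Gamma> t) = - \<i>"
    and h22: "herm (D t) (D t) = 2 * of_real (k t)"
    and h13: "herm (\<Gamma> t) (E t) = - 2 * of_real (k t)" and h31: "herm (E t) (\<Gamma> t) = - 2 * of_real (k t)"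
    and h23: "herm (D t) (E t) = of_real (k' t) - \<i> * of_real (\<tau> t - 3 * (k t)\<^sup>2)"
    and h32: "herm (E t) (D t) = of_real (k' t) + \<i> * of_real (\<tau> t - 3 * (k t)\<^sup>2)" if t: "t \<in> J" for t
  proof -
    show "herm (\<Gamma> t) (\<Gamma> t) = 0" using liftD[OF L t] by simp
    have i: "herm (\<Gamma> t) (D t) = \<i>" if "t \<in> J" for t using naturalD[OF J nat w that] by (simp add: D_def)
    show "herm (\<Gamma> t) (D t) = \<i>" using i t .
    show "herm (D t) (\<Gamma> t) = - \<i>" by (subst herm_swap) (simp add: i[OF t])
    show r: "herm (D t) (D t) = 2 * of_real (k t)"
      by (subst herm_self_real) (simp add: k_def)
    have "deriv_on J (\<lambda>t. \<i>) (\<lambda>t. herm (\<Gamma> t) (E t) + herm (D t) (D t))"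
      by (rule deriv_on_cong[OF deriv_on_herm[OF gd(1) gd(2)]]) (use i in auto)
    from deriv_on_unique[OF J this deriv_on_const t]
    show a: "herm (\<Gamma> t) (E t) = - 2 * of_real (k t)" by (simp add: r add_eq_0_iff)
    show "herm (E t) (\<Gamma> t) = - 2 * of_real (k t)" by (subst herm_swap) (simp add: a)
    show "herm (E t) (D t) = of_real (k' t) + \<i> * of_real (\<tau> t - 3 * (k t)\<^sup>2)"
      using herm_swap[of "E t" "D t"] by (simp add: complex_eq_iff k'_def \<tau>_def)
    then show "herm (D t) (E t) = of_real (k' t) - \<i> * of_real (\<tau> t - 3 * (k t)\<^sup>2)"
      by (subst herm_swap) simp
  qed
  define F3 where "F3 t = D t - (\<i> * of_real (k t)) *s \<Gamma> t" for t
  define x where "x t = \<i> * of_real (k' t) - of_real ((k t)\<^sup>2) + of_real (\<tau> t)" for t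
  define F2 where "F2 t = E t - x t *s \<Gamma> t - (2 * \<i> * of_real (k t)) *s F3 t" for t
  have g11: "herm (\<Gamma> t) (\<Gamma> t) = 0" and g12: "herm (\<Gamma> t) (F2 t) = 0" and g13: "herm (\<Gamma> t) (F3 t) = \<i>"
    and g23: "herm (F2 t) (F3 t) = 0" and g33: "herm (F3 t) (F3 t) = 0" if t: "t \<in> J" for t
    using h11[OF t] h12[OF t] h21[OF t] h22[OF t] h13[OF t] h31[OF t] h23[OF t] h32[OF t]
    by (simp_all add: F2_def F3_def x_def herm_simps algebra_simps power2_eq_square)
  have g21: "herm (F2 t) (\<Gamma> t) = 0" and g31: "herm (F3 t) (\<Gamma> t) = - \<i>"
    and g32: "herm (F3 t) (F2 t) = 0" if t: "t \<in> J" for t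
    using g12[OF t] g13[OF t] g23[OF t] herm_swap[of "F2 t" "\<Gamma> t"] herm_swap[of "F3 t" "\<Gamma> t"]
      herm_swap[of "F3 t" "F2 t"] by simp_all
  define B where "B t = of_columns (\<Gamma> t) (F2 t) (F3 t)" for t
  have detB: "det (B t) = 1" if t: "t \<in> J" for t
  proof -
    \<comment> \<open>Modulo the other columns F3 is \<Gamma>' and F2 is \<Gamma>''; the sign comes
      from exchanging these two.\<close>
    have "det (B t) = - det3 (\<Gamma> t) (D t) (E t)"
      unfolding B_def det3_of_columns F2_def F3_def by (simp add: det_3 algebra_simps)
    then show ?thesis using W[OF t] by (simp add: wronskian_def D_def E_def)
  qed
  have gram: "adj (B t) ** hmat ** B t = hmat" if t: "t \<in> J" for t
  proof -
    let ?X = "adj (B t) ** hmat ** B t"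
    have e: "?X $ 1 $ 1 = 0" "?X $ 1 $ 2 = 0" "?X $ 1 $ 3 = \<i>" "?X $ 2 $ 1 = 0" "?X $ 2 $ 3 = 0"
      "?X $ 3 $ 1 = - \<i>" "?X $ 3 $ 2 = 0" "?X $ 3 $ 3 = 0"
      unfolding gram_nth B_def column_of_columns using g11 g12 g13 g21 g23 g31 g32 g33 t by auto
    \<comment> \<open>The remaining entry <F2, F2>: with all others equal to those of
      \<open>hmat\<close>, the determinant of the Gram matrix forces it to be 1.\<close>
    have "det ?X = -1" by (simp add: det_mul det_adj detB[OF t] det_hmat)
    then have "?X $ 2 $ 2 = 1" unfolding det_3 e by (simp add: i_mult_i)
    then show ?thesis using e by (simp add: vec_eq_iff forall_3)
  qed
  have BG: "B t \<in> G" if "t \<in> J" for t using gram detB that by (simp add: G_iff)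
  have d3: "deriv_on J F3 (\<lambda>t. of_real (\<tau> t) *s \<Gamma> t + F2 t + (\<i> * of_real (k t)) *s F3 t)"
  proof -
    have "deriv_on J (\<lambda>t. - \<i> * of_real (k t)) (\<lambda>t. - \<i> * of_real (k' t) + 0 * of_real (k t))"
      by (rule deriv_on_mult[OF deriv_on_const deriv_on_of_real[OF kk]])
    from deriv_on_add[OF gd(2) deriv_on_smult[OF this gd(1)]] show ?thesis
      by (rule deriv_on_cong) (simp_all add: F3_def F2_def x_def vec_eq_iff algebra_simps power2_eq_square)
  qed
  have d1: "deriv_on J \<Gamma> (\<lambda>t. (\<i> * of_real (k t)) *s \<Gamma> t + F3 t)"
    by (rule deriv_on_cong[OF gd(1)]) (simp_all add: F3_def)
  have dF3: "diffn n J F3" for n unfolding F3_def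
    using dG dk by (auto intro!: diffn_diff diffn_smult diffn_mult diffn_const diffn_of_real)
  have "diffn (Suc 0) J F2" unfolding F2_def x_def power2_eq_square
    by (intro diffn_diff diffn_smult diffn_mult diffn_const diffn_of_real diffn_add dG dk dt dF3)
  then obtain F2' where d2: "deriv_on J F2 F2'" by auto
  \<comment> \<open>This is B^-1 B', with F2' left unevaluated in the second column.\<close>
  define K where "K t = (hmat ** adj (B t) ** hmat) **
     of_columns ((\<i> * of_real (k t)) *s \<Gamma> t + F3 t) (F2' t) (of_real (\<tau> t) *s \<Gamma> t + F2 t + (\<i> * of_real (k t)) *s F3 t)" for t
  have BK: "deriv_on J B (\<lambda>t. B t ** K t)"
    by (rule deriv_on_cong[OF deriv_on_of_columns[OF d1 d2 d3]])
      (simp_all add: B_def[symmetric] K_def matrix_mul_assoc adj_h_inverse(2)[OF gram, unfolded matrix_mul_assoc])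
  have KK: "K t = Kmat (k t) (\<tau> t)" if t: "t \<in> J" for t
  proof -
    let ?I = "hmat ** adj (B t) ** hmat"
    note inv = adj_h_inverse[OF gram[OF t]]
    have c: "?I *v (a *s \<Gamma> t + b *s F2 t + c *s F3 t) = vector [a, b, c]" for a b c
    proof -
      have "a *s \<Gamma> t + b *s F2 t + c *s F3 t = B t *v vector [a, b, c]"
        by (simp add: vec_eq_iff B_def matrix_vector_mult_def sum_3 mult.commute)
      then show ?thesis by (simp only: matrix_vector_mul_assoc inv matrix_vector_mul_lid)
    qed
    define y where "y = ?I *v F2' t"
    have "K t = of_columns (vector [\<i> * of_real (k t), 0, 1]) y (vector [of_real (\<tau> t), 1, \<i> * of_real (k t)])"
      using c[of "\<i> * of_real (k t)" 0 1] c[of "of_real (\<tau> t)" 1 "\<i> * of_real (k t)"]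
      by (simp add: K_def of_columns_mult[symmetric] y_def)
    then have Ke: "K t $ 1 $ 1 = \<i> * of_real (k t)" "K t $ 2 $ 1 = 0" "K t $ 3 $ 1 = 1"
      "K t $ 1 $ 3 = of_real (\<tau> t)" "K t $ 2 $ 3 = 1" "K t $ 3 $ 3 = \<i> * of_real (k t)"
      by simp_all
    \<comment> \<open>Differentiating the constant Gram matrix puts K into the Lie algebra. The
      entries (1,2) and (3,2) of that relation determine two entries of the unknown second column,
      and the vanishing trace determines the third.\<close>
    have "deriv_on J (\<lambda>t. hmat) (\<lambda>t. (adj (B t)) ** (hmat ** (B t ** K t) + 0 ** B t) + adj (B t ** K t) ** (hmat ** B t))"
      by (rule deriv_on_cong[OF deriv_on_matrix_mult[OF deriv_on_adj[OF BK]
          deriv_on_matrix_mult[OF deriv_on_const[where c=hmat] BK]]]) (simp_all add: gram matrix_mul_assoc)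
    from deriv_on_unique[OF J this deriv_on_const t]
    have "(adj (B t) ** hmat ** B t) ** K t + adj (K t) ** (adj (B t) ** hmat ** B t) = 0"
      by (simp add: adj_mult matrix_mul_assoc)
    then have Z: "(hmat ** K t + adj (K t) ** hmat) $ i $ j = 0" for i j by (simp add: gram[OF t])
    have K3: "K t $ 3 $ 2 = 0" using Z[of 1 2] by (simp add: matrix_matrix_mult_def sum_3 Ke)
    have "\<i> * K t $ 1 $ 2 = 1" using Z[of 3 2] by (simp add: matrix_matrix_mult_def sum_3 Ke algebra_simps)
    then have "\<i> * (\<i> * K t $ 1 $ 2) = \<i>" by simp
    then have K1: "K t $ 1 $ 2 = - \<i>" by (simp add: mult.assoc[symmetric] equation_minus_iff)
    have "deriv_on J (\<lambda>t. 1) (\<lambda>t. trace (K t) * det (B t))"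
      by (rule deriv_on_cong[OF deriv_on_det[OF BK]]) (simp_all add: detB)
    from deriv_on_unique[OF J this deriv_on_const t] have "trace (K t) = 0" by (simp add: detB[OF t])
    then have K2: "K t $ 2 $ 2 = - 2 * \<i> * of_real (k t)"
      by (simp add: trace_def sum_3 Ke algebra_simps eq_neg_iff_add_eq_0)
    show ?thesis by (simp add: vec_eq_iff forall_3 Ke K1 K2 K3)
  qed
  show ?thesis
  proof (rule that[of B])
    show "deriv_on J B (\<lambda>t. B t ** Kmat (bending J \<gamma> t) (twist J \<gamma> t))"
      by (rule deriv_on_cong[OF BK]) (simp_all add: KK bend twi)
  qed (use BG in \<open>auto simp: B_def\<close>)
qed

section \<open>Congruence and existence for natural curves\<close>

lemma natural_congruence:
  assumes J: "intvl J" and n: "natural J \<gamma>" "natural J \<gamma>'"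
    and eq: "\<And>t. t \<in> J \<Longrightarrow> bending J \<gamma>' t = bending J \<gamma> t" "\<And>t. t \<in> J \<Longrightarrow> twist J \<gamma>' t = twist J \<gamma> t"
  obtains A where "A \<in> G" "\<And>t. t \<in> J \<Longrightarrow> \<gamma>' t = act A (\<gamma> t)"
proof -
  obtain \<Gamma> \<Gamma>' where w: "wilczynski_lift J \<gamma> \<Gamma>" "wilczynski_lift J \<gamma>' \<Gamma>'"
    using n wlift[OF J] by (auto simp: natural_def)
  obtain B where B: "deriv_on J B (\<lambda>t. B t ** Kmat (bending J \<gamma> t) (twist J \<gamma> t))"
    "\<And>t. t \<in> J \<Longrightarrow> B t \<in> G" "\<And>t. t \<in> J \<Longrightarrow> column 1 (B t) = \<Gamma> t"
    by (rule natural_frame[OF J n(1) w(1)], rule that)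
  obtain C where C0: "deriv_on J C (\<lambda>t. C t ** Kmat (bending J \<gamma>' t) (twist J \<gamma>' t))"
    "\<And>t. t \<in> J \<Longrightarrow> C t \<in> G" "\<And>t. t \<in> J \<Longrightarrow> column 1 (C t) = \<Gamma>' t"
    by (rule natural_frame[OF J n(2) w(2)], rule that)
  have C: "deriv_on J C (\<lambda>t. C t ** Kmat (bending J \<gamma> t) (twist J \<gamma> t))"
    by (rule deriv_on_cong[OF C0(1)]) (simp_all add: eq)
  obtain t0 where t0: "t0 \<in> J" using J by (auto simp: intvl_def)
  \<comment> \<open>\<open>hmat ** adj (B t0) ** hmat\<close> is the inverse of \<open>B t0\<close>,
    so A is C B^-1 at t0.\<close>
  define A where "A = C t0 ** hmat ** adj (B t0) ** hmat"
  have AB: "A ** B t = C t" if t: "t \<in> J" for t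
  proof -
    have "A = C t ** (hmat ** adj (B t) ** hmat)"
      unfolding A_def frame_const[OF J B(1) C Kmat_lie t0 t] by (simp add: matrix_mul_assoc)
    then show ?thesis
      using adj_h_inverse(1)[of "B t"] B(2)[OF t] by (simp add: G_iff matrix_mul_assoc[symmetric])
  qed
  have "A \<in> G"
  proof -
    obtain B' where B': "B' \<in> G" "B t0 ** B' = mat 1" using G_inverse[OF B(2)[OF t0]] by metis
    have "A = (A ** B t0) ** B'" using B'(2) by (simp add: matrix_mul_assoc[symmetric])
    then show ?thesis using AB[OF t0] C0(2)[OF t0] B'(1) G_mult by simp
  qed
  moreover have "\<gamma>' t = act A (\<gamma> t)" if t: "t \<in> J" for t
  proof -
    have "A *v \<Gamma> t = column 1 (A ** B t)"
      unfolding B(3)[OF t, symmetric]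
      by (simp add: vec_eq_iff column_def matrix_vector_mult_def matrix_matrix_mult_def)
    then have "\<Gamma>' t = A *v \<Gamma> t" using AB[OF t] C0(3)[OF t] by simp
    then show ?thesis using w liftD(3) t unfolding wilczynski_lift_def by (metis act_pt)
  qed
  ultimately show ?thesis using that by blast
qed

lemma natural_existence:
  fixes k \<tau> :: "real \<Rightarrow> real"
  assumes J: "intvl J" and k: "smooth_fun J k" and \<tau>: "smooth_fun J \<tau>"
  obtains \<gamma> where "natural J \<gamma>" "\<And>t. t \<in> J \<Longrightarrow> bending J \<gamma> t = k t" "\<And>t. t \<in> J \<Longrightarrow> twist J \<gamma> t = \<tau> t"
proof -
  obtain t0 where t0: "t0 \<in> J" using J by (auto simp: intvl_def)
  have Ks: "smooth_fun J (\<lambda>t. Kmat (k t) (\<tau> t))"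
  proof -
    \<comment> \<open>\<open>Kmat\<close> is real affine in its arguments, so the smoothness of k
      and \<tau> carries over.\<close>
    have split: "Kmat a b = Kmat 0 0 + a *\<^sub>R (Kmat 1 0 - Kmat 0 0) + b *\<^sub>R (Kmat 0 1 - Kmat 0 0)" for a b
      by (simp add: vec_eq_iff forall_3 scaleR_conv_of_real[where 'a=complex])
    have "diffn n J (\<lambda>t. Kmat (k t) (\<tau> t))" for n
      unfolding split[of "k _" "\<tau> _"] using k \<tau>
      by (intro diffn_add diffn_const diffn_bilinear[OF bounded_bilinear_scaleR]) (simp_all add: smooth_fun_iff[OF J])
    then show ?thesis by (simp add: smooth_fun_iff[OF J])
  qed
  obtain B where B: "deriv_on J B (\<lambda>t. B t ** Kmat (k t) (\<tau> t))" "B t0 = mat 1"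
    by (rule linear_ode[OF J t0 bounded_bilinear_matrix_mult smooth_fun_continuous[OF J Ks]])
  have Bs: "smooth_fun J B" by (rule linear_ode_smooth[OF J bounded_bilinear_matrix_mult Ks B(1)])
  \<comment> \<open>With B in both roles, \<open>frame_const\<close> shows that
    \<open>B t ** hmat ** adj (B t)\<close> keeps its initial value \<open>hmat\<close>; membership
    in G needs the flipped relation.\<close>
  have gram: "adj (B t) ** hmat ** B t = hmat" if t: "t \<in> J" for t
  proof (rule adj_h_flip)
    have "adj (mat 1 :: complex^3^3) = mat 1" by (simp add: vec_eq_iff mat_def)
    then show "B t ** hmat ** adj (B t) = hmat"
      using frame_const[OF J B(1) B(1) Kmat_lie t t0] B(2) by simp
  qed
  have detB: "det (B t) = 1" if t: "t \<in> J" for t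
  proof -
    have "deriv_on J (\<lambda>t. det (B t)) (\<lambda>t. 0)"
      by (rule deriv_on_cong[OF deriv_on_det[OF B(1)]]) (simp_all add: trace_Kmat)
    from deriv_on_zero_const[OF J this t t0] show ?thesis by (simp add: B(2))
  qed
  define F where "F j t = column j (B t)" for j t
  have dcol: "deriv_on J (\<lambda>t. column j (B t)) (\<lambda>t. column j (B t ** Kmat (k t) (\<tau> t)))" for j
    by (rule deriv_on_linear[OF bounded_linear_column B(1)])
  have d1: "deriv_on J (F 1) (\<lambda>t. (\<i> * of_real (k t)) *s F 1 t + F 3 t)"
    by (rule deriv_on_cong[OF dcol[of 1]]) (simp_all add: F_def column_mult)
  have d3: "deriv_on J (F 3) (\<lambda>t. of_real (\<tau> t) *s F 1 t + F 2 t + (\<i> * of_real (k t)) *s F 3 t)"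
    by (rule deriv_on_cong[OF dcol[of 3]]) (simp_all add: F_def column_mult)
  define k' where "k' = vderiv J k"
  have kk: "deriv_on J k k'" unfolding k'_def by (rule smooth_fun_obtain(1)[OF J k])
  define x where "x t = \<i> * of_real (k' t) - of_real ((k t)\<^sup>2) + of_real (\<tau> t)" for t
  \<comment> \<open>The definition of F2 in \<open>natural_frame\<close> is read backwards, which
    expresses \<Gamma>'' by the frame. As the Gram matrix of the frame is \<open>hmat\<close>,
    bending and twist can then be read off from coefficients.\<close>
  have d11: "deriv_on J (\<lambda>t. (\<i> * of_real (k t)) *s F 1 t + F 3 t)
     (\<lambda>t. x t *s F 1 t + F 2 t + (2 * \<i> * of_real (k t)) *s F 3 t)"
  proof -
    have "deriv_on J (\<lambda>t. \<i> * of_real (k t)) (\<lambda>t. \<i> * of_real (k' t) + 0 * of_real (k t))"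
      by (rule deriv_on_mult[OF deriv_on_const deriv_on_of_real[OF kk]])
    from deriv_on_add[OF deriv_on_smult[OF this d1] d3] show ?thesis
      by (rule deriv_on_cong) (simp_all add: x_def vec_eq_iff algebra_simps power2_eq_square)
  qed
  define \<Gamma> where "\<Gamma> = F 1"
  have v1: "vderiv J \<Gamma> t = (\<i> * of_real (k t)) *s F 1 t + F 3 t" if "t \<in> J" for t
    unfolding \<Gamma>_def by (rule vderiv_eq[OF J d1 that])
  have v2: "vderiv J (vderiv J \<Gamma>) t = x t *s F 1 t + F 2 t + (2 * \<i> * of_real (k t)) *s F 3 t" if "t \<in> J" for t
    by (rule vderiv_eq[OF J deriv_on_cong[OF d11] that]) (simp_all add: v1)
  have h: "herm (F i t) (F j t) = hmat $ i $ j" if "t \<in> J" for i j t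
    unfolding F_def by (rule gram_G[OF gram[OF that]])
  define \<gamma> where "\<gamma> t = pt (\<Gamma> t)" for t
  have "smooth_fun J \<Gamma>" unfolding smooth_fun_iff[OF J] \<Gamma>_def F_def
    using Bs by (auto simp: smooth_fun_iff[OF J] intro: diffn_linear[OF bounded_linear_column])
  \<comment> \<open>That \<Gamma> does not vanish follows from <F 1, F 3> = i.\<close>
  moreover have "\<Gamma> t \<in> null_vectors" if t: "t \<in> J" for t
    using h[OF t, of 1 1] h[OF t, of 1 3] unfolding null_vectors_def \<Gamma>_def by auto
  ultimately have L: "lift J \<gamma> \<Gamma>" unfolding lift_def \<gamma>_def by blast
  have "wronskian J \<Gamma> t = -1" if t: "t \<in> J" for t
  proof -
    have "wronskian J \<Gamma> t = - det (of_columns (F 1 t) (F 2 t) (F 3 t))"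
      unfolding wronskian_def v1[OF t] v2[OF t] det3_of_columns by (simp add: \<Gamma>_def det_3 algebra_simps)
    then show ?thesis by (simp add: F_def of_columns_columns detB[OF t])
  qed
  with L have w: "wilczynski_lift J \<gamma> \<Gamma>" by (simp add: wilczynski_lift_def)
  have nat: "natural J \<gamma>"
  proof (rule naturalI[OF J w])
    show "herm (\<Gamma> t) (vderiv J \<Gamma> t) = \<i>" if t: "t \<in> J" for t
      unfolding v1[OF t] by (simp add: \<Gamma>_def herm_simps h[OF t])
  qed
  have b: "bending J \<gamma> t = k t" if t: "t \<in> J" for t
    unfolding wlift_eqs(2)[OF J w t] v1[OF t] by (simp add: herm_simps h[OF t])
  have "twist J \<gamma> t = \<tau> t" if t: "t \<in> J" for t
    unfolding wlift_eqs(3)[OF J w t] v1[OF t] v2[OF t] b[OF t]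
    by (simp add: herm_simps h[OF t] x_def power2_eq_square)
  then show ?thesis using that nat b by blast
qed

section \<open>Reparametrization\<close>

text \<open>In Caratheodory's form the two derivatives give q(\<phi> z) (\<phi> z - \<phi> s) = r z
  (z - s), which can be solved for \<phi> z near s, where q(\<phi> z) is nonzero by continuity. This
  serves both the inverse of the strain integral and changes of natural parameter that are only
  known to be continuous.\<close>

lemma has_real_derivative_factor:
  fixes g \<phi> :: "real \<Rightarrow> real"
  assumes g: "(g has_real_derivative c) (at (\<phi> s) within V)" "c \<noteq> 0"
    and gp: "((\<lambda>s. g (\<phi> s)) has_real_derivative d) (at s within U)"
    and ph: "continuous (at s within U) \<phi>" "\<phi> ` U \<subseteq> V" "s \<in> U"
  shows "(\<phi> has_real_derivative d / c) (at s within U)"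
proof -
  obtain q where q: "\<And>z. g z - g (\<phi> s) = q z * (z - \<phi> s)" "continuous (at (\<phi> s) within V) q" "q (\<phi> s) = c"
    using g(1) unfolding DERIV_caratheodory_within by blast
  obtain r where r: "\<And>z. g (\<phi> z) - g (\<phi> s) = r z * (z - s)" "continuous (at s within U) r" "r s = d"
    using gp unfolding DERIV_caratheodory_within by blast
  have cq: "continuous (at s within U) (\<lambda>z. q (\<phi> z))"
    by (rule continuous_within_compose2[OF ph(1)]) (use q(2) ph(2) continuous_within_subset in blast)
  obtain e where e: "e > 0" "\<And>z. z \<in> U \<Longrightarrow> dist s z < e \<Longrightarrow> q (\<phi> z) \<noteq> 0"
    using continuous_within_avoid[OF cq, of 0] g(2) q(3) by auto
  define h where "h z = \<phi> s + (r z / q (\<phi> z)) * (z - s)" for z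
  have "continuous (at s within U) (\<lambda>z. r z / q (\<phi> z))"
    using r(2) cq g(2) q(3) unfolding continuous_within by (intro tendsto_divide) auto
  then have "(h has_real_derivative r s / q (\<phi> s)) (at s within U)"
    unfolding DERIV_caratheodory_within by (intro exI[of _ "\<lambda>z. r z / q (\<phi> z)"]) (simp add: h_def)
  then have "(h has_real_derivative d / c) (at s within U)" by (simp add: r(3) q(3))
  then show ?thesis
  proof (rule has_field_derivative_transform_within[OF _ e(1) ph(3)])
    fix z assume z: "z \<in> U" "dist z s < e"
    then have "q (\<phi> z) \<noteq> 0" using e(2) by (simp add: dist_commute)
    moreover have "q (\<phi> z) * (\<phi> z - \<phi> s) = r z * (z - s)" using q(1)[of "\<phi> z"] r(1)[of z] by simp
    ultimately show "h z = \<phi> z" by (simp add: h_def field_simps)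
  qed
qed

text \<open>The function \<open>u \<mapsto> \<langle>\<Gamma>\<^sub>2(u\<^sub>0), \<Gamma>\<^sub>2(u)\<rangle> / \<langle>\<Gamma>\<^sub>2'(u\<^sub>0), \<Gamma>\<^sub>2(u)\<rangle>\<close> does not depend on the lift and has
  nonzero derivative at \<open>u\<^sub>0\<close>; it serves as a local coordinate on the curve.\<close>

lemma transition_derivative:
  assumes U: "intvl U" and J2: "intvl J2"
    and g1: "deriv_on U \<Gamma>1 D1" and g2: "deriv_on J2 \<Gamma>2 D2"
    and null: "\<And>t. t \<in> J2 \<Longrightarrow> herm (\<Gamma>2 t) (\<Gamma>2 t) = 0"
    and h1: "\<And>t. t \<in> U \<Longrightarrow> herm (\<Gamma>1 t) (D1 t) = \<i>" and h2: "\<And>t. t \<in> J2 \<Longrightarrow> herm (\<Gamma>2 t) (D2 t) = \<i>"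
    and ph: "continuous_on U \<phi>" "\<phi> ` U \<subseteq> J2"
    and l: "\<And>t. t \<in> U \<Longrightarrow> \<Gamma>1 t = l t *s \<Gamma>2 (\<phi> t)" "\<And>t. t \<in> U \<Longrightarrow> l t \<noteq> 0"
  shows "deriv_on U \<phi> (\<lambda>s. inverse ((cmod (l s))\<^sup>2))"
  unfolding deriv_on_def
proof
  fix s assume s: "s \<in> U"
  define w where "w = \<Gamma>2 (\<phi> s)"
  define v where "v = D2 (\<phi> s)"
  have ps: "\<phi> s \<in> J2" using ph s by blast
  have vw: "herm v w = - \<i>" "herm w v = \<i>" "herm w w = 0"
    using herm_swap[of v w] h2[OF ps] null[OF ps] by (simp_all add: v_def w_def)
  have der: "((\<lambda>u. herm w (\<Gamma> u) * inverse (herm v (\<Gamma> u))) has_vector_derivative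
      herm w (\<Gamma> t) * - (herm v d * (inverse (herm v (\<Gamma> t)) * inverse (herm v (\<Gamma> t)))) + herm w d * inverse (herm v (\<Gamma> t))) (at t within T)"
    if d: "(\<Gamma> has_vector_derivative d) (at t within T)" and nz: "herm v (\<Gamma> t) \<noteq> 0" for \<Gamma> d t T
  proof (rule has_vector_derivative_mult)
    note hr = bounded_linear.has_vector_derivative[OF bounded_bilinear.bounded_linear_right[OF bounded_bilinear_herm] d]
    show "((\<lambda>u. herm w (\<Gamma> u)) has_vector_derivative herm w d) (at t within T)" by (rule hr)
    have "((\<lambda>u. herm v (\<Gamma> u)) has_derivative (\<lambda>h. h *\<^sub>R herm v d)) (at t within T)"
      using hr[of v] by (simp add: has_vector_derivative_def)
    from Deriv.has_derivative_inverse[OF nz this]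
    show "((\<lambda>u. inverse (herm v (\<Gamma> u))) has_vector_derivative
        - (herm v d * (inverse (herm v (\<Gamma> t)) * inverse (herm v (\<Gamma> t))))) (at t within T)"
      by (simp add: has_vector_derivative_def mult_ac)
  qed
  define g where "g u = Re (herm w (\<Gamma>2 u) * inverse (herm v (\<Gamma>2 u)))" for u
  have "herm v (\<Gamma>2 (\<phi> s)) \<noteq> 0" using vw by (simp flip: w_def)
  from der[OF deriv_onD[OF g2 ps] this]
  have "((\<lambda>u. herm w (\<Gamma>2 u) * inverse (herm v (\<Gamma>2 u))) has_vector_derivative -1) (at (\<phi> s) within J2)"
    by (simp add: vw flip: w_def v_def)
  from bounded_linear.has_vector_derivative[OF bounded_linear_Re this]
  have gd: "(g has_real_derivative -1) (at (\<phi> s) within J2)"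
    unfolding g_def has_real_derivative_iff_has_vector_derivative by simp
  have gl: "herm w (\<Gamma>2 (\<phi> t)) * inverse (herm v (\<Gamma>2 (\<phi> t))) = herm w (\<Gamma>1 t) * inverse (herm v (\<Gamma>1 t))"
    if "t \<in> U" for t using l[OF that] by (simp add: herm_simps)
  have v1: "herm v (\<Gamma>1 s) = - (\<i> * l s)" "herm w (\<Gamma>1 s) = 0"
    using l(1)[OF s] by (simp_all add: herm_simps vw flip: w_def)
  have ls: "l s \<noteq> 0" using l(2) s .
  have "cnj (l s) * herm w (D1 s) = \<i>"
    using h1[OF s] l(1)[OF s] by (simp add: herm_simps flip: w_def)
  then have wD: "herm w (D1 s) = \<i> / cnj (l s)" using ls by (simp add: field_simps)
  have "herm v (\<Gamma>1 s) \<noteq> 0" using v1 ls by simp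
  from der[OF deriv_onD[OF g1 s] this]
  have "((\<lambda>u. herm w (\<Gamma>1 u) * inverse (herm v (\<Gamma>1 u))) has_vector_derivative
     \<i> / cnj (l s) * inverse (- (\<i> * l s))) (at s within U)"
    by (simp add: v1 wD)
  moreover have "\<i> / cnj (l s) * inverse (- (\<i> * l s)) = of_real (- inverse ((cmod (l s))\<^sup>2))"
    using ls complex_norm_square[of "l s"] by (simp add: field_simps del: of_real_power)
  ultimately have "((\<lambda>u. herm w (\<Gamma>1 u) * inverse (herm v (\<Gamma>1 u))) has_vector_derivative
     of_real (- inverse ((cmod (l s))\<^sup>2))) (at s within U)" by simp
  from bounded_linear.has_vector_derivative[OF bounded_linear_Re this]
  have "((\<lambda>u. Re (herm w (\<Gamma>1 u) * inverse (herm v (\<Gamma>1 u)))) has_vector_derivative - inverse ((cmod (l s))\<^sup>2)) (at s within U)"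
    by (simp only: Re_complex_of_real)
  then have "((\<lambda>t. g (\<phi> t)) has_real_derivative - inverse ((cmod (l s))\<^sup>2)) (at s within U)"
    unfolding has_real_derivative_iff_has_vector_derivative
    by (rule has_vector_derivative_transform[rotated 2]) (use s gl in \<open>simp_all add: g_def\<close>)
  \<comment> \<open>The coordinate has derivative -1 along \<Gamma>2 and -1 / |l|^2 along \<Gamma>1;
    their quotient is the derivative of \<phi>.\<close>
  from has_real_derivative_factor[OF gd _ this _ ph(2) s] ph(1) s
  show "(\<phi> has_vector_derivative inverse ((cmod (l s))\<^sup>2)) (at s within U)"
    by (simp add: continuous_on_eq_continuous_within has_real_derivative_iff_has_vector_derivative)
qed

text \<open>Starting from continuity of \<phi>, \<open>transition_derivative\<close> gives \<phi>' =
  1 / |l|^2. Regularity then passes from \<phi> to l and through this formula back to \<phi>, until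
  both are twice differentiable. Now the Wronskian law reads (l \<phi>')^3 = 1, while |l| \<phi>' =
  1 / |l|; hence |l| = 1, \<phi>' = 1 and l^3 = 1. All correction terms vanish, and the 2-jets agree
  up to the unit factor l.\<close>

lemma transition:
  assumes U: "intvl U" "U \<subseteq> J1" and J: "intvl J1" "intvl J2" and n: "natural J1 \<gamma>1" "natural J2 \<gamma>2"
    and ph: "continuous_on U \<phi>" "\<phi> ` U \<subseteq> J2" "\<And>s. s \<in> U \<Longrightarrow> \<gamma>1 s = \<gamma>2 (\<phi> s)"
    and t: "t \<in> U"
  shows "bending J1 \<gamma>1 t = bending J2 \<gamma>2 (\<phi> t)" "twist J1 \<gamma>1 t = twist J2 \<gamma>2 (\<phi> t)"
proof -
  obtain \<Gamma>1 \<Gamma>2 where w: "wilczynski_lift J1 \<gamma>1 \<Gamma>1" "wilczynski_lift J2 \<gamma>2 \<Gamma>2"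
    using n wlift J by (auto simp: natural_def)
  then have L: "lift J1 \<gamma>1 \<Gamma>1" "lift J2 \<gamma>2 \<Gamma>2" by (auto simp: wilczynski_lift_def)
  define D1 where "D1 = vderiv J1 \<Gamma>1"
  define E1 where "E1 = vderiv J1 D1"
  define D2 where "D2 = vderiv J2 \<Gamma>2"
  define E2 where "E2 = vderiv J2 D2"
  note d1 = lift_derivs(1,2)[OF J(1) L(1), folded D1_def, folded E1_def]
  note d2 = lift_derivs(1,2)[OF J(2) L(2), folded D2_def, folded E2_def]
  note d1U = deriv_on_subset[OF d1(1) U(2)] deriv_on_subset[OF d1(2) U(2)]
  have "\<exists>c. c \<noteq> 0 \<and> \<Gamma>1 s = c *s \<Gamma>2 (\<phi> s)" if "s \<in> U" for s
  proof -
    have "s \<in> J1" "\<phi> s \<in> J2" using that U ph by blast+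
    then show ?thesis using liftD[OF L(1)] liftD[OF L(2)] ph(3)[OF that] pt_eq_iff by metis
  qed
  then obtain l where l: "\<And>s. s \<in> U \<Longrightarrow> \<Gamma>1 s = l s *s \<Gamma>2 (\<phi> s)" "\<And>s. s \<in> U \<Longrightarrow> l s \<noteq> 0" by metis
  define \<phi>1 where "\<phi>1 s = inverse ((cmod (l s))\<^sup>2)" for s
  have dph: "deriv_on U \<phi> \<phi>1" unfolding \<phi>1_def
    by (rule transition_derivative[OF U(1) J(2) d1U(1) d2(1) _ _ _ ph(1,2) l])
      (use naturalD[OF J(1) n(1) w(1)] naturalD[OF J(2) n(2) w(2)] liftD[OF L(2)] U in \<open>auto simp: D1_def D2_def\<close>)
  have sm: "diffn m U \<Gamma>1" "diffn m J2 \<Gamma>2" for m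
  proof -
    have "diffn m J1 \<Gamma>1" using L(1) by (simp add: lift_def smooth_fun_iff[OF J(1)])
    then show "diffn m U \<Gamma>1" using U(2) diffn_subset by blast
    show "diffn m J2 \<Gamma>2" using L(2) by (simp add: lift_def smooth_fun_iff[OF J(2)])
  qed
  have dl: "diffn m U l" if "diffn m U \<phi>" for m
    by (rule scalar_diffn[OF sm(1) diffn_compose[OF that sm(2) ph(2)] l(1)]) (use liftD(1)[OF L(2)] ph in auto)
  have "diffn (Suc 0) U \<phi>" using dph by auto
  from dl[OF this] have l1: "diffn (Suc 0) U l" .
  \<comment> \<open>The squared modulus is written through real and imaginary parts, to which the
    closure rules apply.\<close>
  have \<phi>1: "\<phi>1 = (\<lambda>s. inverse (Re (l s) * Re (l s) + Im (l s) * Im (l s)))"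
    unfolding \<phi>1_def cmod_power2 by (simp add: power2_eq_square)
  have "diffn (Suc 0) U \<phi>1" unfolding \<phi>1
    by (intro diffn_inverse diffn_add diffn_mult diffn_Re diffn_Im l1)
      (use l(2) in \<open>auto simp: complex_eq_iff add_nonneg_eq_0_iff\<close>)
  then obtain \<phi>2 where dph1: "deriv_on U \<phi>1 \<phi>2" by auto
  have "diffn (Suc (Suc 0)) U \<phi>" using dph dph1 by auto
  from dl[OF this] obtain l' l'' where l': "deriv_on U l l'" "deriv_on U l' l''" by auto
  note ch = lift_change[OF U(1) d1U d2 ph(2) dph dph1 l' l(1)]
  have W: "det3 (\<Gamma>1 s) (D1 s) (E1 s) = -1" "det3 (\<Gamma>2 (\<phi> s)) (D2 (\<phi> s)) (E2 (\<phi> s)) = -1" if "s \<in> U" for s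
  proof -
    have "s \<in> J1" "\<phi> s \<in> J2" using that U ph by blast+
    then show "det3 (\<Gamma>1 s) (D1 s) (E1 s) = -1" "det3 (\<Gamma>2 (\<phi> s)) (D2 (\<phi> s)) (E2 (\<phi> s)) = -1"
      using w unfolding wilczynski_lift_def wronskian_def D1_def D2_def E1_def E2_def by auto
  qed
  have lp: "l s ^ 3 * of_real (\<phi>1 s) ^ 3 = 1" if "s \<in> U" for s
    using ch(3)[OF _ that] W[OF that] by simp
  have cl: "cmod (l s) = 1" if s: "s \<in> U" for s
  proof -
    have ne: "cmod (l s) \<noteq> 0" using l(2)[OF s] by simp
    have "cmod (l s ^ 3 * of_real (\<phi>1 s) ^ 3) = 1" using lp[OF s] by simp
    then have "(cmod (l s) * \<phi>1 s) ^ 3 = 1 ^ 3"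
      by (simp add: norm_mult norm_power norm_inverse \<phi>1_def power_mult_distrib)
    then have "cmod (l s) * \<phi>1 s = 1" by (rule power_eq_imp_eq_base) (auto simp: \<phi>1_def)
    then show ?thesis using ne by (simp add: \<phi>1_def field_simps power2_eq_square)
  qed
  have p1: "\<phi>1 s = 1" if "s \<in> U" for s using cl[OF that] by (simp add: \<phi>1_def)
  have "deriv_on U \<phi>1 (\<lambda>s. 0)" by (rule deriv_on_cong[OF deriv_on_const]) (use p1 in auto)
  from deriv_on_unique[OF U(1) dph1 this t] have p2: "\<phi>2 t = 0" .
  have l3: "l s ^ 3 = 1" if "s \<in> U" for s using lp[OF that] p1[OF that] by simp
  have l0: "l' s = 0" if "s \<in> U" for s by (rule deriv_on_root_of_unity[OF U(1) l'(1) l3 that])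
  have "deriv_on U l' (\<lambda>t. 0)" by (rule deriv_on_cong[OF deriv_on_const]) (use l0 in auto)
  from deriv_on_unique[OF U(1) l'(2) this t] have l2: "l'' t = 0" .
  have D: "D1 t = l t *s D2 (\<phi> t)" "E1 t = l t *s E2 (\<phi> t)"
    using ch(1,2)[OF _ t] by (simp_all add: p1[OF t] p2 l0[OF t] l2)
  note h = herm_unit_smult[OF cl[OF t]]
  have tJ: "t \<in> J1" "\<phi> t \<in> J2" using t U ph by blast+
  note e1 = wlift_eqs(2,3)[OF J(1) w(1) tJ(1)] and e2 = wlift_eqs(2,3)[OF J(2) w(2) tJ(2)]
  show b: "bending J1 \<gamma>1 t = bending J2 \<gamma>2 (\<phi> t)"
    unfolding e1(1) e2(1) D1_def[symmetric] D2_def[symmetric] D h ..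
  show "twist J1 \<gamma>1 t = twist J2 \<gamma>2 (\<phi> t)"
    unfolding e1(2) e2(2) b D1_def[symmetric] D2_def[symmetric] E1_def[symmetric] E2_def[symmetric] D h ..
qed

text \<open>With <\<Gamma>, \<Gamma>'> = i b the strain density is 1/b, so \<sigma> is the strain
  integral, and its inverse \<theta> is the change to the natural parameter.\<close>

lemma natural_reparametrization:
  assumes J: "intvl J" and g: "generic_transversal J \<gamma>"
  obtains J' \<theta> \<sigma> where "intvl J'" "homeomorphism J J' \<sigma> \<theta>" "natural J' (\<gamma> \<circ> \<theta>)"
proof -
  obtain \<Gamma> where w: "wilczynski_lift J \<gamma> \<Gamma>" using wilczynski_exists[OF J g] by metis
  then have L: "lift J \<gamma> \<Gamma>" and W: "\<And>t. t \<in> J \<Longrightarrow> wronskian J \<Gamma> t = -1" by (auto simp: wilczynski_lift_def)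
  define b where "b t = Im (herm (\<Gamma> t) (vderiv J \<Gamma> t))" for t
  have b0: "b t > 0" if "t \<in> J" for t using g lift_generic_iff[OF J L] that by (simp add: b_def)
  have hb: "herm (\<Gamma> t) (vderiv J \<Gamma> t) = \<i> * of_real (b t)" if "t \<in> J" for t
    using lift_imaginary[OF J L that] by (simp add: complex_eq_iff b_def)
  have sG: "smooth_fun J \<Gamma>" using L by (simp add: lift_def)
  have bs: "diffn n J b" for n
    using sG smooth_fun_obtain(2)[OF J sG] unfolding b_def smooth_fun_iff[OF J]
    by (intro diffn_Im diffn_herm) blast+
  have as: "diffn n J (\<lambda>t. inverse (b t))" for n using bs b0 by (intro diffn_inverse) force+
  obtain t0 where t0: "t0 \<in> J" using J by (auto simp: intvl_def)
  obtain \<sigma> where \<sigma>: "deriv_on J \<sigma> (\<lambda>t. inverse (b t))"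
    using antiderivative[OF J diffn_continuous[OF as[of "Suc 0"]] t0] by metis
  have mono: "\<sigma> x < \<sigma> y" if xy: "x \<in> J" "y \<in> J" "x < y" for x y
  proof -
    have sub: "{x..y} \<subseteq> J" using J xy mem_is_interval_1_I[of J x y] by (auto simp: intvl_def)
    note d = deriv_on_subset[OF \<sigma> sub]
    have "\<exists>k. DERIV \<sigma> z :> k \<and> k > 0" if "x < z" "z < y" for z
      using deriv_onD[OF d, of z] that at_within_Icc_at[of x z y] b0[of z] sub
      by (auto simp: has_real_derivative_iff_has_vector_derivative subset_iff intro!: exI[of _ "inverse (b z)"])
    then show ?thesis using DERIV_pos_imp_increasing_open[OF xy(3)] deriv_on_continuous[OF d] by blast
  qed
  have inj: "inj_on \<sigma> J" by (rule inj_onI) (metis mono less_irrefl linorder_neqE)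
  have iv: "is_interval J" and c\<sigma>: "continuous_on J \<sigma>" using J \<sigma> deriv_on_continuous by (auto simp: intvl_def)
  obtain \<theta> where hom: "homeomorphism J (\<sigma> ` J) \<sigma> \<theta>"
    using injective_into_1d_eq_homeomorphism[OF c\<sigma>] inj iv is_interval_path_connected by blast
  define J' where "J' = \<sigma> ` J"
  have J': "intvl J'"
  proof -
    have "connected J" using iv is_interval_connected_1 by blast
    then have "is_interval J'" unfolding J'_def is_interval_connected_1
      by (rule connected_continuous_image[OF c\<sigma>])
    moreover obtain p q where "p \<in> J" "q \<in> J" "p < q" using J by (auto simp: intvl_def)
    ultimately show ?thesis using mono unfolding intvl_def J'_def by blast
  qed
  have th: "continuous_on J' \<theta>" "\<theta> ` J' = J" "\<And>s. s \<in> J' \<Longrightarrow> \<sigma> (\<theta> s) = s"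
    using hom by (auto simp: homeomorphism_def J'_def)
  have thJ: "\<theta> s \<in> J" if "s \<in> J'" for s using th(2) that by blast
  have d\<theta>: "deriv_on J' \<theta> (\<lambda>s. b (\<theta> s))" unfolding deriv_on_def
  proof
    fix s assume s: "s \<in> J'"
    have "(\<sigma> has_real_derivative inverse (b (\<theta> s))) (at (\<theta> s) within J)"
      using deriv_onD[OF \<sigma> thJ[OF s]] by (simp add: has_real_derivative_iff_has_vector_derivative)
    moreover have "((\<lambda>s. \<sigma> (\<theta> s)) has_real_derivative 1) (at s within J')"
      unfolding has_real_derivative_iff_has_vector_derivative
      by (rule has_vector_derivative_transform[OF s _ has_vector_derivative_id]) (simp add: th(3))
    ultimately have "(\<theta> has_real_derivative 1 / inverse (b (\<theta> s))) (at s within J')"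
      using has_real_derivative_factor[of \<sigma> _ \<theta> s J 1 J'] b0[OF thJ[OF s]] th s
      by (simp add: continuous_on_eq_continuous_within)
    then show "(\<theta> has_vector_derivative b (\<theta> s)) (at s within J')"
      by (simp add: has_real_derivative_iff_has_vector_derivative divide_inverse)
  qed
  have \<theta>s: "diffn n J' \<theta>" for n
  proof (induction n)
    case (Suc n)
    from diffn_SucI[OF d\<theta> diffn_compose[OF this bs]] th(2) show ?case by simp
  qed simp
  have comp: "diffn n J' (\<lambda>s. f (\<theta> s))" if "\<And>n. diffn n J f" for n and f :: "real \<Rightarrow> 'z::real_normed_vector"
    using diffn_compose[OF \<theta>s that] th(2) by blast
  \<comment> \<open>Since \<theta>' = b(\<theta>), this factor satisfies l \<theta>' = 1, which
    keeps the Wronskian at -1, and <\<Lambda>, \<Lambda>'> becomes l^2 \<theta>' i b = i.\<close>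
  define l where "l s = complex_of_real (inverse (b (\<theta> s)))" for s
  have ls: "diffn n J' l" for n unfolding l_def by (intro diffn_of_real comp as)
  define \<Lambda> where "\<Lambda> s = l s *s \<Gamma> (\<theta> s)" for s
  have "smooth_fun J' \<Lambda>" unfolding smooth_fun_iff[OF J'] \<Lambda>_def
    using sG by (intro allI diffn_smult ls comp) (simp add: smooth_fun_iff[OF J])
  moreover have "l s \<noteq> 0" if "s \<in> J'" for s using b0[OF thJ[OF that]] by (simp add: l_def)
  ultimately have L': "lift J' (\<gamma> \<circ> \<theta>) \<Lambda>"
    using liftD[OF L] thJ unfolding lift_def null_vectors_def
    by (auto simp: \<Lambda>_def herm_simps pt_smult vec_eq_iff)
  obtain b' where b': "deriv_on J' (\<lambda>s. b (\<theta> s)) b'" using comp[OF bs, of "Suc 0"] by auto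
  obtain l' l'' where l': "deriv_on J' l l'" "deriv_on J' l' l''" using ls[of "Suc (Suc 0)"] by auto
  have sub: "\<theta> ` J' \<subseteq> J" using th(2) by simp
  note ch = lift_change[OF J' lift_derivs(1,2)[OF J' L'] lift_derivs(1,2)[OF J L] sub d\<theta> b' l' \<Lambda>_def]
  have lb: "l s * of_real (b (\<theta> s)) = 1" if "s \<in> J'" for s
    using b0[OF thJ[OF that]] by (simp add: l_def flip: of_real_mult)
  have "wronskian J' \<Lambda> s = -1" if s: "s \<in> J'" for s
  proof -
    have "wronskian J' \<Lambda> s = (l s * of_real (b (\<theta> s))) ^ 3 * wronskian J \<Gamma> (\<theta> s)"
      using ch(3)[OF s] by (simp add: wronskian_def power_mult_distrib)
    then show ?thesis using lb[OF s] W[OF thJ[OF s]] by simp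
  qed
  with L' have w': "wilczynski_lift J' (\<gamma> \<circ> \<theta>) \<Lambda>" by (simp add: wilczynski_lift_def)
  have "natural J' (\<gamma> \<circ> \<theta>)"
  proof (rule naturalI[OF J' w'])
    fix s assume s: "s \<in> J'"
    have "(cmod (l s))\<^sup>2 * b (\<theta> s) * b (\<theta> s) = 1"
      using b0[OF thJ[OF s]] by (simp add: l_def power2_eq_square field_simps norm_divide norm_inverse)
    then show "herm (\<Lambda> s) (vderiv J' \<Lambda> s) = \<i>"
      using ch(4)[OF s liftD(2)[OF L thJ[OF s]]] hb[OF thJ[OF s]]
      by (metis (no_types, opaque_lifting) mult.assoc mult.commute mult.right_neutral of_real_1 of_real_mult)
  qed
  then show ?thesis using that J' hom J'_def by blast
qed

section \<open>Topology of the projective plane\<close>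

lemma topspace_CP2 [simp]: "topspace CP2_topology = CP2"
proof -
  have "{z. z \<noteq> 0 \<and> pt z \<in> CP2} = - {0}" by (auto simp: CP2_def)
  then have "openin CP2_topology CP2" by (simp add: openin_CP2_topology open_Compl)
  moreover have "topspace CP2_topology \<subseteq> CP2"
    using openin_topspace[of CP2_topology] unfolding openin_CP2_topology by blast
  ultimately show ?thesis using openin_subset by blast
qed

lemma S_subset_CP2: "S \<subseteq> CP2"
  by (auto simp: S_def CP2_def null_vectors_def)

text \<open>In the quotient topology the preimage of an open set under \<open>pt\<close> is open by
  definition.\<close>

lemma continuous_map_pt:
  assumes "continuous_on J f" "\<And>t. t \<in> J \<Longrightarrow> f t \<noteq> 0"
  shows "continuous_map (top_of_set J) CP2_topology (\<lambda>t. pt (f t))"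
  unfolding continuous_map_def
proof (intro conjI allI impI)
  show "(\<lambda>t. pt (f t)) \<in> topspace (top_of_set J) \<rightarrow> topspace CP2_topology"
    using assms(2) by (auto simp: CP2_def)
  fix U assume "openin CP2_topology U"
  then have "open {z. z \<noteq> 0 \<and> pt z \<in> U}" by (simp add: openin_CP2_topology)
  from continuous_openin_preimage_gen[OF assms(1) this]
  have "openin (top_of_set J) (J \<inter> f -` {z. z \<noteq> 0 \<and> pt z \<in> U})" .
  moreover have "J \<inter> f -` {z. z \<noteq> 0 \<and> pt z \<in> U} = {x \<in> topspace (top_of_set J). pt (f x) \<in> U}"
    using assms(2) by auto
  ultimately show "openin (top_of_set J) {x \<in> topspace (top_of_set J). pt (f x) \<in> U}" by simp
qed

lemma pt_chart:
  assumes "p \<in> chart_dom i"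
  shows "chart i p \<noteq> 0" "pt (chart i p) = p"
proof -
  obtain z where z: "p = pt z" "z $ i \<noteq> 0" using assms by (auto simp: chart_dom_eq)
  show "chart i p \<noteq> 0" unfolding z(1) chart_pt[OF z(2)] using z(2) by (auto simp: vec_eq_iff)
  show "pt (chart i p) = p" unfolding z(1) chart_pt[OF z(2)] using z(2) by (simp add: pt_smult)
qed

text \<open>Continuity is local, and on each ball \<open>pt\<close> recovers the curve from its
  chart representative.\<close>

lemma smooth_curve_continuous:
  assumes J: "intvl J" and "smooth_curve J \<gamma>"
  shows "continuous_map (top_of_set J) CP2_topology \<gamma>"
  unfolding continuous_map_def
proof (intro conjI allI impI)
  show "\<gamma> \<in> topspace (top_of_set J) \<rightarrow> topspace CP2_topology"
    using assms S_subset_CP2 by (auto simp: smooth_curve_def)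
  fix U assume U: "openin CP2_topology U"
  show "openin (top_of_set J) {x \<in> topspace (top_of_set J). \<gamma> x \<in> U}"
  proof (subst openin_subopen, intro ballI)
    fix t assume "t \<in> {x \<in> topspace (top_of_set J). \<gamma> x \<in> U}"
    then have t: "t \<in> J" "\<gamma> t \<in> U" by auto
    obtain i e where e: "e > 0" "\<gamma> ` (J \<inter> ball t e) \<subseteq> chart_dom i"
      "smooth_fun (J \<inter> ball t e) (\<lambda>s. chart i (\<gamma> s))"
      using assms(2) t(1) unfolding smooth_curve_def by blast
    let ?B = "J \<inter> ball t e"
    have "continuous_on ?B (\<lambda>s. chart i (\<gamma> s))"
      by (rule smooth_fun_continuous[OF intvl_Int_ball[OF J t(1) e(1)] e(3)])
    then have "continuous_map (top_of_set ?B) CP2_topology (\<lambda>s. pt (chart i (\<gamma> s)))"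
      by (rule continuous_map_pt) (use e(2) pt_chart in blast)
    then have "openin (top_of_set ?B) {x \<in> ?B. pt (chart i (\<gamma> x)) \<in> U}"
      using U by (auto simp: continuous_map_def)
    moreover have "{x \<in> ?B. pt (chart i (\<gamma> x)) \<in> U} = {x \<in> ?B. \<gamma> x \<in> U}"
      using e(2) pt_chart(2) by (auto simp: image_subset_iff)
    moreover have "openin (top_of_set J) ?B" by (simp add: openin_open_Int)
    ultimately have "openin (top_of_set J) {x \<in> ?B. \<gamma> x \<in> U}" by (simp only:) (rule openin_trans)
    then show "\<exists>T. openin (top_of_set J) T \<and> t \<in> T \<and> T \<subseteq> {x \<in> topspace (top_of_set J). \<gamma> x \<in> U}"
      using t e(1) by (intro exI[of _ "{x \<in> ?B. \<gamma> x \<in> U}"]) auto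
  qed
qed

lemma continuous_map_act:
  assumes "A \<in> G"
  shows "continuous_map CP2_topology CP2_topology (act A)"
  unfolding continuous_map_def
proof (intro conjI allI impI)
  show "act A \<in> topspace CP2_topology \<rightarrow> topspace CP2_topology" using act_CP2[OF assms] by auto
  fix U assume "openin CP2_topology U"
  then have o: "open {z. z \<noteq> 0 \<and> pt z \<in> U}" by (simp add: openin_CP2_topology)
  have "continuous_on UNIV ((*v) A)"
    by (rule linear_continuous_on[OF bounded_bilinear.bounded_linear_right[OF bounded_bilinear_matrix_vec]])
  from open_vimage[OF o this] have "open ((*v) A -` {z. z \<noteq> 0 \<and> pt z \<in> U})" .
  moreover have "(*v) A -` {z. z \<noteq> 0 \<and> pt z \<in> U} = {z. z \<noteq> 0 \<and> pt z \<in> {p \<in> CP2. act A p \<in> U}}"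
    using G_mult_nonzero[OF assms] by (auto simp: act_pt CP2_def)
  ultimately show "openin CP2_topology {p \<in> topspace CP2_topology. act A p \<in> U}"
    by (simp add: openin_CP2_topology)
qed

lemma homeomorphic_map_act:
  assumes "A \<in> G"
  shows "homeomorphic_map CP2_topology CP2_topology (act A)"
proof -
  obtain B where B: "B \<in> G" "B ** A = mat 1" "A ** B = mat 1" using G_inverse[OF assms] by metis
  have "homeomorphic_maps CP2_topology CP2_topology (act A) (act B)"
    unfolding homeomorphic_maps_def
    using continuous_map_act[OF assms] continuous_map_act[OF B(1)] B(2,3) by (auto simp flip: act_mult)
  then show ?thesis using homeomorphic_map_maps by blast
qed

section \<open>Local parametrizations\<close>

lemma local_paramD:
  assumes "local_param K J \<gamma>"
  shows "intvl J" "generic_transversal J \<gamma>" "openin (subtopology CP2_topology K) (\<gamma> ` J)"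
    "homeomorphic_map (top_of_set J) (subtopology CP2_topology (\<gamma> ` J)) \<gamma>" "\<gamma> ` J \<subseteq> K"
  using assms openin_imp_subset unfolding local_param_def by blast+

lemma local_param_act:
  assumes A: "A \<in> G" and K: "K \<subseteq> CP2" and l: "local_param K J \<gamma>"
  shows "local_param (act A ` K) J (act A \<circ> \<gamma>)"
proof -
  note L = local_paramD[OF l]
  note h = homeomorphic_map_act[OF A]
  have sub: "homeomorphic_map (subtopology CP2_topology T) (subtopology CP2_topology (act A ` T)) (act A)"
    if "T \<subseteq> CP2" for T
    by (rule homeomorphic_map_subtopologies[OF h]) (use that act_CP2[OF A] in auto)
  have g: "\<gamma> ` J \<subseteq> CP2" using L(5) K by blast
  have "openin (subtopology CP2_topology (act A ` K)) (act A ` (\<gamma> ` J))"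
    using homeomorphic_map_openness[OF sub[OF K]] L(3,5) K by auto
  moreover have "homeomorphic_map (top_of_set J) (subtopology CP2_topology (act A ` \<gamma> ` J)) (act A \<circ> \<gamma>)"
    by (rule homeomorphic_map_compose[OF L(4) sub[OF g]])
  ultimately show ?thesis
    unfolding local_param_def using L(1) generic_act[OF L(1) A L(2)] by (simp add: image_comp)
qed

lemma local_param_preimage_open:
  assumes l: "local_param K J \<gamma>" and V: "openin (subtopology CP2_topology K) V"
  shows "openin (top_of_set J) {s \<in> J. \<gamma> s \<in> V}"
proof -
  note L = local_paramD[OF l]
  have "continuous_map (top_of_set J) (subtopology CP2_topology (\<gamma> ` J)) \<gamma>"
    using L(4) by (rule homeomorphic_imp_continuous_map)
  then have "continuous_map (top_of_set J) (subtopology CP2_topology K) \<gamma>"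
    using L(5) by (auto simp: continuous_map_in_subtopology)
  then show ?thesis using V by (auto simp: continuous_map_def)
qed

text \<open>A parametrization is a homeomorphism onto its arc, and the arc is open in K.\<close>

lemma local_param_image_open:
  assumes l: "local_param K J \<gamma>" and T: "openin (top_of_set J) T"
  shows "openin (subtopology CP2_topology K) (\<gamma> ` T)"
proof -
  note L = local_paramD[OF l]
  have TJ: "T \<subseteq> J" using T openin_imp_subset by blast
  have "openin (subtopology CP2_topology (\<gamma> ` J)) (\<gamma> ` T)"
    using homeomorphic_map_openness[OF L(4)] T TJ by simp
  moreover have "subtopology CP2_topology (\<gamma> ` J) = subtopology (subtopology CP2_topology K) (\<gamma> ` J)"
    using L(5) by (simp add: subtopology_subtopology inf.absorb2)
  ultimately show ?thesis using openin_trans_full L(3) by metis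
qed

section \<open>Bending and twist as functions on an embedded curve\<close>

lemma openin_intvl_ball:
  assumes "openin (top_of_set J) T" "t \<in> T"
  obtains e where "e > 0" "J \<inter> ball t e \<subseteq> T"
  using assms unfolding openin_contains_ball by (metis inf_commute)

text \<open>This gives the descriptions by \<open>THE\<close> in \<open>curve_bending\<close> and
  \<open>curve_twist\<close> their meaning. As the second arc is open in K, the change of parameter
  is defined on a ball around s1; its continuity is the regularity that \<open>transition\<close>
  asks for.\<close>

lemma natural_invariants_unique:
  assumes n1: "natural_local_param K J1 \<gamma>1" and n2: "natural_local_param K J2 \<gamma>2"
    and s: "s1 \<in> J1" "s2 \<in> J2" "\<gamma>1 s1 = \<gamma>2 s2"
  shows "bending J1 \<gamma>1 s1 = bending J2 \<gamma>2 s2" "twist J1 \<gamma>1 s1 = twist J2 \<gamma>2 s2"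
proof -
  have l: "local_param K J1 \<gamma>1" "local_param K J2 \<gamma>2" and nat: "natural J1 \<gamma>1" "natural J2 \<gamma>2"
    using n1 n2 by (auto simp: natural_local_param_def)
  note L1 = local_paramD[OF l(1)] and L2 = local_paramD[OF l(2)]
  obtain e where e: "e > 0" "J1 \<inter> ball s1 e \<subseteq> {s \<in> J1. \<gamma>1 s \<in> \<gamma>2 ` J2}"
    by (rule openin_intvl_ball[OF local_param_preimage_open[OF l(1) L2(3)], of s1]) (use s in auto)
  define U where "U = J1 \<inter> ball s1 e"
  have U: "intvl U" "U \<subseteq> J1" "s1 \<in> U" "\<And>s. s \<in> U \<Longrightarrow> \<gamma>1 s \<in> \<gamma>2 ` J2"
    using intvl_Int_ball[OF L1(1) s(1) e(1)] e s by (auto simp: U_def)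
  obtain g where g: "homeomorphic_maps (top_of_set J2) (subtopology CP2_topology (\<gamma>2 ` J2)) \<gamma>2 g"
    using L2(4) homeomorphic_map_maps by blast
  then have gi: "\<And>t. t \<in> J2 \<Longrightarrow> g (\<gamma>2 t) = t" and
    gc: "continuous_map (subtopology CP2_topology (\<gamma>2 ` J2)) (top_of_set J2) g"
    by (auto simp: homeomorphic_maps_def)
  have "continuous_map (top_of_set J1) CP2_topology \<gamma>1"
    using homeomorphic_imp_continuous_map[OF L1(4)] continuous_map_into_fulltopology by blast
  then have "continuous_map (top_of_set U) CP2_topology \<gamma>1"
    using U(2) by (rule continuous_map_from_subtopology_mono)
  then have "continuous_map (top_of_set U) (subtopology CP2_topology (\<gamma>2 ` J2)) \<gamma>1"
    using U(4) by (auto simp: continuous_map_in_subtopology)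
  from continuous_map_compose[OF this gc]
  have c: "continuous_map (top_of_set U) (top_of_set J2) (g \<circ> \<gamma>1)" .
  have ph: "continuous_on U (g \<circ> \<gamma>1)" "(g \<circ> \<gamma>1) ` U \<subseteq> J2"
    using c by (auto simp: continuous_map_in_subtopology)
  have eq: "\<gamma>1 s = \<gamma>2 ((g \<circ> \<gamma>1) s)" if "s \<in> U" for s using U(4)[OF that] gi by force
  have "(g \<circ> \<gamma>1) s1 = s2" using s gi by simp
  then show "bending J1 \<gamma>1 s1 = bending J2 \<gamma>2 s2" "twist J1 \<gamma>1 s1 = twist J2 \<gamma>2 s2"
    using transition[OF U(1,2) L1(1) L2(1) nat ph eq U(3)] by simp_all
qed

lemma curve_invariants:
  assumes "natural_local_param K J \<gamma>" "s \<in> J"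
  shows "curve_bending K (\<gamma> s) = bending J \<gamma> s" "curve_twist K (\<gamma> s) = twist J \<gamma> s"
  unfolding curve_bending_def curve_twist_def
  using natural_invariants_unique[OF _ assms(1) _ assms(2)] assms by (blast intro!: the_equality)+

lemma natural_local_param_exists:
  assumes l: "local_param K J \<gamma>"
  obtains J' \<gamma>' where "natural_local_param K J' \<gamma>'" "\<gamma>' ` J' = \<gamma> ` J"
proof -
  note L = local_paramD[OF l]
  obtain J' \<theta> \<sigma> where J': "intvl J'" "homeomorphism J J' \<sigma> \<theta>" "natural J' (\<gamma> \<circ> \<theta>)"
    by (rule natural_reparametrization[OF L(1,2)])
  have im: "\<theta> ` J' = J" using J'(2) by (auto simp: homeomorphism_def)
  have "homeomorphic_maps (top_of_set J') (top_of_set J) \<theta> \<sigma>"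
    using J'(2) unfolding homeomorphic_maps_def homeomorphism_def by (auto simp: continuous_map_in_subtopology)
  then have "homeomorphic_map (top_of_set J') (top_of_set J) \<theta>" using homeomorphic_map_maps by blast
  from homeomorphic_map_compose[OF this L(4)]
  have h: "homeomorphic_map (top_of_set J') (subtopology CP2_topology (\<gamma> ` J)) (\<gamma> \<circ> \<theta>)" .
  have im': "(\<gamma> \<circ> \<theta>) ` J' = \<gamma> ` J" unfolding image_comp[symmetric] im ..
  have "local_param K J' (\<gamma> \<circ> \<theta>)" unfolding local_param_def im'
    using J'(1,3) L(3) h by (simp add: natural_def)
  then show ?thesis using that[OF _ im'] J'(3) by (simp add: natural_local_param_def)
qed

lemma natural_local_param_act:
  assumes A: "A \<in> G" and K: "K \<subseteq> CP2" and l: "natural_local_param K J \<gamma>"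
  shows "natural_local_param (act A ` K) J (act A \<circ> \<gamma>)"
    "s \<in> J \<Longrightarrow> bending J (act A \<circ> \<gamma>) s = bending J \<gamma> s" "s \<in> J \<Longrightarrow> twist J (act A \<circ> \<gamma>) s = twist J \<gamma> s"
  using assms local_param_act[OF A K, of J \<gamma>] natural_act[OF _ A, of J \<gamma>] local_paramD(1)[of K J \<gamma>]
  unfolding natural_local_param_def by blast+

section \<open>Congruence\<close>

lemma embeddedD:
  assumes "embedded_generic_transversal K"
  shows "K \<subseteq> CP2" "K \<noteq> {}" "connectedin CP2_topology K"
    "p \<in> K \<Longrightarrow> \<exists>J \<gamma>. local_param K J \<gamma> \<and> p \<in> \<gamma> ` J"
  using assms S_subset_CP2 by (auto simp: embedded_generic_transversal_def)

lemma congruent_imp_diffeo: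
  assumes K: "embedded_generic_transversal K" and A: "A \<in> G"
  shows "diffeo K (act A ` K) (act A)" "orientation_preserving K (act A)"
    "preserves_natural_parameter K (act A)"
    "p \<in> K \<Longrightarrow> curve_bending (act A ` K) (act A p) = curve_bending K p"
    "p \<in> K \<Longrightarrow> curve_twist (act A ` K) (act A p) = curve_twist K p"
proof -
  note KC = embeddedD(1)[OF K]
  obtain B where B: "B \<in> G" "B ** A = mat 1" "A ** B = mat 1" using G_inverse[OF A] by metis
  have BA: "act B (act A p) = p" for p using B(2) by (simp flip: act_mult)
  have inj: "inj_on (act A) K" by (rule inj_onI) (metis BA)
  have sm: "smooth_curve J (act C \<circ> \<gamma>)" if "C \<in> G" "intvl J" "transversal J \<gamma>" for C J \<gamma>
    using transversal_act[OF that(2,1,3)] by (simp add: transversal_def)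
  have tr: "intvl J" "transversal J \<gamma>" if "local_param T J \<gamma>" for T J \<gamma>
    using local_paramD(1,2)[OF that] by (auto simp: generic_transversal_def)
  show "diffeo K (act A ` K) (act A)" unfolding diffeo_def
  proof (intro conjI)
    show "bij_betw (act A) K (act A ` K)" using inj by (simp add: bij_betw_def)
    show "smooth_map K (act A)" unfolding smooth_map_def using sm[OF A] tr by blast
    show "smooth_map (act A ` K) (the_inv_into K (act A))" unfolding smooth_map_def
    proof (intro allI impI)
      fix J \<gamma> assume l: "local_param (act A ` K) J \<gamma>"
      \<comment> \<open>The inverse of the restricted map is known to be the action of B only on the
        image curve, so a lift is transferred instead of equating the two maps.\<close>
      have eq: "(the_inv_into K (act A) \<circ> \<gamma>) t = (act B \<circ> \<gamma>) t" if t: "t \<in> J" for t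
      proof -
        have "\<gamma> t \<in> act A ` K" using local_paramD(5)[OF l] t by blast
        then obtain p where "p \<in> K" "\<gamma> t = act A p" by blast
        then show ?thesis using the_inv_into_f_f[OF inj] BA by simp
      qed
      obtain \<Gamma> where "lift J \<gamma> \<Gamma>" using tr(2)[OF l] by (auto simp: transversal_def)
      from lift_act[OF tr(1)[OF l] B(1) this] have "lift J (the_inv_into K (act A) \<circ> \<gamma>) (\<lambda>t. B *v \<Gamma> t)"
        unfolding lift_def using eq by auto
      then show "smooth_curve J (the_inv_into K (act A) \<circ> \<gamma>)"
        by (rule lift_smooth_curve[OF tr(1)[OF l]])
    qed
  qed
  show "orientation_preserving K (act A)"
    unfolding orientation_preserving_def using transversal_act A tr by blast
  show "preserves_natural_parameter K (act A)"
    unfolding preserves_natural_parameter_def natural_local_param_def using natural_act(1) A tr by blast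
  fix p assume p: "p \<in> K"
  obtain J0 \<gamma>0 where l: "local_param K J0 \<gamma>0" "p \<in> \<gamma>0 ` J0"
    using embeddedD(4)[OF K p] by blast
  obtain J \<gamma> where n: "natural_local_param K J \<gamma>" "\<gamma> ` J = \<gamma>0 ` J0"
    by (rule natural_local_param_exists[OF l(1)])
  then obtain s where s: "s \<in> J" "\<gamma> s = p" using l(2) by (metis imageE)
  note nA = natural_local_param_act[OF A KC n(1)]
  show "curve_bending (act A ` K) (act A p) = curve_bending K p"
    "curve_twist (act A ` K) (act A p) = curve_twist K p"
    using curve_invariants[OF n(1) s(1)] curve_invariants[OF nA(1) s(1)] nA(2,3)[OF s(1)] s(2) by simp_all
qed

text \<open>Scalar matrices in G act trivially, so only the actions of A and B, not the matrices,
  can be shown to agree.\<close>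

lemma act_rigid:
  assumes J: "intvl J" and U: "intvl U" "U \<subseteq> J" and n: "natural J \<gamma>" and A: "A \<in> G" "B \<in> G"
    and eq: "\<And>t. t \<in> U \<Longrightarrow> act A (\<gamma> t) = act B (\<gamma> t)" and p: "p \<in> CP2"
  shows "act A p = act B p"
proof -
  obtain \<Gamma> where w: "wilczynski_lift J \<gamma> \<Gamma>" using wlift J n by (auto simp: natural_def)
  obtain t where t: "t \<in> U" using U(1) by (auto simp: intvl_def)
  have L: "lift J \<gamma> \<Gamma>" using w by (simp add: wilczynski_lift_def)
  note d = lift_derivs(1,2)[OF J L]
  have v1: "vderiv U \<Gamma> s = vderiv J \<Gamma> s" if "s \<in> U" for s
    by (rule vderiv_eq[OF U(1) deriv_on_subset[OF d(1) U(2)] that])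
  have v2: "vderiv U (vderiv U \<Gamma>) s = vderiv J (vderiv J \<Gamma>) s" if "s \<in> U" for s
    by (rule vderiv_eq[OF U(1) deriv_on_cong[OF deriv_on_subset[OF d(2) U(2)]] that]) (simp_all add: v1)
  have sU: "smooth_fun U \<Gamma>" by (rule smooth_fun_subset[OF J U]) (use L in \<open>simp add: lift_def\<close>)
  have wU: "wilczynski_lift U \<gamma> \<Gamma>"
    using w sU U(2) unfolding wilczynski_lift_def lift_def wronskian_def by (auto simp: v1 v2)
  have wA: "wilczynski_lift U (act A \<circ> \<gamma>) (\<lambda>t. A *v \<Gamma> t)" by (rule wilczynski_act[OF U(1) A(1) wU])
  have "wilczynski_lift U (act B \<circ> \<gamma>) (\<lambda>t. B *v \<Gamma> t)" by (rule wilczynski_act[OF U(1) A(2) wU])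
  \<comment> \<open>Thus A \<Gamma> and B \<Gamma> are Wilczynski lifts of one curve over U, and
    their 2-jets at t are proportional with a single factor c. As the 2-jet of \<Gamma> is a basis,
    A = c B.\<close>
  then have wB: "wilczynski_lift U (act A \<circ> \<gamma>) (\<lambda>t. B *v \<Gamma> t)"
    using eq unfolding wilczynski_lift_def lift_def by simp
  obtain c where c: "cmod c = 1" "A *v \<Gamma> t = c *s (B *v \<Gamma> t)"
    "A *v vderiv U \<Gamma> t = c *s (B *v vderiv U \<Gamma> t)"
    "A *v vderiv U (vderiv U \<Gamma>) t = c *s (B *v vderiv U (vderiv U \<Gamma>) t)"
    using wilczynski_unique[OF U(1) wA wB t]
    by (metis (no_types, lifting) vderiv_mult_vec[OF U(1) sU t] vderiv_vderiv_mult_vec[OF U(1) sU t])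
  define M where "M = of_columns (\<Gamma> t) (vderiv U \<Gamma> t) (vderiv U (vderiv U \<Gamma>) t)"
  have cM: "A ** M = of_columns (c *s (B *v \<Gamma> t)) (c *s (B *v vderiv U \<Gamma> t)) (c *s (B *v vderiv U (vderiv U \<Gamma>) t))"
    unfolding M_def of_columns_mult[symmetric] c(2-4) ..
  have "det M = -1" using wU t by (simp add: wilczynski_lift_def wronskian_def M_def det3_of_columns)
  then have "invertible M" by (simp add: invertible_det_nz)
  then obtain N where N: "M ** N = mat 1" by (auto simp: invertible_def)
  have cv: "A *v z = c *s (B *v z)" for z
  proof -
    have "A *v z = (A ** M) *v (N *v z)"
      using N by (simp add: matrix_vector_mul_assoc flip: matrix_mul_assoc)
    also have "A ** M = of_columns (c *s (B *v \<Gamma> t)) (c *s (B *v vderiv U \<Gamma> t)) (c *s (B *v vderiv U (vderiv U \<Gamma>) t))"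
      by (rule cM)
    also have "\<dots> *v (N *v z) = c *s (of_columns (B *v \<Gamma> t) (B *v vderiv U \<Gamma> t) (B *v vderiv U (vderiv U \<Gamma>) t) *v (N *v z))"
      by (simp add: vec_eq_iff matrix_vector_mult_def[of "of_columns _ _ _"] sum_3 algebra_simps)
    also have "\<dots> = c *s ((B ** M) *v (N *v z))" by (simp add: M_def of_columns_mult)
    also have "\<dots> = c *s (B *v z)"
      using N by (simp add: matrix_vector_mul_assoc flip: matrix_mul_assoc)
    finally show ?thesis .
  qed
  obtain z where "p = pt z" using p by (auto simp: CP2_def)
  moreover have "c \<noteq> 0" using c(1) by auto
  ultimately show ?thesis by (simp add: act_pt cv pt_smult)
qed

text \<open>Since \<open>smooth_map\<close> speaks of parametrized arcs only, continuity is obtained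
  along each arc and carried to K by the openness of the parametrizations.\<close>

lemma continuous_map_embedded:
  assumes K: "embedded_generic_transversal K" and K': "K' \<subseteq> CP2" and f: "f ` K \<subseteq> K'"
    and sm: "smooth_map K f"
  shows "continuous_map (subtopology CP2_topology K) (subtopology CP2_topology K') f"
  unfolding continuous_map_in_subtopology
proof
  note KC = embeddedD(1)[OF K]
  show "f \<in> topspace (subtopology CP2_topology K) \<rightarrow> K'" using f by auto
  show "continuous_map (subtopology CP2_topology K) CP2_topology f"
    unfolding continuous_map_def
  proof (intro conjI allI impI)
    show "f \<in> topspace (subtopology CP2_topology K) \<rightarrow> topspace CP2_topology" using f K' by auto
    fix V assume V: "openin CP2_topology V"
    show "openin (subtopology CP2_topology K) {p \<in> topspace (subtopology CP2_topology K). f p \<in> V}"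
    proof (subst openin_subopen, intro ballI)
      fix p assume "p \<in> {p \<in> topspace (subtopology CP2_topology K). f p \<in> V}"
      then have p: "p \<in> K" "f p \<in> V" by auto
      obtain J \<gamma> where l: "local_param K J \<gamma>" "p \<in> \<gamma> ` J"
        using embeddedD(4)[OF K p(1)] by blast
      have "smooth_curve J (f \<circ> \<gamma>)" using sm l(1) by (simp add: smooth_map_def)
      from smooth_curve_continuous[OF local_paramD(1)[OF l(1)] this] V
      have "openin (top_of_set J) {s \<in> J. f (\<gamma> s) \<in> V}" by (auto simp: continuous_map_def)
      from local_param_image_open[OF l(1) this]
      show "\<exists>T. openin (subtopology CP2_topology K) T \<and> p \<in> T \<and>
          T \<subseteq> {p \<in> topspace (subtopology CP2_topology K). f p \<in> V}"
        using l p local_paramD(5)[OF l(1)] KC by (intro exI[of _ "\<gamma> ` {s \<in> J. f (\<gamma> s) \<in> V}"]) auto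
    qed
  qed
qed

lemma diffeo_imp_congruent:
  assumes K: "embedded_generic_transversal K" and K': "embedded_generic_transversal K'"
    and h: "diffeo K K' h" and nat: "preserves_natural_parameter K h"
    and b: "\<And>p. p \<in> K \<Longrightarrow> curve_bending K' (h p) = curve_bending K p"
    and tw: "\<And>p. p \<in> K \<Longrightarrow> curve_twist K' (h p) = curve_twist K p"
  shows "congruent_curves K K'"
proof -
  note KC = embeddedD(1)[OF K] embeddedD(1)[OF K']
  have bij: "bij_betw h K K'" using h by (simp add: diffeo_def)
  then have hK: "h ` K = K'" and inj: "inj_on h K" by (auto simp: bij_betw_def)
  let ?X = "subtopology CP2_topology K" and ?Y = "subtopology CP2_topology K'"
  \<comment> \<open>That h is a homeomorphism makes the images of arcs of K relatively open arcs of
    K'. Hence h composed with a natural local parametrization is again one, and the invariants of K'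
    can be evaluated along it.\<close>
  have "homeomorphic_maps ?X ?Y h (the_inv_into K h)"
    unfolding homeomorphic_maps_def
  proof (intro conjI)
    show "continuous_map ?X ?Y h"
      by (rule continuous_map_embedded[OF K KC(2)]) (use h hK in \<open>auto simp: diffeo_def\<close>)
    show "continuous_map ?Y ?X (the_inv_into K h)"
      by (rule continuous_map_embedded[OF K' KC(1)])
        (use h hK the_inv_into_into[OF inj] in \<open>auto simp: diffeo_def\<close>)
  qed (use KC hK inj in \<open>auto simp: the_inv_into_f_f f_the_inv_into_f\<close>)
  then have hom: "homeomorphic_map ?X ?Y h" using homeomorphic_map_maps by blast
  have loc: "\<exists>A. A \<in> G \<and> (\<forall>s\<in>J. h (\<gamma> s) = act A (\<gamma> s))" if n: "natural_local_param K J \<gamma>" for J \<gamma>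
  proof -
    have l: "local_param K J \<gamma>" and nJ: "natural J \<gamma>" using n by (auto simp: natural_local_param_def)
    note L = local_paramD[OF l]
    have nh: "natural J (h \<circ> \<gamma>)" using nat n by (simp add: preserves_natural_parameter_def)
    have "openin ?Y (h ` \<gamma> ` J)" using homeomorphic_map_openness[OF hom] L(3,5) KC by auto
    moreover have "homeomorphic_map (top_of_set J) (subtopology CP2_topology (h ` \<gamma> ` J)) (h \<circ> \<gamma>)"
    proof (rule homeomorphic_map_compose[OF L(4)])
      have "homeomorphic_map (subtopology ?X (\<gamma> ` J)) (subtopology ?Y (h ` \<gamma> ` J)) h"
        by (rule homeomorphic_map_subtopologies[OF hom]) (use L(5) hK KC in auto)
      moreover have "K \<inter> \<gamma> ` J = \<gamma> ` J" "K' \<inter> h ` \<gamma> ` J = h ` \<gamma> ` J" using L(5) hK by auto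
      ultimately show "homeomorphic_map (subtopology CP2_topology (\<gamma> ` J)) (subtopology CP2_topology (h ` \<gamma> ` J)) h"
        by (simp add: subtopology_subtopology)
    qed
    ultimately have nh': "natural_local_param K' J (h \<circ> \<gamma>)"
      unfolding natural_local_param_def local_param_def image_comp[symmetric] using L(1) nh
      by (simp add: natural_def)
    have "bending J (h \<circ> \<gamma>) s = bending J \<gamma> s" "twist J (h \<circ> \<gamma>) s = twist J \<gamma> s" if s: "s \<in> J" for s
      using curve_invariants[OF n s] curve_invariants[OF nh' s] b[of "\<gamma> s"] tw[of "\<gamma> s"] L(5) s by auto
    from natural_congruence[OF L(1) nJ nh this] show ?thesis by (metis comp_apply)
  qed
  have cov: "\<exists>J \<gamma>. natural_local_param K J \<gamma> \<and> p \<in> \<gamma> ` J" if p: "p \<in> K" for p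
  proof -
    obtain J0 \<gamma>0 where l: "local_param K J0 \<gamma>0" "p \<in> \<gamma>0 ` J0"
      using embeddedD(4)[OF K p] by blast
    from natural_local_param_exists[OF l(1)] show ?thesis using l(2) by metis
  qed
  obtain p0 where p0: "p0 \<in> K" using embeddedD(2)[OF K] by blast
  obtain J0 \<gamma>0 where n0: "natural_local_param K J0 \<gamma>0" "p0 \<in> \<gamma>0 ` J0" using cov[OF p0] by blast
  obtain A where A: "A \<in> G" "\<And>s. s \<in> J0 \<Longrightarrow> h (\<gamma>0 s) = act A (\<gamma>0 s)" using loc[OF n0(1)] by blast
  have n_open: "openin ?X (\<gamma> ` J)" if "natural_local_param K J \<gamma>" for J \<gamma>
    using that local_paramD(3) by (auto simp: natural_local_param_def)
  \<comment> \<open>Agreement is required on a neighbourhood. This makes E open at once, and it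
    provides a whole subinterval of agreement wherever an arc meets E, as \<open>act_rigid\<close>
    demands.\<close>
  define E where "E = {p. \<exists>V. openin ?X V \<and> p \<in> V \<and> (\<forall>q\<in>V. h q = act A q)}"
  have EK: "E \<subseteq> K" unfolding E_def using openin_imp_subset by blast
  have p0E: "p0 \<in> E" unfolding E_def using n_open[OF n0(1)] n0(2) A(2) by blast
  have Eo: "openin ?X E" unfolding E_def by (subst openin_subopen) blast
  have "openin ?X (K - E)"
  proof (subst openin_subopen, intro ballI)
    fix p assume p: "p \<in> K - E"
    obtain J \<gamma> where n: "natural_local_param K J \<gamma>" "p \<in> \<gamma> ` J" using cov p by blast
    then have l: "local_param K J \<gamma>" and nJ: "natural J \<gamma>" by (auto simp: natural_local_param_def)
    note L = local_paramD[OF l]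
    obtain B where B: "B \<in> G" "\<And>s. s \<in> J \<Longrightarrow> h (\<gamma> s) = act B (\<gamma> s)" using loc[OF n(1)] by blast
    \<comment> \<open>An arc that meets E lies entirely in E, because its own element B then acts as
      A does; so an arc through a point outside E avoids E.\<close>
    have "\<gamma> ` J \<inter> E = {}"
    proof (rule ccontr)
      assume "\<gamma> ` J \<inter> E \<noteq> {}"
      then obtain s where s: "s \<in> J" "\<gamma> s \<in> E" by blast
      then obtain V where V: "openin ?X V" "\<gamma> s \<in> V" "\<And>q. q \<in> V \<Longrightarrow> h q = act A q"
        unfolding E_def by blast
      obtain e where e: "e > 0" "J \<inter> ball s e \<subseteq> {s \<in> J. \<gamma> s \<in> V}"
        by (rule openin_intvl_ball[OF local_param_preimage_open[OF l V(1)], of s]) (use s V in auto)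
      have "act A (\<gamma> t) = act B (\<gamma> t)" if "t \<in> J \<inter> ball s e" for t
        using V(3)[of "\<gamma> t"] B(2)[of t] e(2) that by force
      then have AB: "act A q = act B q" if "q \<in> CP2" for q
        using act_rigid[OF L(1) intvl_Int_ball[OF L(1) s(1) e(1)] _ nJ A(1) B(1) _ that] by blast
      have "p \<in> E" unfolding E_def
      proof (intro CollectI exI conjI ballI)
        show "openin ?X (\<gamma> ` J)" by (rule L(3))
        show "p \<in> \<gamma> ` J" by (rule n(2))
        fix q assume q: "q \<in> \<gamma> ` J"
        then obtain t where t: "t \<in> J" "q = \<gamma> t" by blast
        have "q \<in> CP2" using q L(5) KC(1) by blast
        then show "h q = act A q" using B(2)[OF t(1)] AB t(2) by simp
      qed
      then show False using p by blast
    qed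
    then show "\<exists>T. openin ?X T \<and> p \<in> T \<and> T \<subseteq> K - E" using L(3,5) n(2) by blast
  qed
  then have "closedin ?X E" unfolding closedin_def using EK KC by (auto simp: inf.absorb2)
  moreover have "connected_space ?X"
    using embeddedD(3)[OF K] by (simp add: connectedin_def)
  ultimately have "E = K" using connected_space_clopen_in[of ?X] Eo p0E KC by (auto simp: inf.absorb2)
  then have "h q = act A q" if "q \<in> K" for q using that unfolding E_def by blast
  then have "K' = act A ` K" using hK by auto
  then show ?thesis using A(1) by (auto simp: congruent_curves_def)
qed

theorem theorem3p9:
  shows "(\<forall>K K'. embedded_generic_transversal K \<and> embedded_generic_transversal K' \<longrightarrow>
            (congruent_curves K K' \<longleftrightarrow>
              (\<exists>h. diffeo K K' h \<and> orientation_preserving K h \<and>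
                   preserves_natural_parameter K h \<and>
                   (\<forall>p\<in>K. curve_bending K' (h p) = curve_bending K p) \<and>
                   (\<forall>p\<in>K. curve_twist K' (h p) = curve_twist K p))))
       \<and> (\<forall>(J :: real set) (\<kappa> :: real \<Rightarrow> real) (\<tau> :: real \<Rightarrow> real).
            intvl J \<and> smooth_fun J \<kappa> \<and> smooth_fun J \<tau> \<longrightarrow>
            (\<exists>\<gamma>. generic_transversal J \<gamma> \<and> natural J \<gamma> \<and>
                 (\<forall>t\<in>J. bending J \<gamma> t = \<kappa> t) \<and>
                 (\<forall>t\<in>J. twist J \<gamma> t = \<tau> t)))"
proof (intro conjI allI impI)
  fix K K' :: "point set"
  assume K: "embedded_generic_transversal K \<and> embedded_generic_transversal K'"
  show "congruent_curves K K' \<longleftrightarrow>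
              (\<exists>h. diffeo K K' h \<and> orientation_preserving K h \<and>
                   preserves_natural_parameter K h \<and>
                   (\<forall>p\<in>K. curve_bending K' (h p) = curve_bending K p) \<and>
                   (\<forall>p\<in>K. curve_twist K' (h p) = curve_twist K p))"
    (is "_ \<longleftrightarrow> ?R")
  proof
    assume "congruent_curves K K'"
    then obtain A where A: "A \<in> G" "K' = act A ` K" by (auto simp: congruent_curves_def)
    show ?R unfolding A(2) using congruent_imp_diffeo[OF _ A(1), of K] K by (intro exI[of _ "act A"]) auto
  next
    assume ?R
    then obtain h where "diffeo K K' h" "preserves_natural_parameter K h"
      "\<And>p. p \<in> K \<Longrightarrow> curve_bending K' (h p) = curve_bending K p"
      "\<And>p. p \<in> K \<Longrightarrow> curve_twist K' (h p) = curve_twist K p" by blast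
    then show "congruent_curves K K'" using K by (intro diffeo_imp_congruent) auto
  qed
next
  fix J and k \<tau> :: "real \<Rightarrow> real"
  assume "intvl J \<and> smooth_fun J k \<and> smooth_fun J \<tau>"
  then obtain \<gamma> where "natural J \<gamma>" "\<And>t. t \<in> J \<Longrightarrow> bending J \<gamma> t = k t" "\<And>t. t \<in> J \<Longrightarrow> twist J \<gamma> t = \<tau> t"
    using natural_existence by blast
  then show "\<exists>\<gamma>. generic_transversal J \<gamma> \<and> natural J \<gamma> \<and> (\<forall>t\<in>J. bending J \<gamma> t = k t) \<and> (\<forall>t\<in>J. twist J \<gamma> t = \<tau> t)"
    unfolding natural_def by blast
qed

end
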